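(* Let $0<L<1$. Let $(a_n)_{n\ge0}$ be a non-increasing sequence of positive numbers with $a_0=1$, and suppose there are constants $0<c_1\le C_1<\infty$ with $c_1 n^{\frac12(L-1)}\le a_n\le C_1 n^{\frac12(L-1)}$ for all $n\ge1$. Let $F(z)=\sum_{n\ge0}\zeta_n a_n z^n$, let $\sigma_F(r)^2=\sum_{n\ge0}a_n^2r^{2n}$, and for $0<r<1$ let $\mathrm{Hole}(r)=\{F\ne0\text{ on }\{|z|\le r\}\}$. Then, as $r\to1^-$, $$\frac{1-L+o(1)}{2}\,\sigma_F(r)^2\log\frac1{1-r}\;\le\;-\log\mathbb P[\mathrm{Hole}(r)]\;\le\;(1-L+o(1))\,\sigma_F(r)^2\log\frac1{1-r},$$ where $o(1)$ denotes quantities tending to $0$ as $r\to1^-$.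
   Context: $(\zeta_n)_{n\ge0}$ is a sequence of independent standard complex Gaussian random variables: each has density $\frac1\pi e^{-|z|^2}$ with respect to planar Lebesgue measure on $\mathbb C$. The series almost surely has radius of convergence $1$, and $\sigma_F(r)^2=\mathbb E[|F(re^{i\theta})|^2]$ for every real $\theta$. *)

theory Defs
  imports "HOL-Probability.Probability"
begin

definition std_complex_gaussian :: "'w measure \<Rightarrow> ('w \<Rightarrow> complex) \<Rightarrow> bool" where
  "std_complex_gaussian M X \<longleftrightarrow>
     distributed M lborel X (\<lambda>z. ennreal (1 / pi * exp (- (cmod z)\<^sup>2)))"

definition gaf :: "(nat \<Rightarrow> 'w \<Rightarrow> complex) \<Rightarrow> (nat \<Rightarrow> real) \<Rightarrow> 'w \<Rightarrow> complex \<Rightarrow> complex" where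
  "gaf \<zeta> a \<omega> z = (\<Sum>n. \<zeta> n \<omega> * of_real (a n) * z ^ n)"

definition sigma_sq :: "(nat \<Rightarrow> real) \<Rightarrow> real \<Rightarrow> real" where
  "sigma_sq a r = (\<Sum>n. (a n)\<^sup>2 * r ^ (2 * n))"

(* Almost surely the series defining F has radius of convergence 1.  The convergence condition
   removes only a null set of outcomes, on which suminf would return a junk value and
   the event might fail to be measurable (and measure would then silently be 0). *)
definition Hole ::
    "'w measure \<Rightarrow> (nat \<Rightarrow> 'w \<Rightarrow> complex) \<Rightarrow> (nat \<Rightarrow> real) \<Rightarrow> real \<Rightarrow> 'w set" where
  "Hole M \<zeta> a r =
     {\<omega> \<in> space M. conv_radius (\<lambda>n. \<zeta> n \<omega> * of_real (a n)) \<ge> 1 \<and>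
        (\<forall>z. cmod z \<le> r \<longrightarrow> gaf \<zeta> a \<omega> z \<noteq> 0)}"

end

theory Submission
  imports Defs "HOL-Complex_Analysis.Complex_Analysis" "HOL-Real_Asymp.Real_Asymp"
begin

text \<open>
  Upper bound for the hole probability. Split \<open>F = F1 + F2\<close> into independent parts, where the coefficients
  of \<open>F2\<close> on \<open>|z| = r\<close> have standard deviations that are constant on blocks of \<open>N\<close> consecutive indices;
  by orthogonality of roots of unity, the values of \<open>F2\<close> at any \<open>N\<close> equally spaced points of the circle
  are independent complex Gaussians with a common variance \<open>s\<^sup>2\<close>. Let
  \<open>u y = E ln (max |y| |\<xi>|) = E ln |y + \<xi>|\<close> for a standard complex Gaussian \<open>\<xi>\<close>. The function \<open>u\<close> is
  subharmonic and exceeds \<open>ln |y|\<close> by about \<open>exp (- |y|\<^sup>2)\<close>. If \<open>F\<close> has no zeros and \<open>|F 0| \<le> A\<close>, then the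
  circular mean of \<open>u (F1 / s) - ln |F / s|\<close> is at least the excess \<open>e\<close> of \<open>u\<close> at \<open>F 0 / s\<close>. Conditionally
  on \<open>F1\<close>, the sum of this function over \<open>N\<close> equally spaced points has independent centred terms, so an
  exponential moment bounds the probability by \<open>exp (- c N e\<^sup>2)\<close>. With \<open>d = 1 - r\<close>, one takes \<open>N\<close> slightly
  below \<open>1 / d\<close> and \<open>A\<^sup>2\<close> slightly below \<open>(1 - L) / 2 * s\<^sup>2 * ln (1 / d)\<close>; then \<open>N e\<^sup>2\<close> is far larger than
  \<open>A\<^sup>2\<close>, and \<open>P(|F 0| > A) = exp (- A\<^sup>2)\<close> dominates.

  Lower bound. There is a hole if \<open>|\<zeta>\<^sub>0| > A\<close> and the rest of the series is at most \<open>A\<close> on the circle. By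
  Bernstein's inequality the latter follows from a bound on a grid of \<open>O((1 / d) ln (1 / d))\<close> points. By the
  Khatri--Sidak inequality, a consequence of the Prekopa--Leindler inequality, the probability of the
  grid bound is at least the product of the probabilities of its parts. With \<open>A\<^sup>2\<close> slightly above
  \<open>(1 - L) * \<sigma>\<^sup>2 * ln (1 / d)\<close>, each factor is at least \<open>1 - d powr (1 - L)\<close>, and the product costs only
  \<open>exp (- o(A\<^sup>2))\<close>.
\<close>

section \<open>The complex Gaussian measure\<close>

text \<open>Both exponents come from comparing powers of \<open>d\<close>, where
  \<open>A\<^sup>2\<close> has order \<open>d powr (- L)\<close> times a logarithm. In the upper
  bound take \<open>A\<^sup>2 = \<tau> * s\<^sup>2 * ln (1 / d)\<close>; then the excess
  \<open>e\<close> is about \<open>d powr \<tau>\<close>, so \<open>N * e\<^sup>2\<close> is about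
  \<open>d powr (2 * \<tau> - 1)\<close> and wins for \<open>2 * \<tau> < 1 - L\<close>. In the
  lower bound take \<open>A\<^sup>2 = \<tau> * \<sigma>\<^sup>2 * ln (1 / d)\<close>; then each of
  about \<open>1 / d\<close> grid points fails with probability about \<open>d powr \<tau>\<close>,
  for a cost \<open>d powr (\<tau> - 1)\<close>, negligible for \<open>\<tau> > 1 - L\<close>. The
  factor two between the bounds is thus the square in \<open>e\<^sup>2\<close>. The obstacle in the
  upper bound is that mean value inequalities hold for the whole circle, whereas independence is
  available only at \<open>N\<close> equally spaced points. Instead of discretizing, the proof
  averages the exponential of the \<open>N\<close>-point sum over all rotations of the grid:
  convexity of \<open>exp\<close> bounds this average from below on the hole event, and Fubini
  bounds its expectation one rotation at a time. Hence there is no discretization error and no union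
  over grids.\<close>

definition cgauss :: "complex measure" where
  "cgauss = density lborel (\<lambda>z. ennreal (1 / pi * exp (- (cmod z)\<^sup>2)))"

lemma sets_cgauss [simp, measurable_cong]: "sets cgauss = sets borel"
  by (simp add: cgauss_def)

lemma space_cgauss [simp]: "space cgauss = UNIV"
  by (simp add: cgauss_def)

lemma nn_integral_cgauss:
  assumes [measurable]: "f \<in> borel_measurable borel"
  shows "(\<integral>\<^sup>+z. f z \<partial>cgauss) = (\<integral>\<^sup>+z. ennreal (1 / pi * exp (- (cmod z)\<^sup>2)) * f z \<partial>lborel)"
  by (simp add: cgauss_def nn_integral_density)

lemma emeasure_annulus_complex:
  assumes "0 \<le> x"
  shows "emeasure lborel {z::complex. x < (cmod z)\<^sup>2 \<and> (cmod z)\<^sup>2 \<le> v} = ennreal (pi * (v - x))"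
proof (cases "x \<le> v")
  case True
  have *: "{z::complex. x < (cmod z)\<^sup>2 \<and> (cmod z)\<^sup>2 \<le> v} = cball 0 (sqrt v) - cball 0 (sqrt x)"
  proof -
    have "(cmod z)\<^sup>2 \<le> w \<longleftrightarrow> cmod z \<le> sqrt w" if "0 \<le> w" for w and z :: complex
      using that by (metis abs_norm_cancel real_sqrt_abs real_sqrt_le_iff)
    note sq = this
    show ?thesis
    proof (rule set_eqI)
      fix z :: complex
      show "z \<in> {z. x < (cmod z)\<^sup>2 \<and> (cmod z)\<^sup>2 \<le> v} \<longleftrightarrow> z \<in> cball 0 (sqrt v) - cball 0 (sqrt x)"
        using sq[OF assms, of z] sq[of v z] assms True by (auto simp: not_le[symmetric])
    qed
  qed
  have "emeasure lborel (cball (0::complex) (sqrt v) - cball 0 (sqrt x))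
      = emeasure lborel (cball (0::complex) (sqrt v)) - emeasure lborel (cball (0::complex) (sqrt x))"
    using True assms by (intro emeasure_Diff subset_cball) (auto simp: emeasure_cball)
  also have "\<dots> = ennreal (pi * v) - ennreal (pi * x)"
    using True assms by (simp add: emeasure_cball unit_ball_vol_2)
  also have "\<dots> = ennreal (pi * v - pi * x)"
    using True assms by (intro ennreal_minus) auto
  finally show ?thesis unfolding * by (simp add: algebra_simps)
next
  case False
  then have *: "{z::complex. x < (cmod z)\<^sup>2 \<and> (cmod z)\<^sup>2 \<le> v} = {}" by auto
  have "pi * (v - x) \<le> 0" using False by (simp add: mult_le_0_iff)
  then show ?thesis unfolding * by (simp add: ennreal_neg)
qed

lemma nn_integral_exp_tail: "(\<integral>\<^sup>+v. ennreal (exp (- v)) * indicator {x..} v \<partial>lborel) = ennreal (exp (- x))" for x :: real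
proof -
  have "(\<integral>\<^sup>+v. ennreal (exp (- v)) * indicator {x..} v \<partial>lborel) = ennreal (0 - (- exp (- x)))"
  proof (rule nn_integral_FTC_atLeast[where F = "\<lambda>v. - exp (- v)"])
    show "((\<lambda>v::real. - exp (- v)) \<longlongrightarrow> 0) at_top" by real_asymp
  qed (auto intro!: derivative_eq_intros)
  then show ?thesis by simp
qed

text \<open>That is, \<open>(cmod z)\<^sup>2\<close> is exponentially distributed. Writing
  \<open>exp (- (cmod z)\<^sup>2)\<close> as the integral of \<open>exp (- v)\<close> over
  \<open>v\<close> from \<open>(cmod z)\<^sup>2\<close> to infinity and applying Fubini leaves only
  areas of annuli, which replaces polar coordinates.\<close>

lemma emeasure_cgauss_tail:
  assumes "0 \<le> x"
  shows "emeasure cgauss {z. x < (cmod z)\<^sup>2} = ennreal (exp (- x))"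
proof -
  have "emeasure cgauss {z. x < (cmod z)\<^sup>2}
      = (\<integral>\<^sup>+z. ennreal (1 / pi * exp (- (cmod z)\<^sup>2)) * indicator {z. x < (cmod z)\<^sup>2} z \<partial>lborel)"
    unfolding cgauss_def by (subst emeasure_density) auto
  also have "\<dots> = (\<integral>\<^sup>+z. (\<integral>\<^sup>+v. ennreal (1 / pi) * (ennreal (exp (- v)) *
      indicator {z. x < (cmod z)\<^sup>2 \<and> (cmod z)\<^sup>2 \<le> v} z) \<partial>lborel) \<partial>lborel)"
  proof (rule nn_integral_cong)
    fix z :: complex
    have "(\<integral>\<^sup>+v. ennreal (1 / pi) * (ennreal (exp (- v)) *
      indicator {z. x < (cmod z)\<^sup>2 \<and> (cmod z)\<^sup>2 \<le> v} z) \<partial>lborel) =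
      (\<integral>\<^sup>+v. (ennreal (1 / pi) * indicator {z. x < (cmod z)\<^sup>2} z) * (ennreal (exp (- v)) *
      indicator {(cmod z)\<^sup>2..} v) \<partial>lborel)"
      by (intro nn_integral_cong) (auto split: split_indicator)
    also have "\<dots> = ennreal (1 / pi) * indicator {z. x < (cmod z)\<^sup>2} z * ennreal (exp (- (cmod z)\<^sup>2))"
      by (subst nn_integral_cmult) (auto simp: nn_integral_exp_tail)
    finally show "ennreal (1 / pi * exp (- (cmod z)\<^sup>2)) * indicator {z. x < (cmod z)\<^sup>2} z =
       (\<integral>\<^sup>+v. ennreal (1 / pi) * (ennreal (exp (- v)) *
      indicator {z. x < (cmod z)\<^sup>2 \<and> (cmod z)\<^sup>2 \<le> v} z) \<partial>lborel)"
      by (simp add: ennreal_mult'[symmetric] mult_ac)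
        (simp add: ennreal_mult'[symmetric] mult.assoc[symmetric])
  qed
  also have "\<dots> = (\<integral>\<^sup>+v. (\<integral>\<^sup>+z. ennreal (1 / pi) * (ennreal (exp (- v)) *
      indicator {z::complex. x < (cmod z)\<^sup>2 \<and> (cmod z)\<^sup>2 \<le> v} z) \<partial>lborel) \<partial>lborel)"
    by (rule lborel_pair.Fubini') measurable
  also have "\<dots> = (\<integral>\<^sup>+v. ennreal (exp (- v) * (v - x)) * indicator {x..} v \<partial>lborel)"
  proof (rule nn_integral_cong)
    fix v :: real
    have "(\<integral>\<^sup>+z. ennreal (1 / pi) * (ennreal (exp (- v)) *
      indicator {z::complex. x < (cmod z)\<^sup>2 \<and> (cmod z)\<^sup>2 \<le> v} z) \<partial>lborel)
      = ennreal (1 / pi) * (ennreal (exp (- v)) * ennreal (pi * (v - x)))"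
      by (subst nn_integral_cmult, measurable, subst nn_integral_cmult_indicator)
        (auto simp: emeasure_annulus_complex assms)
    also have "\<dots> = ennreal (exp (- v) * (v - x)) * indicator {x..} v"
    proof (cases "x \<le> v")
      case True
      then show ?thesis
        by (simp add: ennreal_mult'[symmetric])
    next
      case False
      then have "pi * (v - x) \<le> 0" by (simp add: mult_le_0_iff)
      then show ?thesis using False by (simp add: ennreal_neg)
    qed
    finally show "(\<integral>\<^sup>+z. ennreal (1 / pi) * (ennreal (exp (- v)) *
      indicator {z::complex. x < (cmod z)\<^sup>2 \<and> (cmod z)\<^sup>2 \<le> v} z) \<partial>lborel) = \<dots>" .
  qed
  also have "\<dots> = ennreal (0 - (- (x - x + 1) * exp (- x)))"
  proof (rule nn_integral_FTC_atLeast[where F = "\<lambda>v. - (v - x + 1) * exp (- v)"])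
    show "((\<lambda>v::real. - (v - x + 1) * exp (- v)) \<longlongrightarrow> 0) at_top" by real_asymp
  qed (auto intro!: derivative_eq_intros simp: algebra_simps)
  finally show ?thesis by simp
qed

lemma AE_cgauss_ne: "AE z in cgauss. z \<noteq> c"
  unfolding cgauss_def by (subst AE_density) (auto intro!: AE_I[of _ _ "{c}"])

lemma prob_space_cgauss: "prob_space cgauss"
proof
  \<comment> \<open>The total mass is the tail at level 0, because the origin is a null set.\<close>
  have "emeasure cgauss (space cgauss) = emeasure cgauss {z. 0 < (cmod z)\<^sup>2}"
    using AE_cgauss_ne[of 0] by (intro emeasure_eq_AE) auto
  then show "emeasure cgauss (space cgauss) = 1"
    using emeasure_cgauss_tail[of 0] by simp
qed

interpretation cgauss: prob_space cgauss by (rule prob_space_cgauss)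

lemma measure_cgauss_tail:
  assumes "0 \<le> x"
  shows "measure cgauss {z. x < (cmod z)\<^sup>2} = exp (- x)"
  using emeasure_cgauss_tail[OF assms] by (simp add: measure_def)

lemma measure_cgauss_cball:
  assumes "0 \<le> x"
  shows "measure cgauss {z. (cmod z)\<^sup>2 \<le> x} = 1 - exp (- x)"
proof -
  have "{z. (cmod z)\<^sup>2 \<le> x} = space cgauss - {z. x < (cmod z)\<^sup>2}" by auto
  then show ?thesis
    using assms by (simp only:) (subst cgauss.prob_compl, auto simp: measure_cgauss_tail)
qed

section \<open>Rotation invariance of Lebesgue measure and of the complex Gaussian\<close>

lemma nn_integral_lborel_affine:
  fixes f :: "'a::euclidean_space \<Rightarrow> ennreal"
  assumes [measurable]: "f \<in> borel_measurable borel" and c: "c \<noteq> 0"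
  shows "(\<integral>\<^sup>+x. f (t + c *\<^sub>R x) \<partial>lborel) = ennreal (1 / \<bar>c\<bar> ^ DIM('a)) * (\<integral>\<^sup>+x. f x \<partial>lborel)"
proof -
  have "(\<integral>\<^sup>+x. f x \<partial>lborel) = ennreal (\<bar>c\<bar> ^ DIM('a)) * (\<integral>\<^sup>+x. f (t + c *\<^sub>R x) \<partial>lborel)"
    by (subst lborel_affine[OF c, of t])
       (simp add: nn_integral_density nn_integral_distr nn_integral_cmult)
  then show ?thesis using c by (simp add: mult.assoc[symmetric] ennreal_mult'[symmetric])
qed

text \<open>Rotations are handled as a product of shears, so that only Fubini and the invariance of
  Lebesgue measure under translations and real dilations are needed.\<close>

lemma nn_integral_lborel_rotate:
  fixes h :: "'a::euclidean_space \<times> 'a \<Rightarrow> ennreal" and T T' :: "'a \<Rightarrow> 'a"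
  assumes h [measurable]: "h \<in> borel_measurable borel" and c: "c \<noteq> 0"
    and T: "linear T" "linear T'" and TT: "\<And>x. T' (T x) = (1 - c\<^sup>2) *\<^sub>R x"
  shows "(\<integral>\<^sup>+b. \<integral>\<^sup>+a. h (c *\<^sub>R a + T b, c *\<^sub>R b - T' a) \<partial>lborel \<partial>lborel)
       = (\<integral>\<^sup>+b. \<integral>\<^sup>+a. h (a, b) \<partial>lborel \<partial>lborel)"
proof -
  have h' [measurable]: "h \<in> borel_measurable (borel \<Otimes>\<^sub>M borel)"
    using h by (simp add: borel_prod)
  have [measurable]: "T \<in> borel_measurable borel" "T' \<in> borel_measurable borel"
    using T by (auto intro!: borel_measurable_continuous_onI linear_continuous_on linear_conv_bounded_linear[THEN iffD1])
  let ?D = "ennreal (1 / \<bar>c\<bar> ^ DIM('a))"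
  have "(\<integral>\<^sup>+b. \<integral>\<^sup>+a. h (c *\<^sub>R a + T b, c *\<^sub>R b - T' a) \<partial>lborel \<partial>lborel)
     = (\<integral>\<^sup>+b. \<integral>\<^sup>+a. h (T b + c *\<^sub>R a, (1 / c) *\<^sub>R b - (1 / c) *\<^sub>R T' (T b + c *\<^sub>R a)) \<partial>lborel \<partial>lborel)"
  proof -
    \<comment> \<open>In terms of the new first coordinate \<open>x = T b + c *\<^sub>R a\<close>,
      the second one is \<open>(b - T' x) / c\<close>. The map is therefore two shears combined with
      dilations by \<open>c\<close> and \<open>1 / c\<close>, whose Jacobian factors cancel.\<close>
    have "c *\<^sub>R b - T' a = (1 / c) *\<^sub>R b - (1 / c) *\<^sub>R T' (T b + c *\<^sub>R a)" for a b
    proof -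
      have *: "T' (T b + c *\<^sub>R a) = (1 - c\<^sup>2) *\<^sub>R b + c *\<^sub>R T' a"
        using T(2) by (simp add: linear_add linear_scale TT)
      show ?thesis unfolding *
        using c by (simp add: algebra_simps power2_eq_square)
    qed
    then show ?thesis by (simp add: add.commute)
  qed
  also have "\<dots> = (\<integral>\<^sup>+b. ?D * (\<integral>\<^sup>+a. h (a, (1 / c) *\<^sub>R b - (1 / c) *\<^sub>R T' a) \<partial>lborel) \<partial>lborel)"
  proof (intro nn_integral_cong)
    fix b
    show "(\<integral>\<^sup>+a. h (T b + c *\<^sub>R a, (1 / c) *\<^sub>R b - (1 / c) *\<^sub>R T' (T b + c *\<^sub>R a)) \<partial>lborel)
      = ?D * (\<integral>\<^sup>+a. h (a, (1 / c) *\<^sub>R b - (1 / c) *\<^sub>R T' a) \<partial>lborel)"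
      by (rule nn_integral_lborel_affine[where f = "\<lambda>a. h (a, (1 / c) *\<^sub>R b - (1 / c) *\<^sub>R T' a)"])
        (use c in auto)
  qed
  also have "\<dots> = ?D * (\<integral>\<^sup>+b. (\<integral>\<^sup>+a. h (a, (1 / c) *\<^sub>R b - (1 / c) *\<^sub>R T' a) \<partial>lborel) \<partial>lborel)"
    by (rule nn_integral_cmult) measurable
  also have "\<dots> = ?D * (\<integral>\<^sup>+a. (\<integral>\<^sup>+b. h (a, (1 / c) *\<^sub>R b - (1 / c) *\<^sub>R T' a) \<partial>lborel) \<partial>lborel)"
    by (subst lborel_pair.Fubini') auto
  also have "\<dots> = ?D * (\<integral>\<^sup>+a. ennreal (1 / \<bar>1 / c\<bar> ^ DIM('a)) * (\<integral>\<^sup>+b. h (a, b) \<partial>lborel) \<partial>lborel)"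
  proof (intro nn_integral_cong arg_cong[where f = "\<lambda>x. ?D * x"])
    fix a
    have "(\<integral>\<^sup>+b. h (a, - ((1 / c) *\<^sub>R T' a) + (1 / c) *\<^sub>R b) \<partial>lborel)
      = ennreal (1 / \<bar>1 / c\<bar> ^ DIM('a)) * (\<integral>\<^sup>+b. h (a, b) \<partial>lborel)"
      by (rule nn_integral_lborel_affine[where f = "\<lambda>b. h (a, b)"]) (use c in auto)
    then show "(\<integral>\<^sup>+b. h (a, (1 / c) *\<^sub>R b - (1 / c) *\<^sub>R T' a) \<partial>lborel)
      = ennreal (1 / \<bar>1 / c\<bar> ^ DIM('a)) * (\<integral>\<^sup>+b. h (a, b) \<partial>lborel)" by simp
  qed
  also have "\<dots> = ?D * ennreal (1 / \<bar>1 / c\<bar> ^ DIM('a)) * (\<integral>\<^sup>+a. (\<integral>\<^sup>+b. h (a, b) \<partial>lborel) \<partial>lborel)"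
    by (subst nn_integral_cmult) (auto simp: mult.assoc)
  also have "?D * ennreal (1 / \<bar>1 / c\<bar> ^ DIM('a)) = 1"
    using c by (simp add: ennreal_mult'[symmetric] power_divide)
  also have "1 * (\<integral>\<^sup>+a. (\<integral>\<^sup>+b. h (a, b) \<partial>lborel) \<partial>lborel) = (\<integral>\<^sup>+b. \<integral>\<^sup>+a. h (a, b) \<partial>lborel \<partial>lborel)"
    by (subst lborel_pair.Fubini') auto
  finally show ?thesis .
qed

lemma measurable_Complex [measurable]: "(\<lambda>p. Complex (fst p) (snd p)) \<in> borel_measurable (borel \<Otimes>\<^sub>M borel)"
proof -
  have "(\<lambda>p. complex_of_real (fst p) + \<i> * complex_of_real (snd p)) \<in> borel_measurable (borel \<Otimes>\<^sub>M borel)"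
    by measurable
  then show ?thesis by (simp add: Complex_eq)
qed

lemma lborel_complex_eq:
  "lborel = distr (lborel \<Otimes>\<^sub>M lborel) borel (\<lambda>p. Complex (fst p) (snd p))"
proof (rule lborel_eqI)
  fix l u :: complex
  assume lu: "\<And>b. b \<in> Basis \<Longrightarrow> l \<bullet> b \<le> u \<bullet> b"
  have le: "Re l \<le> Re u" "Im l \<le> Im u"
    using lu[of 1] lu[of \<i>] by (auto simp: Basis_complex_def)
  have "emeasure (distr (lborel \<Otimes>\<^sub>M lborel) borel (\<lambda>p. Complex (fst p) (snd p))) (box l u)
    = emeasure (lborel \<Otimes>\<^sub>M lborel) ({Re l<..<Re u} \<times> {Im l<..<Im u})"
    by (subst emeasure_distr)
      (auto simp: in_box_complex_iff space_pair_measure intro!: arg_cong2[where f = emeasure])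
  also have "\<dots> = ennreal ((Re u - Re l) * (Im u - Im l))"
    using le by (subst lborel.emeasure_pair_measure_Times) (auto simp: ennreal_mult'')
  finally show "emeasure (distr (lborel \<Otimes>\<^sub>M lborel) borel (\<lambda>p. Complex (fst p) (snd p))) (box l u)
    = ennreal (\<Prod>b\<in>Basis. (u - l) \<bullet> b)"
    by (simp add: Basis_complex_def)
qed simp

lemma nn_integral_lborel_complex:
  assumes [measurable]: "f \<in> borel_measurable borel"
  shows "(\<integral>\<^sup>+z. f z \<partial>lborel) = (\<integral>\<^sup>+y. \<integral>\<^sup>+x. f (Complex x y) \<partial>lborel \<partial>lborel)"
proof -
  have "(\<integral>\<^sup>+z. f z \<partial>lborel) = (\<integral>\<^sup>+p. f (Complex (fst p) (snd p)) \<partial>(lborel \<Otimes>\<^sub>M lborel))"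
    by (subst lborel_complex_eq, subst nn_integral_distr) auto
  also have "\<dots> = (\<integral>\<^sup>+y. \<integral>\<^sup>+x. f (Complex x y) \<partial>lborel \<partial>lborel)"
    using lborel_pair.nn_integral_snd[of "\<lambda>p. f (Complex (fst p) (snd p))"] by simp
  finally show ?thesis .
qed

lemma nn_integral_lborel_cis:
  assumes [measurable]: "f \<in> borel_measurable borel"
  shows "(\<integral>\<^sup>+z. f (cis t * z) \<partial>lborel) = (\<integral>\<^sup>+z. f z \<partial>lborel)"
proof -
  have main: "(\<integral>\<^sup>+z. f (cis t * z) \<partial>lborel) = (\<integral>\<^sup>+z. f z \<partial>lborel)" 
    if c: "cos t \<noteq> 0" and [measurable]: "f \<in> borel_measurable borel" for t f
  proof -
    let ?h = "\<lambda>p. f (Complex (fst p) (snd p))"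
    have h: "?h \<in> borel_measurable borel" unfolding borel_prod[symmetric] by measurable
    have "(\<integral>\<^sup>+z. f (cis t * z) \<partial>lborel) = (\<integral>\<^sup>+y. \<integral>\<^sup>+x. f (cis t * Complex x y) \<partial>lborel \<partial>lborel)"
      by (rule nn_integral_lborel_complex) measurable
    also have "\<dots> = (\<integral>\<^sup>+y. \<integral>\<^sup>+x. ?h (cos t *\<^sub>R x + (- sin t * y), cos t *\<^sub>R y - (- sin t * x)) \<partial>lborel \<partial>lborel)"
      by (intro nn_integral_cong arg_cong[where f = f]) (auto simp: complex_eq_iff algebra_simps)
    also have "\<dots> = (\<integral>\<^sup>+y. \<integral>\<^sup>+x. ?h (x, y) \<partial>lborel \<partial>lborel)"
      by (rule nn_integral_lborel_rotate[OF h c])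
        (auto simp: linear_iff algebra_simps power2_eq_square sin_cos_squared_add3, 
         simp add: power2_eq_square[symmetric] sin_squared_eq algebra_simps)
    finally show ?thesis by (simp add: nn_integral_lborel_complex)
  qed
  show ?thesis
  proof (cases "cos t = 0")
    case False then show ?thesis by (rule main) fact
  next
    case True
    then have "(sin t)\<^sup>2 = 1" using sin_cos_squared_add[of t] by simp
    \<comment> \<open>The shears divide by \<open>cos t\<close>. When it vanishes, the half angle
      has nonzero cosine and the rotation by \<open>t / 2\<close> is applied twice.\<close>
    have "cos t = (cos (t/2))\<^sup>2 - (sin (t/2))\<^sup>2" using cos_double[of "t/2"] by simp
    then have "cos (t/2) \<noteq> 0" using True sin_cos_squared_add[of "t/2"] by auto
    then have "(\<integral>\<^sup>+z. f (cis (t/2) * (cis (t/2) * z)) \<partial>lborel) = (\<integral>\<^sup>+z. f z \<partial>lborel)"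
      using main[of "t/2" "\<lambda>z. f (cis (t/2) * z)"] main[of "t/2" f] by simp
    then show ?thesis by (simp add: mult.assoc[symmetric] cis_mult)
  qed
qed

lemma nn_integral_cgauss_cis:
  assumes [measurable]: "f \<in> borel_measurable borel"
  shows "(\<integral>\<^sup>+z. f (cis t * z) \<partial>cgauss) = (\<integral>\<^sup>+z. f z \<partial>cgauss)"
proof -
  have "(\<integral>\<^sup>+z. f (cis t * z) \<partial>cgauss) =
    (\<integral>\<^sup>+z. ennreal (1 / pi * exp (- (cmod (cis t * z))\<^sup>2)) * f (cis t * z) \<partial>lborel)"
    by (subst nn_integral_cgauss) (auto simp: norm_mult)
  also have "\<dots> = (\<integral>\<^sup>+z. f z \<partial>cgauss)"
    by (subst nn_integral_lborel_cis[where f = "\<lambda>z. ennreal (1 / pi * exp (- (cmod z)\<^sup>2)) * f z"])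
      (auto simp: nn_integral_cgauss)
  finally show ?thesis .
qed

lemma nn_integral_cgauss_unit:
  assumes "f \<in> borel_measurable borel" "cmod u = 1"
  shows "(\<integral>\<^sup>+z. f (u * z) \<partial>cgauss) = (\<integral>\<^sup>+z. f z \<partial>cgauss)"
proof -
  have "u = cis (Arg u)" using assms by (metis rcis_cmod_Arg rcis_def mult_1 of_real_1)
  then show ?thesis using nn_integral_cgauss_cis[OF assms(1), of "Arg u"] by simp
qed

section \<open>Gaussian rotations\<close>

text \<open>Invariance of a pair of independent Gaussians under a unitary 2 by 2 matrix. The phase
  of \<open>\<alpha>\<close> is absorbed by phase invariance of each coordinate, so that the
  diagonal entries become the real number \<open>c\<close> required by the shear argument. The case
  \<open>\<alpha> = 0\<close> is separate because that argument divides by \<open>c\<close>.\<close>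

lemma nn_integral_cgauss_rotate:
  assumes h [measurable]: "h \<in> borel_measurable (borel \<Otimes>\<^sub>M borel)"
    and ab: "(cmod \<alpha>)\<^sup>2 + (cmod \<beta>)\<^sup>2 = 1"
  shows "(\<integral>\<^sup>+b. \<integral>\<^sup>+a. h (\<alpha> * a + \<beta> * b, - cnj \<beta> * a + cnj \<alpha> * b) \<partial>cgauss \<partial>cgauss)
       = (\<integral>\<^sup>+b. \<integral>\<^sup>+a. h (a, b) \<partial>cgauss \<partial>cgauss)"
proof (cases "\<alpha> = 0")
  case True
  then have "cmod \<beta> = 1" using ab norm_ge_zero[of \<beta>] by (simp add: power2_eq_1_iff)
  then have b1: "cmod \<beta> = 1" "cmod (- cnj \<beta>) = 1" by auto
  have "(\<integral>\<^sup>+b. \<integral>\<^sup>+a. h (\<alpha> * a + \<beta> * b, - cnj \<beta> * a + cnj \<alpha> * b) \<partial>cgauss \<partial>cgauss)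
      = (\<integral>\<^sup>+b. \<integral>\<^sup>+a. h (\<beta> * b, - cnj \<beta> * a) \<partial>cgauss \<partial>cgauss)"
    using True by simp
  also have "\<dots> = (\<integral>\<^sup>+b. \<integral>\<^sup>+a. h (\<beta> * b, a) \<partial>cgauss \<partial>cgauss)"
    by (intro nn_integral_cong nn_integral_cgauss_unit[OF _ b1(2)]) measurable
  also have "\<dots> = (\<integral>\<^sup>+b. \<integral>\<^sup>+a. h (b, a) \<partial>cgauss \<partial>cgauss)"
    by (rule nn_integral_cgauss_unit[OF _ b1(1), where f = "\<lambda>b. \<integral>\<^sup>+a. h (b, a) \<partial>cgauss"]) measurable
  also have "\<dots> = (\<integral>\<^sup>+b. \<integral>\<^sup>+a. h (a, b) \<partial>cgauss \<partial>cgauss)"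
    by (rule pair_sigma_finite.Fubini'[of cgauss cgauss "\<lambda>x y. h (y, x)"])
      (auto simp: pair_sigma_finite_def cgauss.sigma_finite_measure_axioms)
  finally show ?thesis .
next
  case False
  define c where "c = cmod \<alpha>"
  define u where "u = \<alpha> / c"
  have c: "c \<noteq> 0" using False by (simp add: c_def)
  have u: "cmod u = 1" "cmod (cnj u) = 1" using c by (auto simp: u_def c_def norm_divide)
  have uu: "u * cnj u = 1" using u by (simp add: complex_norm_square[symmetric])
  define s where "s = \<beta> * u"
  have "s * cnj s = (\<beta> * cnj \<beta>) * (u * cnj u)" by (simp add: s_def mult_ac)
  also have "\<dots> = complex_of_real ((cmod \<beta>)\<^sup>2)" unfolding uu complex_norm_square by simp
  also have "(cmod \<beta>)\<^sup>2 = 1 - c\<^sup>2" using ab by (simp add: c_def)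
  finally have cs: "s * cnj s = of_real (1 - c\<^sup>2)" .
  have \<alpha>: "\<alpha> = complex_of_real c * u" "cnj \<alpha> = complex_of_real c * cnj u" using c by (auto simp: u_def)
  have \<beta>: "\<beta> = s * cnj u" by (simp add: s_def mult.assoc uu)
  have \<beta>': "cnj \<beta> = cnj s * u" unfolding \<beta> by simp
  let ?g = "\<lambda>a b :: complex. h (complex_of_real c * a + s * b, - cnj s * a + complex_of_real c * b)"
  let ?w = "\<lambda>z::complex. ennreal (1 / pi * exp (- (cmod z)\<^sup>2))"
  have w2: "?w b * ?w a = ennreal (1 / pi\<^sup>2 * exp (- ((cmod a)\<^sup>2 + (cmod b)\<^sup>2)))" for a b
  proof -
    have "?w b * ?w a = ennreal ((1 / pi * exp (- (cmod b)\<^sup>2)) * (1 / pi * exp (- (cmod a)\<^sup>2)))"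
      by (rule ennreal_mult'[symmetric]) auto
    also have "(1 / pi * exp (- (cmod b)\<^sup>2)) * (1 / pi * exp (- (cmod a)\<^sup>2)) = 1 / pi\<^sup>2 * exp (- ((cmod a)\<^sup>2 + (cmod b)\<^sup>2))"
      by (simp add: exp_add[symmetric] power2_eq_square[of pi] add.commute)
    finally show ?thesis .
  qed
  have "(\<integral>\<^sup>+b. \<integral>\<^sup>+a. h (\<alpha> * a + \<beta> * b, - cnj \<beta> * a + cnj \<alpha> * b) \<partial>cgauss \<partial>cgauss)
     = (\<integral>\<^sup>+b. \<integral>\<^sup>+a. ?g (u * a) (cnj u * b) \<partial>cgauss \<partial>cgauss)"
    unfolding \<alpha> \<beta>' by (simp only: \<beta> mult.assoc minus_mult_left complex_cnj_mult complex_cnj_complex_of_real)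
  also have "\<dots> = (\<integral>\<^sup>+b. \<integral>\<^sup>+a. ?g a (cnj u * b) \<partial>cgauss \<partial>cgauss)"
  proof (rule nn_integral_cong)
    fix b
    show "(\<integral>\<^sup>+a. ?g (u * a) (cnj u * b) \<partial>cgauss) = (\<integral>\<^sup>+a. ?g a (cnj u * b) \<partial>cgauss)"
      by (rule nn_integral_cgauss_unit[OF _ u(1), where f = "\<lambda>a. ?g a (cnj u * b)"]) measurable
  qed
  also have "\<dots> = (\<integral>\<^sup>+b. \<integral>\<^sup>+a. ?g a b \<partial>cgauss \<partial>cgauss)"
    by (rule nn_integral_cgauss_unit[OF _ u(2), where f = "\<lambda>b. \<integral>\<^sup>+a. ?g a b \<partial>cgauss"]) measurable
  also have "\<dots> = (\<integral>\<^sup>+b. \<integral>\<^sup>+a. ?w b * (?w a * ?g a b) \<partial>lborel \<partial>lborel)"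
    by (simp add: nn_integral_cgauss nn_integral_cmult)
  also have "\<dots> = (\<integral>\<^sup>+b. \<integral>\<^sup>+a. (\<lambda>p. ennreal (1 / pi\<^sup>2 * exp (- ((cmod (fst p))\<^sup>2 + (cmod (snd p))\<^sup>2))) * h p)
       (c *\<^sub>R a + s * b, c *\<^sub>R b - cnj s * a) \<partial>lborel \<partial>lborel)"
  proof (intro nn_integral_cong)
    fix a b :: complex
    have "complex_of_real ((cmod (c *\<^sub>R a + s * b))\<^sup>2 + (cmod (c *\<^sub>R b - cnj s * a))\<^sup>2)
      = (c * a + s * b) * (c * cnj a + cnj s * cnj b) + (c * b - cnj s * a) * (c * cnj b - s * cnj a)"
      unfolding of_real_add complex_norm_square by (simp add: scaleR_conv_of_real)
    also have "\<dots> = (c\<^sup>2 + s * cnj s) * (a * cnj a + b * cnj b)"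
      by (simp add: algebra_simps power2_eq_square)
    also have "\<dots> = complex_of_real ((cmod a)\<^sup>2 + (cmod b)\<^sup>2)"
      unfolding cs of_real_add complex_norm_square by simp
    finally have e: "(cmod (c *\<^sub>R a + s * b))\<^sup>2 + (cmod (c *\<^sub>R b - cnj s * a))\<^sup>2 = (cmod a)\<^sup>2 + (cmod b)\<^sup>2"
      by (simp only: of_real_eq_iff)
    then show "?w b * (?w a * ?g a b) = (\<lambda>p. ennreal (1 / pi\<^sup>2 * exp (- ((cmod (fst p))\<^sup>2 + (cmod (snd p))\<^sup>2))) * h p)
       (c *\<^sub>R a + s * b, c *\<^sub>R b - cnj s * a)"
      unfolding mult.assoc[of "?w b", symmetric] w2 fst_conv snd_conv e
      by (simp add: scaleR_conv_of_real)
  qed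
  also have "\<dots> = (\<integral>\<^sup>+b. \<integral>\<^sup>+a. (\<lambda>p. ennreal (1 / pi\<^sup>2 * exp (- ((cmod (fst p))\<^sup>2 + (cmod (snd p))\<^sup>2))) * h p) (a, b) \<partial>lborel \<partial>lborel)"
  proof (rule nn_integral_lborel_rotate)
    show "cnj s * (s * x) = (1 - c\<^sup>2) *\<^sub>R x" for x
      using cs by (simp add: scaleR_conv_of_real mult.assoc[symmetric] mult.commute)
    show "(\<lambda>p. ennreal (1 / pi\<^sup>2 * exp (- ((cmod (fst p))\<^sup>2 + (cmod (snd p))\<^sup>2))) * h p) \<in> borel_measurable borel"
      unfolding borel_prod[symmetric] by measurable
  qed (use c in \<open>auto simp: linear_iff algebra_simps\<close>)
  also have "\<dots> = (\<integral>\<^sup>+b. \<integral>\<^sup>+a. ?w b * (?w a * h (a, b)) \<partial>lborel \<partial>lborel)"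
    unfolding mult.assoc[symmetric] w2 by simp
  also have "\<dots> = (\<integral>\<^sup>+b. \<integral>\<^sup>+a. h (a, b) \<partial>cgauss \<partial>cgauss)"
    by (simp add: nn_integral_cgauss nn_integral_cmult)
  finally show ?thesis .
qed

lemma nn_integral_cgauss_sum:
  assumes h [measurable]: "h \<in> borel_measurable borel"
    and ab: "(cmod \<alpha>)\<^sup>2 + (cmod \<beta>)\<^sup>2 = 1"
  shows "(\<integral>\<^sup>+b. \<integral>\<^sup>+a. h (\<alpha> * a + \<beta> * b) \<partial>cgauss \<partial>cgauss) = (\<integral>\<^sup>+a. h a \<partial>cgauss)"
  using nn_integral_cgauss_rotate[of "\<lambda>p. h (fst p)", OF _ ab] by (simp add: cgauss.emeasure_space_1[simplified])

section \<open>Finite products of Gaussians and their rotations\<close>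

abbreviation gprod :: "'i set \<Rightarrow> ('i \<Rightarrow> complex) measure" where
  "gprod I \<equiv> PiM I (\<lambda>_. cgauss)"

interpretation gp: product_prob_space "\<lambda>_. cgauss" I for I :: "'i set"
  by standard

lemma sets_gprod [measurable_cong]: "sets (gprod I) = sets (PiM I (\<lambda>_. borel))"
  by (rule sets_PiM_cong) auto

lemma space_gprod: "space (gprod I) = PiE I (\<lambda>_. UNIV)"
  by (simp add: space_PiM)

lemma prob_space_gprod: "prob_space (gprod I)"
  by (rule prob_space_PiM) (rule prob_space_cgauss)

text \<open>The restriction to \<open>I\<close> keeps the image inside the space of
  \<open>gprod I\<close>, whose points are \<open>undefined\<close> off \<open>I\<close>.\<close>

definition mapply :: "'i set \<Rightarrow> ('i \<Rightarrow> 'i \<Rightarrow> complex) \<Rightarrow> ('i \<Rightarrow> complex) \<Rightarrow> 'i \<Rightarrow> complex" where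
  "mapply I B x = (\<lambda>n\<in>I. \<Sum>k\<in>I. B n k * x k)"

lemma mapply_measurable [measurable]: "mapply I B \<in> measurable (gprod I) (gprod I)"
  unfolding mapply_def by measurable

text \<open>A matrix with orthonormal rows which, acting on an i.i.d. standard complex Gaussian vector,
  preserves its law. All unitary matrices have this property, but only products of plane
  rotations are ever needed.\<close>

definition gauss_rotation :: "'i set \<Rightarrow> ('i \<Rightarrow> 'i \<Rightarrow> complex) \<Rightarrow> bool" where
  "gauss_rotation I B \<longleftrightarrow>
     (\<forall>n\<in>I. \<forall>m\<in>I. (\<Sum>k\<in>I. B n k * cnj (B m k)) = (if n = m then 1 else 0)) \<and>
     (\<forall>f\<in>borel_measurable (gprod I). (\<integral>\<^sup>+x. f (mapply I B x) \<partial>gprod I) = (\<integral>\<^sup>+x. f x \<partial>gprod I))"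

lemma gauss_rotationD:
  assumes "gauss_rotation I B"
  shows "\<And>n m. n \<in> I \<Longrightarrow> m \<in> I \<Longrightarrow> (\<Sum>k\<in>I. B n k * cnj (B m k)) = (if n = m then 1 else 0)"
    and "\<And>f. f \<in> borel_measurable (gprod I) \<Longrightarrow> (\<integral>\<^sup>+x. f (mapply I B x) \<partial>gprod I) = (\<integral>\<^sup>+x. f x \<partial>gprod I)"
  using assms by (auto simp: gauss_rotation_def)

lemma sum_mapply:
  assumes "finite I"
  shows "(\<Sum>n\<in>I. v n * mapply I B x n) = (\<Sum>k\<in>I. (\<Sum>n\<in>I. v n * B n k) * x k)"
proof -
  have "(\<Sum>n\<in>I. v n * mapply I B x n) = (\<Sum>n\<in>I. \<Sum>k\<in>I. v n * B n k * x k)"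
    by (simp add: mapply_def sum_distrib_left mult.assoc)
  also have "\<dots> = (\<Sum>k\<in>I. \<Sum>n\<in>I. v n * B n k * x k)" by (rule sum.swap)
  finally show ?thesis by (simp add: sum_distrib_right)
qed

text \<open>Orthonormal rows make the row map, \<open>v\<close> to \<open>v B\<close>, an isometry
  for the Hermitian inner product.\<close>

lemma gauss_rotation_inner:
  assumes "gauss_rotation I B" "finite I"
  shows "(\<Sum>k\<in>I. (\<Sum>n\<in>I. v n * B n k) * cnj (\<Sum>n\<in>I. w n * B n k)) = (\<Sum>n\<in>I. v n * cnj (w n))"
proof -
  have "(\<Sum>k\<in>I. (\<Sum>n\<in>I. v n * B n k) * cnj (\<Sum>n\<in>I. w n * B n k))
     = (\<Sum>k\<in>I. \<Sum>n\<in>I. \<Sum>m\<in>I. v n * cnj (w m) * (B n k * cnj (B m k)))"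
    by (simp add: sum_product mult_ac)
  also have "\<dots> = (\<Sum>n\<in>I. \<Sum>k\<in>I. \<Sum>m\<in>I. v n * cnj (w m) * (B n k * cnj (B m k)))"
    by (rule sum.swap)
  also have "\<dots> = (\<Sum>n\<in>I. \<Sum>m\<in>I. \<Sum>k\<in>I. v n * cnj (w m) * (B n k * cnj (B m k)))"
    by (rule sum.cong[OF refl], rule sum.swap)
  also have "\<dots> = (\<Sum>n\<in>I. \<Sum>m\<in>I. v n * cnj (w m) * (if n = m then 1 else 0))"
    by (intro sum.cong refl) (simp add: sum_distrib_left[symmetric] gauss_rotationD(1)[OF assms(1)])
  also have "\<dots> = (\<Sum>n\<in>I. v n * cnj (w n))"
    using assms(2) by (intro sum.cong refl) (simp add: if_distrib sum.delta' cong: if_cong)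
  finally show ?thesis .
qed

lemma gauss_rotation_comp:
  assumes "gauss_rotation I B" "gauss_rotation I C" "finite I"
  shows "gauss_rotation I (\<lambda>n k. \<Sum>m\<in>I. B n m * C m k)"
  unfolding gauss_rotation_def
proof (intro conjI ballI)
  fix n m assume "n \<in> I" "m \<in> I"
  then show "(\<Sum>k\<in>I. (\<Sum>l\<in>I. B n l * C l k) * cnj (\<Sum>l\<in>I. B m l * C l k)) = (if n = m then 1 else 0)"
    using gauss_rotation_inner[OF assms(2,3), of "B n" "B m"] gauss_rotationD(1)[OF assms(1)] by simp
next
  fix f :: "_ \<Rightarrow> ennreal" assume f: "f \<in> borel_measurable (gprod I)"
  have eq: "mapply I (\<lambda>n k. \<Sum>m\<in>I. B n m * C m k) x = mapply I B (mapply I C x)" for x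
  proof
    fix n
    show "mapply I (\<lambda>n k. \<Sum>m\<in>I. B n m * C m k) x n = mapply I B (mapply I C x) n"
    proof (cases "n \<in> I")
      case True
      then have "mapply I (\<lambda>n k. \<Sum>m\<in>I. B n m * C m k) x n = (\<Sum>k\<in>I. (\<Sum>m\<in>I. B n m * C m k) * x k)"
        by (simp add: mapply_def)
      also have "\<dots> = (\<Sum>m\<in>I. B n m * mapply I C x m)" by (rule sum_mapply[OF assms(3), symmetric])
      finally show ?thesis using True by (simp add: mapply_def)
    qed (simp add: mapply_def)
  qed
  have "(\<integral>\<^sup>+x. f (mapply I B (mapply I C x)) \<partial>gprod I) = (\<integral>\<^sup>+x. f (mapply I B x) \<partial>gprod I)"
    by (rule gauss_rotationD(2)[OF assms(2), where f = "\<lambda>x. f (mapply I B x)"]) (use f in measurable)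
  then show "(\<integral>\<^sup>+x. f (mapply I (\<lambda>n k. \<Sum>m\<in>I. B n m * C m k) x) \<partial>gprod I) = (\<integral>\<^sup>+x. f x \<partial>gprod I)"
    unfolding eq using gauss_rotationD(2)[OF assms(1) f] by simp
qed

lemma gauss_rotation_phase:
  assumes "finite I" "i \<in> I" "cmod u = 1"
  shows "gauss_rotation I (\<lambda>n k. if n = k then (if n = i then u else 1) else 0)" (is "gauss_rotation I ?B")
  unfolding gauss_rotation_def
proof (intro conjI ballI)
  fix n m assume "n \<in> I" "m \<in> I"
  have "u * cnj u = 1" using assms(3) by (simp add: complex_norm_square[symmetric])
  then show "(\<Sum>k\<in>I. ?B n k * cnj (?B m k)) = (if n = m then 1 else 0)"
    using assms(1) \<open>n \<in> I\<close> \<open>m \<in> I\<close>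
    by (simp add: if_distrib[of cnj] if_distrib[of "\<lambda>x. _ * x"] if_distrib[of "\<lambda>x. x * _"] sum.delta sum.delta' cong: if_cong)
next
  fix f :: "_ \<Rightarrow> ennreal" assume f [measurable]: "f \<in> borel_measurable (gprod I)"
  define K where "K = I - {i}"
  have I: "I = insert i K" "finite K" "i \<notin> K" using assms by (auto simp: K_def)
  have m: "mapply I ?B (x(i := a)) = x(i := u * a)" if "x \<in> space (gprod K)" for x a
  proof
    fix n
    show "mapply I ?B (x(i := a)) n = (x(i := u * a)) n"
    proof (cases "n \<in> I")
      case True
      have "mapply I ?B (x(i := a)) n = (\<Sum>k\<in>I. if k = n then (if n = i then u else 1) * (x(i := a)) k else 0)"
        unfolding mapply_def using True by (auto intro!: sum.cong)
      also have "\<dots> = (if n = i then u else 1) * (x(i := a)) n" using True assms(1) by simp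
      finally show ?thesis by simp
    next
      case False
      then show ?thesis using that I by (auto simp: mapply_def space_gprod PiE_def extensional_def)
    qed
  qed
  have "(\<integral>\<^sup>+x. f (mapply I ?B x) \<partial>gprod I)
      = (\<integral>\<^sup>+x. \<integral>\<^sup>+a. f (mapply I ?B (x(i := a))) \<partial>cgauss \<partial>gprod K)"
    unfolding I(1) by (rule gp.product_nn_integral_insert) (use I in \<open>auto simp: I(1)[symmetric]\<close>)
  also have "\<dots> = (\<integral>\<^sup>+x. \<integral>\<^sup>+a. f (x(i := u * a)) \<partial>cgauss \<partial>gprod K)"
    by (intro nn_integral_cong) (simp add: m)
  also have "\<dots> = (\<integral>\<^sup>+x. \<integral>\<^sup>+a. f (x(i := a)) \<partial>cgauss \<partial>gprod K)"
  proof (rule nn_integral_cong)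
    fix x assume x: "x \<in> space (gprod K)"
    have [measurable]: "(\<lambda>a. x(i := a)) \<in> measurable borel (gprod I)"
      unfolding I(1) by (rule measurable_fun_upd[where J = K]) (use x in auto)
    show "(\<integral>\<^sup>+a. f (x(i := u * a)) \<partial>cgauss) = (\<integral>\<^sup>+a. f (x(i := a)) \<partial>cgauss)"
      by (rule nn_integral_cgauss_unit[where f = "\<lambda>a. f (x(i := a))"]) (measurable, rule assms)
  qed
  also have "\<dots> = (\<integral>\<^sup>+x. f x \<partial>gprod I)"
    unfolding I(1) by (rule gp.product_nn_integral_insert[symmetric]) (use I in \<open>auto simp: I(1)[symmetric]\<close>)
  finally show "(\<integral>\<^sup>+x. f (mapply I ?B x) \<partial>gprod I) = (\<integral>\<^sup>+x. f x \<partial>gprod I)" .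
qed

definition givens :: "'i \<Rightarrow> 'i \<Rightarrow> complex \<Rightarrow> complex \<Rightarrow> 'i \<Rightarrow> 'i \<Rightarrow> complex" where
  "givens i j \<alpha> \<beta> n k =
    (if n = i then (if k = i then \<alpha> else if k = j then \<beta> else 0)
     else if n = j then (if k = i then - cnj \<beta> else if k = j then cnj \<alpha> else 0)
     else if n = k then 1 else 0)"

text \<open>Fubini isolates the coordinates \<open>i\<close> and \<open>j\<close>; with all the
  others held fixed, the invariance under 2 by 2 unitary matrices applies.\<close>

lemma gauss_rotation_givens:
  assumes "finite I" "i \<in> I" "j \<in> I" "i \<noteq> j" and ab: "(cmod \<alpha>)\<^sup>2 + (cmod \<beta>)\<^sup>2 = 1"
  shows "gauss_rotation I (givens i j \<alpha> \<beta>)" (is "gauss_rotation I ?B")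
proof -
  define K where "K = I - {i, j}"
  have I: "I = insert i (insert j K)" "finite K" "i \<notin> insert j K" "j \<notin> K" using assms by (auto simp: K_def)
  have sum_I: "(\<Sum>k\<in>I. F k) = F i + (F j + (\<Sum>k\<in>K. F k))" for F :: "'a \<Rightarrow> complex"
    using I by simp
  have ab': "\<alpha> * cnj \<alpha> + \<beta> * cnj \<beta> = 1"
    using ab by (simp add: complex_norm_square[symmetric]) (metis of_real_1 of_real_add of_real_power)
  show ?thesis unfolding gauss_rotation_def
  proof (intro conjI ballI)
    fix n m assume nm: "n \<in> I" "m \<in> I"
    have K0: "(\<Sum>k\<in>K. ?B n k * cnj (?B m k)) = (if n = m \<and> n \<in> K then 1 else 0)"
    proof (cases "n \<in> K")
      case True
      then have "(\<Sum>k\<in>K. ?B n k * cnj (?B m k)) = (\<Sum>k\<in>K. if k = n then cnj (?B m n) else 0)"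
        using I by (intro sum.cong) (auto simp: givens_def)
      also have "\<dots> = cnj (?B m n)" using True I(2) by simp
      also have "\<dots> = (if n = m then 1 else 0)" using True I by (auto simp: givens_def)
      finally show ?thesis using True by simp
    next
      case False
      then have "(\<Sum>k\<in>K. ?B n k * cnj (?B m k)) = (\<Sum>k\<in>K. 0)"
        using I nm by (intro sum.cong) (auto simp: givens_def)
      then show ?thesis using False by simp
    qed
    show "(\<Sum>k\<in>I. ?B n k * cnj (?B m k)) = (if n = m then 1 else 0)"
      unfolding sum_I K0 using I nm ab' by (auto simp: givens_def algebra_simps)
  next
    fix f :: "_ \<Rightarrow> ennreal" assume f [measurable]: "f \<in> borel_measurable (gprod I)"
    have m: "mapply I ?B (x(j := b, i := a)) = x(j := - cnj \<beta> * a + cnj \<alpha> * b, i := \<alpha> * a + \<beta> * b)"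
      (is "mapply I ?B ?x = ?y") if "x \<in> space (gprod K)" for x a b
    proof
      fix n
      consider "n = i" | "n = j" | "n \<in> K" | "n \<notin> I" using I by auto
      then show "mapply I ?B ?x n = ?y n"
      proof cases
        case 1
        have "(\<Sum>k\<in>K. ?B i k * ?x k) = 0" using I by (intro sum.neutral) (auto simp: givens_def)
        then show ?thesis using 1 I by (simp add: mapply_def sum_I) (auto simp: givens_def)
      next
        case 2
        have "(\<Sum>k\<in>K. ?B j k * ?x k) = 0" using I by (intro sum.neutral) (auto simp: givens_def)
        then show ?thesis using 2 I by (simp add: mapply_def sum_I) (auto simp: givens_def)
      next
        case 3
        have "(\<Sum>k\<in>K. ?B n k * ?x k) = (\<Sum>k\<in>K. if k = n then ?x n else 0)"
          using I 3 by (intro sum.cong) (auto simp: givens_def)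
        then show ?thesis using 3 I by (auto simp: mapply_def sum_I givens_def)
      next
        case 4
        then show ?thesis using that I by (auto simp: mapply_def space_gprod PiE_def extensional_def)
      qed
    qed
    have split: "(\<integral>\<^sup>+x. g x \<partial>gprod I) = (\<integral>\<^sup>+x. \<integral>\<^sup>+b. \<integral>\<^sup>+a. g (x(j := b, i := a)) \<partial>cgauss \<partial>cgauss \<partial>gprod K)"
      if g: "g \<in> borel_measurable (gprod I)" for g :: "_ \<Rightarrow> ennreal"
    proof -
      have [measurable]: "g \<in> borel_measurable (gprod (insert i (insert j K)))" using g I(1) by simp
      have "(\<integral>\<^sup>+x. g x \<partial>gprod I) = (\<integral>\<^sup>+x. \<integral>\<^sup>+a. g (x(i := a)) \<partial>cgauss \<partial>gprod (insert j K))"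
        unfolding I(1) by (rule gp.product_nn_integral_insert) (use I in auto)
      also have "\<dots> = (\<integral>\<^sup>+x. \<integral>\<^sup>+b. \<integral>\<^sup>+a. g (x(j := b, i := a)) \<partial>cgauss \<partial>cgauss \<partial>gprod K)"
      proof (rule gp.product_nn_integral_insert)
        have [measurable]: "(\<lambda>p. (fst p)(i := snd p)) \<in> measurable (gprod (insert j K) \<Otimes>\<^sub>M cgauss) (gprod (insert i (insert j K)))"
          by (rule measurable_fun_upd[where J = "insert j K"]) auto
        show "(\<lambda>x. \<integral>\<^sup>+a. g (x(i := a)) \<partial>cgauss) \<in> borel_measurable (gprod (insert j K))"
        proof (rule cgauss.borel_measurable_nn_integral)
          have "(\<lambda>p. g ((fst p)(i := snd p))) \<in> borel_measurable (gprod (insert j K) \<Otimes>\<^sub>M cgauss)"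
            by measurable
          then show "(\<lambda>(x, a). g (x(i := a))) \<in> borel_measurable (gprod (insert j K) \<Otimes>\<^sub>M cgauss)"
            by (simp add: case_prod_beta)
        qed
      qed (use I in auto)
      finally show ?thesis .
    qed
    have "(\<integral>\<^sup>+x. f (mapply I ?B x) \<partial>gprod I)
      = (\<integral>\<^sup>+x. \<integral>\<^sup>+b. \<integral>\<^sup>+a. f (mapply I ?B (x(j := b, i := a))) \<partial>cgauss \<partial>cgauss \<partial>gprod K)"
      by (rule split) measurable
    also have "\<dots> = (\<integral>\<^sup>+x. \<integral>\<^sup>+b. \<integral>\<^sup>+a. f (x(j := b, i := a)) \<partial>cgauss \<partial>cgauss \<partial>gprod K)"
    proof (rule nn_integral_cong)
      fix x assume x: "x \<in> space (gprod K)"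
      have [measurable]: "(\<lambda>p. x(j := snd p, i := fst p)) \<in> measurable (borel \<Otimes>\<^sub>M borel) (gprod I)"
        unfolding I(1) using x
        by (intro measurable_fun_upd[where J = "insert j K"] measurable_fun_upd[where J = K]) auto
      have "(\<integral>\<^sup>+b. \<integral>\<^sup>+a. (\<lambda>p. f (x(j := snd p, i := fst p))) (\<alpha> * a + \<beta> * b, - cnj \<beta> * a + cnj \<alpha> * b) \<partial>cgauss \<partial>cgauss)
         = (\<integral>\<^sup>+b. \<integral>\<^sup>+a. (\<lambda>p. f (x(j := snd p, i := fst p))) (a, b) \<partial>cgauss \<partial>cgauss)"
        by (rule nn_integral_cgauss_rotate[OF _ ab]) measurable
      then show "(\<integral>\<^sup>+b. \<integral>\<^sup>+a. f (mapply I ?B (x(j := b, i := a))) \<partial>cgauss \<partial>cgauss)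
         = (\<integral>\<^sup>+b. \<integral>\<^sup>+a. f (x(j := b, i := a)) \<partial>cgauss \<partial>cgauss)"
        by (simp add: m[OF x])
    qed
    also have "\<dots> = (\<integral>\<^sup>+x. f x \<partial>gprod I)" by (rule split[symmetric]) measurable
    finally show "(\<integral>\<^sup>+x. f (mapply I ?B x) \<partial>gprod I) = (\<integral>\<^sup>+x. f x \<partial>gprod I)" .
  qed
qed

text \<open>Givens elimination. The induction is on a set \<open>S\<close> containing every index
  other than \<open>i\<close> at which \<open>v\<close> may be nonzero: each rotation kills one such
  entry, and a final phase makes the surviving entry real and nonnegative. The size of that entry is
  forced by the isometry property.\<close>

lemma exists_gauss_rotation:
  fixes v :: "'i \<Rightarrow> complex"
  assumes "finite I" "i \<in> I"
  shows "\<exists>B. gauss_rotation I B \<and>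
    (\<forall>k\<in>I. (\<Sum>n\<in>I. v n * B n k) = (if k = i then of_real (sqrt (\<Sum>n\<in>I. (cmod (v n))\<^sup>2)) else 0))"
proof -
  have "\<exists>B. gauss_rotation I B \<and>
    (\<forall>k\<in>I. (\<Sum>n\<in>I. v n * B n k) = (if k = i then of_real (sqrt (\<Sum>n\<in>I. (cmod (v n))\<^sup>2)) else 0))"
    if "finite S" "S \<subseteq> I - {i}" "\<And>n. n \<in> I - {i} - S \<Longrightarrow> v n = 0" for S and v :: "'i \<Rightarrow> complex"
    using that
  proof (induction S arbitrary: v rule: finite_induct)
    case empty
    define u where "u = (if v i = 0 then 1 else cnj (v i) / cmod (v i))"
    have u: "cmod u = 1" "v i * u = cmod (v i)"
      by (auto simp: u_def norm_divide complex_norm_square[symmetric] power2_eq_square)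
    have z: "v n = 0" if "n \<in> I" "n \<noteq> i" for n using empty(2) that by auto
    have nrm: "(\<Sum>n\<in>I. (cmod (v n))\<^sup>2) = (cmod (v i))\<^sup>2"
    proof -
      have "(\<Sum>n\<in>I. (cmod (v n))\<^sup>2) = (\<Sum>n\<in>I. if n = i then (cmod (v i))\<^sup>2 else 0)"
        by (intro sum.cong) (auto simp: z)
      then show ?thesis using assms by simp
    qed
    show ?case
    proof (intro exI conjI ballI, rule gauss_rotation_phase[OF assms u(1)])
      fix k assume k: "k \<in> I"
      have "(\<Sum>n\<in>I. v n * (if n = k then if n = i then u else 1 else 0))
        = (\<Sum>n\<in>I. if n = k then v k * (if k = i then u else 1) else 0)"
        by (intro sum.cong) auto
      then show "(\<Sum>n\<in>I. v n * (if n = k then if n = i then u else 1 else 0))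
        = (if k = i then of_real (sqrt (\<Sum>n\<in>I. (cmod (v n))\<^sup>2)) else 0)"
        using k assms u z by (simp add: nrm)
    qed
  next
    case (insert j S)
    then have j: "j \<in> I" "j \<noteq> i" "j \<notin> S" by auto
    \<comment> \<open>The coefficients solve \<open>v i * \<beta> + v j * cnj \<alpha> = 0\<close>,
      so the rotated vector vanishes at \<open>j\<close>. If \<open>\<rho> = 0\<close>, both entries
      are zero already and the identity is taken.\<close>
    define \<rho> where "\<rho> = sqrt ((cmod (v i))\<^sup>2 + (cmod (v j))\<^sup>2)"
    define \<alpha> where "\<alpha> = (if \<rho> = 0 then 1 else cnj (v i) / \<rho>)"
    define \<beta> where "\<beta> = (if \<rho> = 0 then 0 else - v j / \<rho>)"
    have \<rho>2: "\<rho>\<^sup>2 = (cmod (v i))\<^sup>2 + (cmod (v j))\<^sup>2" by (simp add: \<rho>_def)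
    have ab: "(cmod \<alpha>)\<^sup>2 + (cmod \<beta>)\<^sup>2 = 1"
      using \<rho>2 by (auto simp: \<alpha>_def \<beta>_def norm_divide power_divide add_divide_distrib[symmetric])
    have zz: "v i * \<beta> + v j * cnj \<alpha> = 0"
      using \<rho>2 by (auto simp: \<alpha>_def \<beta>_def \<rho>_def add_nonneg_eq_0_iff)
    let ?C = "givens i j \<alpha> \<beta>"
    have C: "gauss_rotation I ?C" by (rule gauss_rotation_givens) (use assms j ab in auto)
    define w where "w = (\<lambda>k. \<Sum>n\<in>I. v n * ?C n k)"
    define K where "K = I - {i, j}"
    have I: "I = insert i (insert j K)" "finite K" "i \<notin> insert j K" "j \<notin> K" using assms j by (auto simp: K_def)
    have sum_I: "(\<Sum>k\<in>I. F k) = F i + (F j + (\<Sum>k\<in>K. F k))" for F :: "'i \<Rightarrow> complex"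
      using I by simp
    have wj: "w j = 0"
    proof -
      have "(\<Sum>n\<in>K. v n * ?C n j) = 0" using I by (intro sum.neutral) (auto simp: givens_def)
      then show ?thesis using zz j unfolding w_def sum_I by (simp add: givens_def)
    qed
    have wk: "w k = v k" if "k \<in> K" for k
    proof -
      have "(\<Sum>n\<in>K. v n * ?C n k) = (\<Sum>n\<in>K. if n = k then v k else 0)"
        using I that by (intro sum.cong) (auto simp: givens_def)
      then show ?thesis using that I unfolding w_def sum_I by (auto simp: givens_def)
    qed
    have "w n = 0" if "n \<in> I - {i} - S" for n
      using that wj wk[of n] insert.prems(2)[of n] by (cases "n = j") (auto simp: K_def)
    then obtain B where B: "gauss_rotation I B"
      "\<And>k. k \<in> I \<Longrightarrow> (\<Sum>n\<in>I. w n * B n k) = (if k = i then of_real (sqrt (\<Sum>n\<in>I. (cmod (w n))\<^sup>2)) else 0)"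
      using insert.IH[of w] insert.prems(1) by blast
    have "complex_of_real (\<Sum>n\<in>I. (cmod (w n))\<^sup>2) = (\<Sum>k\<in>I. w k * cnj (w k))"
      by (simp add: complex_norm_square del: of_real_power)
    also have "\<dots> = (\<Sum>k\<in>I. v k * cnj (v k))"
      unfolding w_def by (rule gauss_rotation_inner[OF C assms(1)])
    also have "\<dots> = complex_of_real (\<Sum>n\<in>I. (cmod (v n))\<^sup>2)"
      by (simp add: complex_norm_square del: of_real_power)
    finally have nrm: "(\<Sum>n\<in>I. (cmod (w n))\<^sup>2) = (\<Sum>n\<in>I. (cmod (v n))\<^sup>2)"
      by (simp only: of_real_eq_iff)
    show ?case
    proof (intro exI conjI ballI)
      show "gauss_rotation I (\<lambda>n k. \<Sum>m\<in>I. ?C n m * B m k)"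
        by (rule gauss_rotation_comp[OF C B(1) assms(1)])
      fix k assume k: "k \<in> I"
      have "(\<Sum>n\<in>I. v n * (\<Sum>m\<in>I. ?C n m * B m k)) = (\<Sum>n\<in>I. \<Sum>m\<in>I. v n * ?C n m * B m k)"
        by (simp add: sum_distrib_left mult.assoc)
      also have "\<dots> = (\<Sum>m\<in>I. \<Sum>n\<in>I. v n * ?C n m * B m k)" by (rule sum.swap)
      also have "\<dots> = (\<Sum>m\<in>I. w m * B m k)" by (simp add: w_def sum_distrib_right)
      finally show "(\<Sum>n\<in>I. v n * (\<Sum>m\<in>I. ?C n m * B m k))
        = (if k = i then of_real (sqrt (\<Sum>n\<in>I. (cmod (v n))\<^sup>2)) else 0)"
        using B(2)[OF k] nrm by simp
    qed
  qed
  from this[of "I - {i}" v] show ?thesis using assms by auto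
qed

text \<open>Orthonormal combinations of independent standard Gaussians are again independent and
  standard. A rotation turns one of the vectors, \<open>u l\<close>, into the unit vector at
  \<open>i\<close>; orthogonality then makes all the others vanish at \<open>i\<close>, so
  coordinate \<open>i\<close> integrates out as a separate factor and induction applies to the
  remaining coordinates.\<close>

lemma nn_integral_orthonormal_combinations:
  fixes u :: "'j \<Rightarrow> 'i \<Rightarrow> complex" and \<phi> :: "'j \<Rightarrow> complex \<Rightarrow> ennreal"
  assumes "finite J" "finite I"
    and "\<And>j l. j \<in> J \<Longrightarrow> l \<in> J \<Longrightarrow> (\<Sum>n\<in>I. u j n * cnj (u l n)) = (if j = l then 1 else 0)"
    and "\<And>j. j \<in> J \<Longrightarrow> \<phi> j \<in> borel_measurable borel"
  shows "(\<integral>\<^sup>+x. (\<Prod>j\<in>J. \<phi> j (\<Sum>n\<in>I. u j n * x n)) \<partial>gprod I) = (\<Prod>j\<in>J. \<integral>\<^sup>+z. \<phi> j z \<partial>cgauss)"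
  using assms
proof (induction J arbitrary: I u rule: finite_induct)
  case empty
  then show ?case by (simp add: prob_space.emeasure_space_1[OF prob_space_gprod])
next
  case (insert l J)
  have on: "\<And>j m. j \<in> insert l J \<Longrightarrow> m \<in> insert l J \<Longrightarrow> (\<Sum>n\<in>I. u j n * cnj (u m n)) = (if j = m then 1 else 0)"
    by (rule insert.prems(2))
  note [measurable] = insert.prems(3)
  have "I \<noteq> {}" using on[of l l] by auto
  then obtain i where i: "i \<in> I" by auto
  define K where "K = I - {i}"
  have I: "I = insert i K" "finite K" "i \<notin> K" using i insert.prems(1) by (auto simp: K_def)
  obtain B where B: "gauss_rotation I B"
    "\<And>k. k \<in> I \<Longrightarrow> (\<Sum>n\<in>I. u l n * B n k) = (if k = i then of_real (sqrt (\<Sum>n\<in>I. (cmod (u l n))\<^sup>2)) else 0)"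
    using exists_gauss_rotation[OF insert.prems(1) i, of "u l"] by blast
  have "complex_of_real (\<Sum>n\<in>I. (cmod (u l n))\<^sup>2) = 1"
    using on[of l l] by (simp add: complex_norm_square del: of_real_power)
  then have n1: "(\<Sum>n\<in>I. (cmod (u l n))\<^sup>2) = 1" by (simp only: of_real_eq_1_iff)
  define w where "w j k = (\<Sum>n\<in>I. u j n * B n k)" for j k
  have wl: "w l k = (if k = i then 1 else 0)" if "k \<in> I" for k
    using B(2)[OF that] n1 by (simp add: w_def)
  have won: "(\<Sum>k\<in>I. w j k * cnj (w m k)) = (if j = m then 1 else 0)" if "j \<in> insert l J" "m \<in> insert l J" for j m
    unfolding w_def using gauss_rotation_inner[OF B(1) insert.prems(1)] on[OF that] by simp
  have wi: "w j i = 0" if "j \<in> J" for j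
  proof -
    have "(\<Sum>k\<in>I. w j k * cnj (w l k)) = (\<Sum>k\<in>I. if k = i then w j i else 0)"
      by (intro sum.cong) (auto simp: wl)
    then show ?thesis using won[of j l] that i insert.hyps insert.prems(1) by (auto split: if_splits)
  qed
  have wK: "(\<Sum>k\<in>K. w j k * cnj (w m k)) = (if j = m then 1 else 0)" if "j \<in> J" "m \<in> J" for j m
    using won[of j m] that I wi by simp
  have [measurable]: "(\<lambda>x. \<Prod>j\<in>insert l J. \<phi> j (\<Sum>n\<in>I. u j n * x n)) \<in> borel_measurable (gprod I)"
    by measurable
  have [measurable]: "(\<lambda>x. \<Prod>j\<in>insert l J. \<phi> j (\<Sum>n\<in>I. w j n * x n)) \<in> borel_measurable (gprod I)"
    by measurable
  have "(\<integral>\<^sup>+x. (\<Prod>j\<in>insert l J. \<phi> j (\<Sum>n\<in>I. u j n * x n)) \<partial>gprod I)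
    = (\<integral>\<^sup>+x. (\<Prod>j\<in>insert l J. \<phi> j (\<Sum>n\<in>I. u j n * mapply I B x n)) \<partial>gprod I)"
    by (rule gauss_rotationD(2)[OF B(1), symmetric]) measurable
  also have "\<dots> = (\<integral>\<^sup>+x. (\<Prod>j\<in>insert l J. \<phi> j (\<Sum>n\<in>I. w j n * x n)) \<partial>gprod I)"
    by (simp add: sum_mapply[OF insert.prems(1)] w_def)
  also have "\<dots> = (\<integral>\<^sup>+x. \<integral>\<^sup>+a. (\<Prod>j\<in>insert l J. \<phi> j (\<Sum>n\<in>I. w j n * (x(i := a)) n)) \<partial>cgauss \<partial>gprod K)"
    unfolding I(1) by (rule gp.product_nn_integral_insert) (use I in \<open>auto simp: I(1)[symmetric]\<close>)
  also have "\<dots> = (\<integral>\<^sup>+x. (\<Prod>j\<in>J. \<phi> j (\<Sum>n\<in>K. w j n * x n)) * (\<integral>\<^sup>+a. \<phi> l a \<partial>cgauss) \<partial>gprod K)"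
  proof (rule nn_integral_cong)
    fix x
    have 1: "(\<Sum>n\<in>I. w l n * (x(i := a)) n) = a" for a
    proof -
      have "(\<Sum>n\<in>I. w l n * (x(i := a)) n) = (\<Sum>n\<in>I. if n = i then a else 0)"
        by (intro sum.cong) (auto simp: wl)
      then show ?thesis using i insert.prems(1) by simp
    qed
    have 2: "(\<Sum>n\<in>I. w j n * (x(i := a)) n) = (\<Sum>n\<in>K. w j n * x n)" if "j \<in> J" for a j
    proof -
      have "(\<Sum>n\<in>K. w j n * (x(i := a)) n) = (\<Sum>n\<in>K. w j n * x n)"
        using I by (intro sum.cong) auto
      then show ?thesis using wi[OF that] I by simp
    qed
    have "(\<integral>\<^sup>+a. (\<Prod>j\<in>insert l J. \<phi> j (\<Sum>n\<in>I. w j n * (x(i := a)) n)) \<partial>cgauss)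
       = (\<integral>\<^sup>+a. (\<Prod>j\<in>J. \<phi> j (\<Sum>n\<in>K. w j n * x n)) * \<phi> l a \<partial>cgauss)"
      using insert.hyps by (intro nn_integral_cong) (simp add: 1 2 mult.commute del: fun_upd_apply)
    then show "(\<integral>\<^sup>+a. (\<Prod>j\<in>insert l J. \<phi> j (\<Sum>n\<in>I. w j n * (x(i := a)) n)) \<partial>cgauss)
       = (\<Prod>j\<in>J. \<phi> j (\<Sum>n\<in>K. w j n * x n)) * (\<integral>\<^sup>+a. \<phi> l a \<partial>cgauss)"
      by (simp add: nn_integral_cmult)
  qed
  also have "\<dots> = (\<Prod>j\<in>J. \<integral>\<^sup>+z. \<phi> j z \<partial>cgauss) * (\<integral>\<^sup>+a. \<phi> l a \<partial>cgauss)"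
    using insert.prems(3) by (subst nn_integral_multc, measurable) (subst insert.IH[OF I(2) wK], auto)
  finally show ?case using insert.hyps by (simp add: mult.commute)
qed

section \<open>The Prekopa--Leindler inequality\<close>

lemma nn_integral_layer_cake:
  fixes f :: "'a \<Rightarrow> real"
  assumes "sigma_finite_measure M" and [measurable]: "f \<in> borel_measurable M" and "\<And>x. 0 \<le> f x"
  shows "(\<integral>\<^sup>+x. ennreal (f x) \<partial>M) = (\<integral>\<^sup>+t. emeasure M {x\<in>space M. t < f x} * indicator {0..} t \<partial>lborel)"
proof -
  interpret M: sigma_finite_measure M by fact
  interpret P: pair_sigma_finite M lborel by standard
  have "(\<integral>\<^sup>+x. ennreal (f x) \<partial>M) = (\<integral>\<^sup>+x. (\<integral>\<^sup>+t. indicator {p. 0 \<le> snd p \<and> snd p < f (fst p)} (x, t) \<partial>lborel) \<partial>M)"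
  proof (rule nn_integral_cong)
    fix x
    have "(\<integral>\<^sup>+t. indicator {p. 0 \<le> snd p \<and> snd p < f (fst p)} (x, t) \<partial>lborel)
      = (\<integral>\<^sup>+t. indicator {0..<f x} t \<partial>lborel)"
      by (intro nn_integral_cong) (auto split: split_indicator)
    then show "ennreal (f x) = (\<integral>\<^sup>+t. indicator {p. 0 \<le> snd p \<and> snd p < f (fst p)} (x, t) \<partial>lborel)"
      using assms(3)[of x] by simp
  qed
  also have "\<dots> = (\<integral>\<^sup>+t. (\<integral>\<^sup>+x. indicator {p. 0 \<le> snd p \<and> snd p < f (fst p)} (x, t) \<partial>M) \<partial>lborel)"
  proof (rule P.Fubini'[symmetric])
    have "Measurable.pred (M \<Otimes>\<^sub>M lborel) (\<lambda>p. 0 \<le> snd p \<and> snd p < f (fst p))" by measurable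
    then have "(indicator {p \<in> space (M \<Otimes>\<^sub>M lborel). 0 \<le> snd p \<and> snd p < f (fst p)} :: _ \<Rightarrow> ennreal) \<in> borel_measurable (M \<Otimes>\<^sub>M lborel)"
      by (intro borel_measurable_indicator) (auto simp: pred_def)
    then show "(\<lambda>(x, t). indicator {p. 0 \<le> snd p \<and> snd p < f (fst p)} (x, t) :: ennreal) \<in> borel_measurable (M \<Otimes>\<^sub>M lborel)"
      by (rule measurable_cong[THEN iffD1, rotated]) (auto split: split_indicator)
  qed
  also have "\<dots> = (\<integral>\<^sup>+t. emeasure M {x\<in>space M. t < f x} * indicator {0..} t \<partial>lborel)"
  proof (rule nn_integral_cong)
    fix t
    have "(\<integral>\<^sup>+x. indicator {p. 0 \<le> snd p \<and> snd p < f (fst p)} (x, t) \<partial>M)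
      = (\<integral>\<^sup>+x. indicator {0..} t * indicator {x\<in>space M. t < f x} x \<partial>M)"
      by (intro nn_integral_cong) (auto split: split_indicator)
    then show "(\<integral>\<^sup>+x. indicator {p. 0 \<le> snd p \<and> snd p < f (fst p)} (x, t) \<partial>M) = emeasure M {x\<in>space M. t < f x} * indicator {0..} t"
      by (simp add: nn_integral_cmult mult.commute)
  qed
  finally show ?thesis .
qed

text \<open>The multiplicative form with \<open>powr\<close> admits functions with zeros, such as
  indicators of convex sets, because \<open>0 powr s = 0\<close>.\<close>

definition log_concave :: "('a::real_vector \<Rightarrow> real) \<Rightarrow> bool" where
  "log_concave f \<longleftrightarrow> (\<forall>x y s. 0 < s \<longrightarrow> s < 1 \<longrightarrow>
     f x powr s * f y powr (1 - s) \<le> f (s *\<^sub>R x + (1 - s) *\<^sub>R y))"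

lemma log_concaveD:
  "log_concave f \<Longrightarrow> 0 < s \<Longrightarrow> s < 1 \<Longrightarrow> f x powr s * f y powr (1 - s) \<le> f (s *\<^sub>R x + (1 - s) *\<^sub>R y)"
  by (auto simp: log_concave_def)

lemma log_concave_level_sets_convex:
  assumes "log_concave f" "0 \<le> t"
  shows "convex {x. t < f x}"
proof (rule convexI)
  fix x y :: 'a and u v :: real
  assume xy: "x \<in> {x. t < f x}" "y \<in> {x. t < f x}" and uv: "0 \<le> u" "0 \<le> v" "u + v = 1"
  have v: "v = 1 - u" using uv by simp
  show "u *\<^sub>R x + v *\<^sub>R y \<in> {x. t < f x}"
  proof (cases "u = 0 \<or> u = 1")
    case True then show ?thesis using xy v by auto
  next
    case False
    then have u: "0 < u" "u < 1" using uv by auto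
    have "t = t powr u * t powr (1 - u)" using assms(2) by (simp add: powr_add[symmetric])
    also have "\<dots> < f x powr u * f y powr (1 - u)"
      using xy u assms(2) by (intro mult_strict_mono' powr_less_mono2) auto
    also have "\<dots> \<le> f (u *\<^sub>R x + (1 - u) *\<^sub>R y)" using assms(1) u by (rule log_concaveD)
    finally show ?thesis using v by simp
  qed
qed

text \<open>The one-dimensional Brunn--Minkowski inequality for intervals. A segment in
  \<open>A\<close> and a segment in \<open>B\<close> combine to a segment in \<open>D\<close> whose
  length is the weighted sum of theirs; taking longest segments gives the claim. Nonemptiness is
  essential, since an empty \<open>A\<close> says nothing about \<open>D\<close>.\<close>

lemma measure_convex_combination_le:
  fixes A B D :: "real set"
  assumes cv: "convex A" "convex B" and ne: "A \<noteq> {}" "B \<noteq> {}" and D: "D \<in> sets borel"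
    and l: "0 < l" "l < 1" and AB: "\<And>a b. a \<in> A \<Longrightarrow> b \<in> B \<Longrightarrow> l * a + (1 - l) * b \<in> D"
  shows "ennreal l * emeasure lborel A + ennreal (1 - l) * emeasure lborel B \<le> emeasure lborel D"
proof (cases "emeasure lborel D = \<infinity>")
  case False
  then obtain m where m: "emeasure lborel D = ennreal m" "0 \<le> m"
    by (cases "emeasure lborel D") auto
  have key: "l * (a2 - a1) + (1 - l) * (b2 - b1) \<le> m"
    if a: "a1 \<in> A" "a2 \<in> A" "a1 \<le> a2" and b: "b1 \<in> B" "b2 \<in> B" "b1 \<le> b2" for a1 a2 b1 b2
  proof -
    define p q where "p = l * a1 + (1 - l) * b1" and "q = l * a2 + (1 - l) * b2"
    have pq: "p \<le> q" unfolding p_def q_def using a b l by (intro add_mono mult_left_mono) auto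
    have "{p..q} \<subseteq> D"
    proof
      fix x assume x: "x \<in> {p..q}"
      define s where "s = (if p = q then 0 else (x - p) / (q - p))"
      have s: "0 \<le> s" "s \<le> 1" "x = p + s * (q - p)"
        using x by (auto simp: s_def divide_simps)
      have "(1 - s) *\<^sub>R a1 + s *\<^sub>R a2 \<in> A" "(1 - s) *\<^sub>R b1 + s *\<^sub>R b2 \<in> B"
        using cv a b s by (auto intro!: convexD simp del: real_scaleR_def)
      from AB[OF this] have "l * ((1 - s) * a1 + s * a2) + (1 - l) * ((1 - s) * b1 + s * b2) \<in> D" by simp
      also have "l * ((1 - s) * a1 + s * a2) + (1 - l) * ((1 - s) * b1 + s * b2) = x"
        unfolding s(3) p_def q_def by (simp add: algebra_simps)
      finally show "x \<in> D" .
    qed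
    then have "emeasure lborel {p..q} \<le> ennreal m"
      using D unfolding m(1)[symmetric] by (intro emeasure_mono) auto
    then have "q - p \<le> m" using pq m by (simp add: ennreal_le_iff)
    then show ?thesis by (simp add: p_def q_def algebra_simps)
  qed
  obtain a0 b0 where ab0: "a0 \<in> A" "b0 \<in> B" using ne by auto
  \<comment> \<open>\<open>K\<close> is \<open>Sup S - Inf S\<close>: it bounds the measure of
    \<open>S\<close>, and it is nearly attained by two points of \<open>S\<close>, to which
    \<open>key\<close> applies.\<close>
  have len: "\<exists>K\<ge>0. emeasure lborel S \<le> ennreal K \<and> (\<forall>e>0. \<exists>x\<in>S. \<exists>y\<in>S. x \<le> y \<and> K - e \<le> y - x)"
    if S: "S \<noteq> {}" and bd: "\<And>x y. x \<in> S \<Longrightarrow> y \<in> S \<Longrightarrow> x \<le> y \<Longrightarrow> y - x \<le> c" for S :: "real set" and c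
  proof -
    obtain x0 where x0: "x0 \<in> S" using S by auto
    have bdd: "bdd_above S" "bdd_below S"
    proof -
      have "\<bar>x - x0\<bar> \<le> c" if "x \<in> S" for x
        using bd[of x x0] bd[of x0 x] x0 that by (cases "x \<le> x0") auto
      then have "x \<le> x0 + c" "x0 - c \<le> x" if "x \<in> S" for x using that by (auto simp: abs_le_iff) (smt (verit))+
      then show "bdd_above S" "bdd_below S" unfolding bdd_above_def bdd_below_def by blast+
    qed
    have sub: "S \<subseteq> {Inf S..Sup S}" using bdd by (auto intro: cInf_lower cSup_upper)
    have "Inf S \<le> Sup S" using sub x0 by auto
    show ?thesis
    proof (intro exI[of _ "Sup S - Inf S"] conjI allI impI)
      show "0 \<le> Sup S - Inf S" using \<open>Inf S \<le> Sup S\<close> by simp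
      have "emeasure lborel S \<le> emeasure lborel {Inf S..Sup S}"
        using sub by (intro emeasure_mono) auto
      then show "emeasure lborel S \<le> ennreal (Sup S - Inf S)" using \<open>Inf S \<le> Sup S\<close> by simp
      fix e :: real assume e: "0 < e"
      obtain y where y: "y \<in> S" "Sup S - e/2 < y"
        using less_cSup_iff[OF S bdd(1), of "Sup S - e/2"] e by auto
      obtain x where x: "x \<in> S" "x < Inf S + e/2"
        using cInf_less_iff[OF S bdd(2), of "Inf S + e/2"] e by auto
      show "\<exists>x\<in>S. \<exists>y\<in>S. x \<le> y \<and> Sup S - Inf S - e \<le> y - x"
      proof (cases "x \<le> y")
        case True then show ?thesis using x y by (intro bexI[of _ x] bexI[of _ y]) auto
      next
        case False then show ?thesis using x y by (intro bexI[of _ x]) auto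
      qed
    qed
  qed
  have bA: "y - x \<le> m / l" if "x \<in> A" "y \<in> A" "x \<le> y" for x y
    using key[OF that ab0(2) ab0(2)] l by (simp add: field_simps)
  have bB: "y - x \<le> m / (1 - l)" if "x \<in> B" "y \<in> B" "x \<le> y" for x y
    using key[OF ab0(1) ab0(1) _ that] l by (simp add: field_simps)
  obtain K where K: "0 \<le> K" "emeasure lborel A \<le> ennreal K" "\<And>e. e > 0 \<Longrightarrow> \<exists>x\<in>A. \<exists>y\<in>A. x \<le> y \<and> K - e \<le> y - x"
    using len[OF ne(1) bA] by blast
  obtain K' where K': "0 \<le> K'" "emeasure lborel B \<le> ennreal K'" "\<And>e. e > 0 \<Longrightarrow> \<exists>x\<in>B. \<exists>y\<in>B. x \<le> y \<and> K' - e \<le> y - x"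
    using len[OF ne(2) bB] by blast
  have "l * K + (1 - l) * K' \<le> m"
  proof (rule field_le_epsilon)
    fix e :: real assume e: "0 < e"
    obtain x y where xy: "x \<in> A" "y \<in> A" "x \<le> y" "K - e \<le> y - x" using K(3)[OF e] by blast
    obtain x' y' where xy': "x' \<in> B" "y' \<in> B" "x' \<le> y'" "K' - e \<le> y' - x'" using K'(3)[OF e] by blast
    have "l * (K - e) + (1 - l) * (K' - e) \<le> l * (y - x) + (1 - l) * (y' - x')"
      using l xy xy' by (intro add_mono mult_left_mono) auto
    also have "\<dots> \<le> m" by (rule key) fact+
    finally show "l * K + (1 - l) * K' \<le> m + e" by (simp add: algebra_simps)
  qed
  then have "ennreal l * ennreal K + ennreal (1 - l) * ennreal K' \<le> ennreal m"
    using l K K' by (simp add: ennreal_mult'[symmetric] ennreal_plus[symmetric] ennreal_le_iff m del: ennreal_plus)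
  then show ?thesis unfolding m(1)
    by (rule order_trans[rotated]) (intro add_mono mult_left_mono K K', auto)
qed auto

lemma ennreal_combination_leD:
  assumes "0 \<le> l" "0 \<le> m" "0 \<le> a" "0 \<le> b" "0 \<le> c"
    and "ennreal l * ennreal a + ennreal m * ennreal b \<le> ennreal c"
  shows "l * a + m * b \<le> c"
  using assms by (simp add: ennreal_mult[symmetric] ennreal_plus[symmetric] ennreal_le_iff del: ennreal_plus)

lemma weighted_arith_geo_mean:
  fixes x y l :: real
  assumes "0 < l" "l < 1" "0 \<le> x" "0 \<le> y"
  shows "x powr l * y powr (1 - l) \<le> l * x + (1 - l) * y"
proof (cases "x = 0 \<or> y = 0")
  case True
  then show ?thesis using assms by auto
next
  case False
  then show ?thesis using assms by (intro Youngs_inequality_0) auto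
qed

text \<open>Dividing \<open>F\<close> and \<open>G\<close> by their suprema makes every level set
  below height 1 nonempty, so one-dimensional Brunn--Minkowski applies at each such height.
  Integrating over heights gives an inequality with a weighted arithmetic mean on the left, and the
  weighted arithmetic--geometric mean inequality turns it into the stated product. Log-concavity of
  \<open>F\<close> and \<open>G\<close> makes their level sets intervals.\<close>

lemma prekopa_leindler_real:
  fixes F G H :: "real \<Rightarrow> real"
  assumes F: "log_concave F" "\<And>x. 0 \<le> F x" "\<And>x. F x \<le> c" "integrable lborel F"
    and G: "log_concave G" "\<And>x. 0 \<le> G x" "\<And>x. G x \<le> c" "integrable lborel G"
    and H: "\<And>x. 0 \<le> H x" "integrable lborel H"
    and l: "0 < l" "l < 1"
    and FGH: "\<And>x y. F x powr l * G y powr (1 - l) \<le> H (l * x + (1 - l) * y)"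
  shows "(integral\<^sup>L lborel F) powr l * (integral\<^sup>L lborel G) powr (1 - l) \<le> integral\<^sup>L lborel H"
proof -
  note [measurable] = borel_measurable_integrable[OF F(4)] borel_measurable_integrable[OF G(4)] borel_measurable_integrable[OF H(2)]
  define f g where "f = Sup (range F)" and "g = Sup (range G)"
  have bdd: "bdd_above (range F)" "bdd_above (range G)"
    using F(3) G(3) by (auto simp: bdd_above_def)
  have le: "F x \<le> f" "G x \<le> g" for x
    unfolding f_def g_def using bdd by (auto intro: cSup_upper)
  have H0: "0 \<le> integral\<^sup>L lborel H" using H by simp
  consider "f \<le> 0" | "g \<le> 0" | "0 < f" "0 < g" by linarith
  then show ?thesis
  proof cases
    case 1
    then have "F = (\<lambda>_. 0)" using le F(2) by (intro ext) (meson order_antisym order_trans)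
    then show ?thesis using H0 by simp
  next
    case 2
    then have "G = (\<lambda>_. 0)" using le G(2) by (intro ext) (meson order_antisym order_trans)
    then show ?thesis using H0 by simp
  next
    case 3
    define h where "h = f powr l * g powr (1 - l)"
    have h: "0 < h" using 3 by (simp add: h_def)
    have level: "ennreal l * emeasure lborel {x. t < F x / f} + ennreal (1 - l) * emeasure lborel {x. t < G x / g}
        \<le> emeasure lborel {x. t < H x / h}" if t: "0 \<le> t" for t
    proof (cases "t < 1")
      case True
      have A: "{x. t < F x / f} = {x. t * f < F x}" and B: "{x. t < G x / g} = {x. t * g < G x}"
        using 3 by (auto simp: field_simps)
      show ?thesis unfolding A B
      proof (rule measure_convex_combination_le)
        show "convex {x. t * f < F x}" "convex {x. t * g < G x}"
          using F G 3 t by (auto intro!: log_concave_level_sets_convex)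
        have "t * f < f" "t * g < g" using 3 True by auto
        then show "{x. t * f < F x} \<noteq> {}" "{x. t * g < G x} \<noteq> {}"
          unfolding f_def g_def using less_cSup_iff[OF _ bdd(1)] less_cSup_iff[OF _ bdd(2)] by auto
        fix a b assume ab: "a \<in> {x. t * f < F x}" "b \<in> {x. t * g < G x}"
        have "t * h = (t powr l * t powr (1 - l)) * h" using t by (simp add: powr_add[symmetric])
        also have "\<dots> = (t * f) powr l * (t * g) powr (1 - l)"
          using 3 t by (simp add: h_def powr_mult)
        also have "\<dots> < F a powr l * G b powr (1 - l)"
          using ab l 3 t by (intro mult_strict_mono' powr_less_mono2) auto
        also have "\<dots> \<le> H (l * a + (1 - l) * b)" by (rule FGH)
        finally show "l * a + (1 - l) * b \<in> {x. t < H x / h}" using h by (simp add: field_simps)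
      qed (use l in auto)
    next
      case False
      have "\<not> t < F x / f" "\<not> t < G x / g" for x
        using False le[of x] 3 by (auto simp: field_simps not_less intro: order_trans)
      then show ?thesis by simp
    qed
    have nn: "(\<integral>\<^sup>+x. ennreal (K x / k) \<partial>lborel) = ennreal (integral\<^sup>L lborel K / k)"
      if "integrable lborel K" "\<And>x. 0 \<le> K x" "0 < k" for K :: "real \<Rightarrow> real" and k
      using that by (subst nn_integral_eq_integral) auto
    have "ennreal l * (\<integral>\<^sup>+x. ennreal (F x / f) \<partial>lborel) + ennreal (1 - l) * (\<integral>\<^sup>+x. ennreal (G x / g) \<partial>lborel)
      = (\<integral>\<^sup>+t. (ennreal l * emeasure lborel {x. t < F x / f} + ennreal (1 - l) * emeasure lborel {x. t < G x / g}) * indicator {0..} t \<partial>lborel)"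
    proof -
      have m: "(\<lambda>t. emeasure lborel {x. t < K x} * indicator {0..} t) \<in> borel_measurable lborel"
        if [measurable]: "K \<in> borel_measurable borel" for K :: "real \<Rightarrow> real"
      proof -
        have "(\<lambda>t. emeasure lborel (Pair t -` {p\<in>space (lborel \<Otimes>\<^sub>M lborel). fst p < K (snd p)})) \<in> borel_measurable lborel"
          by (rule lborel.measurable_emeasure_Pair) measurable
        then show ?thesis by (simp add: space_pair_measure vimage_def)
      qed
      have "ennreal l * (\<integral>\<^sup>+x. ennreal (F x / f) \<partial>lborel) + ennreal (1 - l) * (\<integral>\<^sup>+x. ennreal (G x / g) \<partial>lborel)
        = ennreal l * (\<integral>\<^sup>+t. emeasure lborel {x. t < F x / f} * indicator {0..} t \<partial>lborel)
         + ennreal (1 - l) * (\<integral>\<^sup>+t. emeasure lborel {x. t < G x / g} * indicator {0..} t \<partial>lborel)"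
        using 3 F G by (subst (1 2) nn_integral_layer_cake) (auto simp: lborel.sigma_finite_measure_axioms)
      also have "\<dots> = (\<integral>\<^sup>+t. ennreal l * (emeasure lborel {x. t < F x / f} * indicator {0..} t)
          + ennreal (1 - l) * (emeasure lborel {x. t < G x / g} * indicator {0..} t) \<partial>lborel)"
        using m[of "\<lambda>x. F x / f"] m[of "\<lambda>x. G x / g"] by (simp add: nn_integral_add nn_integral_cmult)
      finally show ?thesis by (simp add: distrib_right mult.assoc)
    qed
    also have "\<dots> \<le> (\<integral>\<^sup>+t. emeasure lborel {x. t < H x / h} * indicator {0..} t \<partial>lborel)"
      using level by (intro nn_integral_mono) (auto split: split_indicator)
    also have "\<dots> = (\<integral>\<^sup>+x. ennreal (H x / h) \<partial>lborel)"
      using h H by (subst nn_integral_layer_cake) (auto simp: lborel.sigma_finite_measure_axioms)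
    finally have "ennreal l * ennreal (integral\<^sup>L lborel F / f) + ennreal (1 - l) * ennreal (integral\<^sup>L lborel G / g)
        \<le> ennreal (integral\<^sup>L lborel H / h)"
      using F G H 3 h by (simp add: nn)
    moreover have "0 \<le> integral\<^sup>L lborel F / f" "0 \<le> integral\<^sup>L lborel G / g" "0 \<le> integral\<^sup>L lborel H / h"
      using F G H 3 h by auto
    ultimately have "l * (integral\<^sup>L lborel F / f) + (1 - l) * (integral\<^sup>L lborel G / g) \<le> integral\<^sup>L lborel H / h"
      using l by (intro ennreal_combination_leD) auto
    moreover have "(integral\<^sup>L lborel F / f) powr l * (integral\<^sup>L lborel G / g) powr (1 - l)
      \<le> l * (integral\<^sup>L lborel F / f) + (1 - l) * (integral\<^sup>L lborel G / g)"
      using l F G 3 by (intro weighted_arith_geo_mean) auto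
    moreover have "(integral\<^sup>L lborel F / f) powr l * (integral\<^sup>L lborel G / g) powr (1 - l)
      = (integral\<^sup>L lborel F) powr l * (integral\<^sup>L lborel G) powr (1 - l) / h"
      using F G 3 by (simp add: powr_divide h_def)
    ultimately have "(integral\<^sup>L lborel F) powr l * (integral\<^sup>L lborel G) powr (1 - l) / h \<le> integral\<^sup>L lborel H / h"
      by linarith
    then show ?thesis using h by (simp add: divide_le_cancel)
  qed
qed

lemma integral_lborel_complex:
  fixes f :: "complex \<Rightarrow> real"
  assumes "integrable lborel f"
  shows "integral\<^sup>L lborel f = (\<integral>y. \<integral>x. f (Complex x y) \<partial>lborel \<partial>lborel)"
proof -
  have [measurable]: "f \<in> borel_measurable borel" using assms by auto
  have i: "integrable (lborel \<Otimes>\<^sub>M lborel) (\<lambda>p. f (Complex (fst p) (snd p)))"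
    using assms by (subst (asm) lborel_complex_eq) (simp add: integrable_distr_eq)
  have "integral\<^sup>L lborel f = (\<integral>p. f (Complex (fst p) (snd p)) \<partial>(lborel \<Otimes>\<^sub>M lborel))"
    by (subst lborel_complex_eq, subst integral_distr) auto
  also have "\<dots> = (\<integral>y. \<integral>x. f (Complex x y) \<partial>lborel \<partial>lborel)"
    using lborel_pair.integral_snd[of "\<lambda>x y. f (Complex x y)"] i by (simp add: case_prod_unfold)
  finally show ?thesis .
qed

lemma integrable_exp_minus_square: "integrable lborel (\<lambda>x::real. exp (- x\<^sup>2))"
  using gaussian_moment_0 integrable_normal_density[of 0 "sqrt (1/2)"]
proof -
  have "integrable lborel (\<lambda>x. sqrt pi * normal_density 0 (sqrt (1/2)) x)"
    by (intro integrable_mult_right) simp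
  then show ?thesis by (simp add: normal_density_def)
qed

text \<open>The real inequality is used twice: on horizontal slices, where it yields the
  three-function hypothesis for the integrals over the slices, and then on those integrals as
  functions of the imaginary part. Domination by the Gaussian weight supplies all the boundedness
  and integrability.\<close>

lemma prekopa_leindler_complex:
  fixes F G H :: "complex \<Rightarrow> real"
  assumes F: "log_concave F" "\<And>z. 0 \<le> F z" "\<And>z. F z \<le> exp (- (cmod z)\<^sup>2)" "F \<in> borel_measurable borel"
    and G: "log_concave G" "\<And>z. 0 \<le> G z" "\<And>z. G z \<le> exp (- (cmod z)\<^sup>2)" "G \<in> borel_measurable borel"
    and H: "log_concave H" "\<And>z. 0 \<le> H z" "\<And>z. H z \<le> exp (- (cmod z)\<^sup>2)" "H \<in> borel_measurable borel"
    and l: "0 < l" "l < 1"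
    and FGH: "\<And>x y. F x powr l * G y powr (1 - l) \<le> H (l *\<^sub>R x + (1 - l) *\<^sub>R y)"
  shows "(integral\<^sup>L lborel F) powr l * (integral\<^sup>L lborel G) powr (1 - l) \<le> integral\<^sup>L lborel H"
proof -
  have le: "exp (- (cmod (Complex x y))\<^sup>2) = exp (- y\<^sup>2) * exp (- x\<^sup>2)" for x y
    by (simp add: cmod_power2 exp_add[symmetric])
  define S where "S = integral\<^sup>L lborel (\<lambda>x::real. exp (- x\<^sup>2))"
  have S0: "0 \<le> S" unfolding S_def by simp
  have slice: "integrable lborel (\<lambda>x. K (Complex x y))" "K (Complex x y) \<le> 1"
     "log_concave (\<lambda>x. K (Complex x y))" "(\<integral>x. K (Complex x y) \<partial>lborel) \<le> exp (- y\<^sup>2) * S"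
    if K: "log_concave K" "\<And>z. 0 \<le> K z" "\<And>z. K z \<le> exp (- (cmod z)\<^sup>2)" "K \<in> borel_measurable borel"
    for K :: "complex \<Rightarrow> real" and x y
  proof -
    have [measurable]: "K \<in> borel_measurable borel" "(\<lambda>x. Complex x y) \<in> borel_measurable borel"
      using K(4) by (auto simp: Complex_eq)
    have ie: "integrable lborel (\<lambda>x. exp (- y\<^sup>2) * exp (- x\<^sup>2))"
      using integrable_exp_minus_square by simp
    show i: "integrable lborel (\<lambda>x. K (Complex x y))"
      by (rule Bochner_Integration.integrable_bound[OF ie]) (use K(2,3)[of "Complex _ y"] le in auto)
    show "K (Complex x y) \<le> 1" using K(3)[of "Complex x y"] by (rule order_trans) simp
    show "log_concave (\<lambda>x. K (Complex x y))"
      unfolding log_concave_def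
    proof (intro allI impI)
      fix a b s :: real assume s: "0 < s" "s < 1"
      have "s *\<^sub>R Complex a y + (1 - s) *\<^sub>R Complex b y = Complex (s *\<^sub>R a + (1 - s) *\<^sub>R b) y"
        by (simp add: complex_eq_iff algebra_simps)
      then show "K (Complex a y) powr s * K (Complex b y) powr (1 - s) \<le> K (Complex (s *\<^sub>R a + (1 - s) *\<^sub>R b) y)"
        using log_concaveD[OF K(1) s, of "Complex a y" "Complex b y"] by simp
    qed
    have "(\<integral>x. K (Complex x y) \<partial>lborel) \<le> (\<integral>x. exp (- y\<^sup>2) * exp (- x\<^sup>2) \<partial>lborel)"
      by (rule integral_mono[OF i ie]) (use K(3) le in metis)
    then show "(\<integral>x. K (Complex x y) \<partial>lborel) \<le> exp (- y\<^sup>2) * S" by (simp add: S_def)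
  qed
  have comb: "l' *\<^sub>R Complex a y + (1 - l') *\<^sub>R Complex b y' = Complex (l' * a + (1 - l') * b) (l' * y + (1 - l') * y')" for l' a b y y'
    by (simp add: complex_eq_iff)
  have marg: "(\<integral>x. F' (Complex x y) \<partial>lborel) powr s * (\<integral>x. G' (Complex x y') \<partial>lborel) powr (1 - s)
     \<le> (\<integral>x. H' (Complex x (s * y + (1 - s) * y')) \<partial>lborel)"
    if F': "log_concave F'" "\<And>z. 0 \<le> F' z" "\<And>z. F' z \<le> exp (- (cmod z)\<^sup>2)" "F' \<in> borel_measurable borel"
    and G': "log_concave G'" "\<And>z. 0 \<le> G' z" "\<And>z. G' z \<le> exp (- (cmod z)\<^sup>2)" "G' \<in> borel_measurable borel"
    and H': "log_concave H'" "\<And>z. 0 \<le> H' z" "\<And>z. H' z \<le> exp (- (cmod z)\<^sup>2)" "H' \<in> borel_measurable borel"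
    and s: "0 < s" "s < 1"
    and FGH': "\<And>x y. F' x powr s * G' y powr (1 - s) \<le> H' (s *\<^sub>R x + (1 - s) *\<^sub>R y)"
    for F' G' H' :: "complex \<Rightarrow> real" and s y y'
  proof (rule prekopa_leindler_real[where c = 1])
    show "F' (Complex a y) powr s * G' (Complex b y') powr (1 - s) \<le> H' (Complex (s * a + (1 - s) * b) (s * y + (1 - s) * y'))" for a b
      using FGH'[of "Complex a y" "Complex b y'"] unfolding comb .
  qed (use slice[OF F'] slice[OF G'] slice[OF H'] F'(2) G'(2) H'(2) s in auto)
  have int: "integrable lborel K" "integrable lborel (\<lambda>y. \<integral>x. K (Complex x y) \<partial>lborel)"
    "log_concave (\<lambda>y. \<integral>x. K (Complex x y) \<partial>lborel)"
    "(\<integral>x. K (Complex x y) \<partial>lborel) \<le> S" "0 \<le> (\<integral>x. K (Complex x y) \<partial>lborel)"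
    if K: "log_concave K" "\<And>z. 0 \<le> K z" "\<And>z. K z \<le> exp (- (cmod z)\<^sup>2)" "K \<in> borel_measurable borel"
    for K :: "complex \<Rightarrow> real" and y
  proof -
    have [measurable]: "K \<in> borel_measurable borel" by fact
    show n: "0 \<le> (\<integral>x. K (Complex x y) \<partial>lborel)" for y using K(2) by simp
    have "exp (- y\<^sup>2) * S \<le> 1 * S" using S0 by (intro mult_right_mono) auto
    then show "(\<integral>x. K (Complex x y) \<partial>lborel) \<le> S" using slice(4)[OF K, of y] by simp
    have ie: "integrable lborel (\<lambda>y. exp (- y\<^sup>2) * S)" using integrable_exp_minus_square by simp
    have "(\<lambda>p. K (Complex (snd p) (fst p))) \<in> borel_measurable (lborel \<Otimes>\<^sub>M lborel)"
    proof -
      have "(\<lambda>p. K (complex_of_real (snd p) + \<i> * complex_of_real (fst p))) \<in> borel_measurable (lborel \<Otimes>\<^sub>M lborel)"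
        by measurable
      then show ?thesis by (simp add: Complex_eq)
    qed
    then have m: "(\<lambda>y. \<integral>x. K (Complex x y) \<partial>lborel) \<in> borel_measurable lborel"
      by (intro lborel.borel_measurable_lebesgue_integral) (simp add: case_prod_beta)
    show "integrable lborel (\<lambda>y. \<integral>x. K (Complex x y) \<partial>lborel)"
      by (rule Bochner_Integration.integrable_bound[OF ie m]) (use slice(4)[OF K] n S0 in auto)
    \<comment> \<open>Log-concavity of the marginal is the slice inequality with the same function
      \<open>K\<close> in all three roles.\<close>
    show "log_concave (\<lambda>y. \<integral>x. K (Complex x y) \<partial>lborel)"
      unfolding log_concave_def real_scaleR_def
    proof (intro allI impI)
      fix a b s :: real assume s: "0 < s" "s < 1"
      show "(\<integral>x. K (Complex x a) \<partial>lborel) powr s * (\<integral>x. K (Complex x b) \<partial>lborel) powr (1 - s)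
         \<le> (\<integral>x. K (Complex x (s * a + (1 - s) * b)) \<partial>lborel)"
        by (rule marg[OF K K K s]) (rule log_concaveD[OF K(1) s])
    qed
    have "(\<integral>\<^sup>+z. ennreal (1 / pi * exp (- (cmod z)\<^sup>2)) * 1 \<partial>lborel) = 1"
      by (subst nn_integral_cgauss[symmetric]) (auto simp: cgauss.emeasure_space_1[simplified])
    then have "integrable lborel (\<lambda>z::complex. 1 / pi * exp (- (cmod z)\<^sup>2))"
      by (intro integrableI_nonneg) (auto simp del: times_divide_eq_left)
    then have "integrable lborel (\<lambda>z::complex. pi * (1 / pi * exp (- (cmod z)\<^sup>2)))"
      by (rule integrable_mult_right)
    then have "integrable lborel (\<lambda>z::complex. exp (- (cmod z)\<^sup>2))" by simp
    then show "integrable lborel K"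
      by (rule Bochner_Integration.integrable_bound) (use K(2,3) in auto)
  qed
  show ?thesis
    unfolding integral_lborel_complex[OF int(1)[OF F]] integral_lborel_complex[OF int(1)[OF G]] integral_lborel_complex[OF int(1)[OF H]]
  proof (rule prekopa_leindler_real[where c = S])
    show "(\<integral>x. F (Complex x a) \<partial>lborel) powr l * (\<integral>x. G (Complex x b) \<partial>lborel) powr (1 - l)
       \<le> (\<integral>x. H (Complex x (l * a + (1 - l) * b)) \<partial>lborel)" for a b
      by (rule marg[OF F G H l FGH])
  qed (use int[OF F] int[OF G] int[OF H] l in auto)
qed

section \<open>Gaussian marginals of log-concave functions\<close>

definition log_concave_fun :: "(('i \<Rightarrow> complex) \<Rightarrow> real) \<Rightarrow> bool" where
  "log_concave_fun f \<longleftrightarrow> (\<forall>u v s. 0 < s \<longrightarrow> s < 1 \<longrightarrow>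
     f u powr s * f v powr (1 - s) \<le> f (\<lambda>n. s *\<^sub>R u n + (1 - s) *\<^sub>R v n))"

lemma exp_minus_norm_square_log_concave:
  assumes "0 < s" "s < 1"
  shows "(exp (- (cmod x)\<^sup>2)) powr s * (exp (- (cmod y)\<^sup>2)) powr (1 - s) \<le> exp (- (cmod (s *\<^sub>R x + (1 - s) *\<^sub>R y))\<^sup>2)"
proof -
  have "(cmod (s *\<^sub>R x + (1 - s) *\<^sub>R y))\<^sup>2 \<le> (s * cmod x + (1 - s) * cmod y)\<^sup>2"
    using assms by (intro power_mono norm_triangle_le) auto
  also have "\<dots> = s * (cmod x)\<^sup>2 + (1 - s) * (cmod y)\<^sup>2 - s * (1 - s) * (cmod x - cmod y)\<^sup>2"
    by (simp add: power2_eq_square algebra_simps)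
  also have "\<dots> \<le> s * (cmod x)\<^sup>2 + (1 - s) * (cmod y)\<^sup>2" using assms by simp
  finally show ?thesis by (simp add: powr_def exp_add[symmetric])
qed

text \<open>The Gaussian weight is log-concave and is absorbed into the integrand. The inequality
  needed between two points \<open>u\<close> and \<open>v\<close> is then Prekopa--Leindler in the
  integrated coordinate, for the three slices through \<open>u\<close>, through \<open>v\<close> and
  through their convex combination.\<close>

lemma log_concave_fun_marginal:
  assumes f: "log_concave_fun f" "\<And>u. 0 \<le> f u" "\<And>u. f u \<le> 1"
    and [measurable]: "f \<in> borel_measurable (PiM UNIV (\<lambda>_. borel))"
  shows "log_concave_fun (\<lambda>u. \<integral>t. f (u(i := t)) \<partial>cgauss)"
  unfolding log_concave_fun_def
proof (intro allI impI)
  fix u v :: "'a \<Rightarrow> complex" and s :: real assume s: "0 < s" "s < 1"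
  let ?g = "\<lambda>u t. f (u(i := t)) * exp (- (cmod t)\<^sup>2)"
  have upd [measurable]: "(\<lambda>t. u(i := t)) \<in> measurable borel (PiM UNIV (\<lambda>_. borel))" for u :: "'a \<Rightarrow> complex"
    by (rule measurable_fun_upd[where J = UNIV]) (auto simp: space_PiM)
  have int: "(\<integral>t. f (u(i := t)) \<partial>cgauss) = 1 / pi * (\<integral>t. ?g u t \<partial>lborel)" for u
    unfolding cgauss_def by (subst integral_density) (auto simp: integral_mult_right_zero[symmetric] mult_ac)
  have pos: "0 \<le> ?g u t" for u t using f(2) by simp
  have le: "?g u t \<le> exp (- (cmod t)\<^sup>2)" for u t
    using mult_right_mono[OF f(3)[of "u(i:=t)"], of "exp (- (cmod t)\<^sup>2)"] by simp
  have three: "?g u x powr s * ?g v y powr (1 - s) \<le> ?g (\<lambda>n. s *\<^sub>R u n + (1 - s) *\<^sub>R v n) (s *\<^sub>R x + (1 - s) *\<^sub>R y)"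
    if s: "0 < s" "s < 1" for u v x y s
  proof -
    have e: "(\<lambda>n. s *\<^sub>R (u(i := x)) n + (1 - s) *\<^sub>R (v(i := y)) n) = (\<lambda>n. s *\<^sub>R u n + (1 - s) *\<^sub>R v n)(i := s *\<^sub>R x + (1 - s) *\<^sub>R y)"
      by auto
    have "?g u x powr s * ?g v y powr (1 - s) = (f (u(i := x)) powr s * f (v(i := y)) powr (1 - s))
        * ((exp (- (cmod x)\<^sup>2)) powr s * (exp (- (cmod y)\<^sup>2)) powr (1 - s))"
      using f(2) by (simp add: powr_mult)
    also have "\<dots> \<le> f (\<lambda>n. s *\<^sub>R (u(i := x)) n + (1 - s) *\<^sub>R (v(i := y)) n) * exp (- (cmod (s *\<^sub>R x + (1 - s) *\<^sub>R y))\<^sup>2)"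
    proof (rule mult_mono[OF _ exp_minus_norm_square_log_concave[OF s]])
      show "f (u(i := x)) powr s * f (v(i := y)) powr (1 - s) \<le> f (\<lambda>n. s *\<^sub>R (u(i := x)) n + (1 - s) *\<^sub>R (v(i := y)) n)"
        using f(1) s unfolding log_concave_fun_def by blast
    qed (auto simp: f(2))
    finally show ?thesis unfolding e .
  qed
  have lc: "log_concave (?g u)" for u
    unfolding log_concave_def
  proof (intro allI impI)
    fix x y :: complex and s :: real assume s: "0 < s" "s < 1"
    have "(\<lambda>n. s *\<^sub>R u n + (1 - s) *\<^sub>R u n) = u" by (auto simp: algebra_simps)
    then show "?g u x powr s * ?g u y powr (1 - s) \<le> ?g u (s *\<^sub>R x + (1 - s) *\<^sub>R y)"
      using three[OF s, of u x u y] by simp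
  qed
  have pl: "(integral\<^sup>L lborel (?g u)) powr s * (integral\<^sup>L lborel (?g v)) powr (1 - s)
      \<le> integral\<^sup>L lborel (?g (\<lambda>n. s *\<^sub>R u n + (1 - s) *\<^sub>R v n))"
    by (rule prekopa_leindler_complex[OF lc pos le _ lc pos le _ lc pos le _ s three[OF s]]) measurable
  have pi: "(1 / pi) powr s * (1 / pi) powr (1 - s) = 1 / pi" by (simp add: powr_add[symmetric])
  have sc: "(1 / pi * X) powr s * (1 / pi * Y) powr (1 - s) = 1 / pi * (X powr s * Y powr (1 - s))"
    if "0 \<le> X" "0 \<le> Y" for X Y
  proof -
    have "(1 / pi * X) powr s * (1 / pi * Y) powr (1 - s)
       = ((1 / pi) powr s * (1 / pi) powr (1 - s)) * (X powr s * Y powr (1 - s))"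
      using that by (subst (1 2) powr_mult) (simp_all only: mult_ac)
    then show ?thesis unfolding pi .
  qed
  have p: "0 \<le> integral\<^sup>L lborel (?g u)" for u by (intro Bochner_Integration.integral_nonneg pos)
  show "(\<integral>t. f (u(i := t)) \<partial>cgauss) powr s * (\<integral>t. f (v(i := t)) \<partial>cgauss) powr (1 - s)
    \<le> (\<integral>t. f ((\<lambda>n. s *\<^sub>R u n + (1 - s) *\<^sub>R v n)(i := t)) \<partial>cgauss)"
    unfolding int sc[OF p p] by (rule mult_left_mono[OF pl]) simp
qed

lemma measurable_fun_upd_UNIV [measurable]:
  "(\<lambda>p. (fst p)(i := snd p)) \<in> measurable (PiM UNIV (\<lambda>_. borel) \<Otimes>\<^sub>M borel) (PiM UNIV (\<lambda>_. borel :: complex measure))"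
  by (rule measurable_fun_upd[where J = UNIV]) auto

definition override :: "'i set \<Rightarrow> ('i \<Rightarrow> complex) \<Rightarrow> ('i \<Rightarrow> complex) \<Rightarrow> 'i \<Rightarrow> complex" where
  "override I u y = (\<lambda>n. if n \<in> I then y n else u n)"

lemma measurable_override [measurable]:
  "override I u \<in> measurable (gprod I) (PiM UNIV (\<lambda>_. borel))"
proof (rule measurable_PiM_single')
  fix i show "(\<lambda>y. override I u y i) \<in> borel_measurable (gprod I)"
    unfolding override_def by (cases "i \<in> I") auto
qed auto

lemma integrable_gprod_bounded:
  assumes "\<And>u. 0 \<le> f u" "\<And>u. f u \<le> (1::real)" "f \<in> borel_measurable (gprod I)"
  shows "integrable (gprod I) f"
  by (rule finite_measure.integrable_const_bound[OF prob_space.finite_measure[OF prob_space_gprod], where B = 1])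
    (use assms in auto)

lemma log_concave_fun_marginals:
  assumes "finite I" and f: "log_concave_fun f" "\<And>u. 0 \<le> f u" "\<And>u. f u \<le> 1"
    and m: "f \<in> borel_measurable (PiM UNIV (\<lambda>_. borel))"
  shows "log_concave_fun (\<lambda>u. \<integral>y. f (override I u y) \<partial>gprod I)"
  using assms
proof (induction I arbitrary: f rule: finite_induct)
  case empty
  have "override {} u y = u" for u y :: "'a \<Rightarrow> complex" by (simp add: override_def)
  then show ?case using empty by (simp add: prob_space.prob_space[OF prob_space_gprod])
next
  case (insert i I)
  note [measurable] = insert.prems(4)
  let ?g = "\<lambda>u. \<integral>t. f (u(i := t)) \<partial>cgauss"
  have "(\<lambda>p. f ((fst p)(i := snd p))) \<in> borel_measurable (PiM UNIV (\<lambda>_. borel) \<Otimes>\<^sub>M cgauss)"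
    by measurable
  then have gm: "?g \<in> borel_measurable (PiM UNIV (\<lambda>_. borel))"
    by (intro cgauss.borel_measurable_lebesgue_integral) (simp add: case_prod_beta)
  have upd [measurable]: "(\<lambda>t. u(i := t)) \<in> measurable borel (PiM UNIV (\<lambda>_. borel))" for u :: "'a \<Rightarrow> complex"
    by (rule measurable_fun_upd[where J = UNIV]) (auto simp: space_PiM)
  have g1: "?g u \<le> 1" for u
  proof -
    have "?g u \<le> (\<integral>t. 1 \<partial>cgauss)"
      using insert.prems by (intro integral_mono cgauss.integrable_const_bound[where B = 1]) auto
    then show ?thesis using cgauss.prob_space by simp
  qed
  have "log_concave_fun (\<lambda>u. \<integral>y. ?g (override I u y) \<partial>gprod I)"
    by (rule insert.IH[OF log_concave_fun_marginal[OF insert.prems] _ g1 gm])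
      (use insert.prems in \<open>auto intro!: Bochner_Integration.integral_nonneg\<close>)
  moreover have "(\<integral>y. f (override (insert i I) u y) \<partial>gprod (insert i I)) = (\<integral>y. ?g (override I u y) \<partial>gprod I)" for u
  proof -
    have ov: "override (insert i I) u (y(i := t)) = (override I u y)(i := t)" for y t
      by (auto simp: override_def)
    have "(\<integral>y. f (override (insert i I) u y) \<partial>gprod (insert i I))
       = (\<integral>y. (\<integral>t. f (override (insert i I) u (y(i := t))) \<partial>cgauss) \<partial>gprod I)"
      by (rule gp.product_integral_insert[OF insert.hyps integrable_gprod_bounded]) (use insert.prems in auto)
    then show ?thesis by (simp only: ov)
  qed
  ultimately show ?case by simp
qed

section \<open>Unimodular symmetry and the Khatri--Sidak inequality\<close>

lemma distr_cgauss_unit: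
  assumes "cmod w = 1"
  shows "distr cgauss cgauss ((*) w) = cgauss"
proof (rule measure_eqI)
  fix A assume "A \<in> sets (distr cgauss cgauss ((*) w))"
  then have [measurable]: "A \<in> sets borel" by simp
  have "emeasure (distr cgauss cgauss ((*) w)) A = (\<integral>\<^sup>+z. indicator A z \<partial>distr cgauss cgauss ((*) w))"
    by simp
  also have "\<dots> = (\<integral>\<^sup>+z. indicator A (w * z) \<partial>cgauss)" by (rule nn_integral_distr) measurable
  also have "\<dots> = emeasure cgauss A"
    by (subst nn_integral_cgauss_unit[OF _ assms]) auto
  finally show "emeasure (distr cgauss cgauss ((*) w)) A = emeasure cgauss A" .
qed simp

lemma integral_gprod_unit:
  fixes f :: "('i \<Rightarrow> complex) \<Rightarrow> real"
  assumes "finite I" "cmod w = 1" and [measurable]: "f \<in> borel_measurable (gprod I)"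
  shows "(\<integral>y. f (\<lambda>n\<in>I. w * y n) \<partial>gprod I) = (\<integral>y. f y \<partial>gprod I)"
proof -
  have d: "distr (gprod I) (gprod I) (compose I ((*) w)) = PiM I (\<lambda>i. distr cgauss cgauss ((*) w))"
    by (rule distr_PiM_finite_prob_space') (use assms prob_space_cgauss in auto)
  have [measurable]: "compose I ((*) w) \<in> measurable (gprod I) (gprod I)"
    unfolding compose_def by measurable
  have "(\<integral>y. f y \<partial>gprod I) = (\<integral>y. f y \<partial>distr (gprod I) (gprod I) (compose I ((*) w)))"
    unfolding d distr_cgauss_unit[OF assms(2)] ..
  also have "\<dots> = (\<integral>y. f (compose I ((*) w) y) \<partial>gprod I)" by (rule integral_distr) measurable
  finally show ?thesis by (simp add: compose_def)
qed

text \<open>The complex analogue of a symmetric convex set: symmetry under negation becomes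
  invariance under a common unimodular factor. The last clause makes \<open>C\<close> a cylinder
  over \<open>I\<close>, so that it can live in the full function space while the measure lives on
  \<open>gprod I\<close>.\<close>

definition circled_convex :: "'i set \<Rightarrow> ('i \<Rightarrow> complex) set \<Rightarrow> bool" where
  "circled_convex I C \<longleftrightarrow>
     C \<in> sets (PiM UNIV (\<lambda>_. borel)) \<and>
     (\<forall>u\<in>C. \<forall>v\<in>C. \<forall>s. 0 < s \<longrightarrow> s < 1 \<longrightarrow> (\<lambda>n. s *\<^sub>R u n + (1 - s) *\<^sub>R v n) \<in> C) \<and>
     (\<forall>u\<in>C. \<forall>w. cmod w = 1 \<longrightarrow> (\<lambda>n. w * u n) \<in> C) \<and>
     (\<forall>u v. (\<forall>n\<in>I. u n = v n) \<longrightarrow> u \<in> C \<longrightarrow> v \<in> C)"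

lemma circled_convexD:
  assumes "circled_convex I C"
  shows "C \<in> sets (PiM UNIV (\<lambda>_. borel))"
    and "\<And>u v s. u \<in> C \<Longrightarrow> v \<in> C \<Longrightarrow> 0 < s \<Longrightarrow> s < 1 \<Longrightarrow> (\<lambda>n. s *\<^sub>R u n + (1 - s) *\<^sub>R v n) \<in> C"
    and "\<And>u w. u \<in> C \<Longrightarrow> cmod w = 1 \<Longrightarrow> (\<lambda>n. w * u n) \<in> C"
    and "\<And>u v. (\<And>n. n \<in> I \<Longrightarrow> u n = v n) \<Longrightarrow> u \<in> C \<longleftrightarrow> v \<in> C"
proof -
  show "\<And>u v. (\<And>n. n \<in> I \<Longrightarrow> u n = v n) \<Longrightarrow> u \<in> C \<longleftrightarrow> v \<in> C"
    using assms unfolding circled_convex_def by (metis (mono_tags))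
qed (use assms in \<open>auto simp: circled_convex_def\<close>)

text \<open>Let \<open>g a\<close> be the conditional probability of \<open>C\<close> given that
  coordinate \<open>i\<close> equals \<open>a\<close>. It is log-concave as a Gaussian marginal and
  depends only on \<open>cmod a\<close> by unimodular invariance, hence it decreases in
  \<open>cmod a\<close>. Conditioning on a small value of that coordinate can therefore only favour
  \<open>C\<close>.\<close>

lemma gauss_slab_coordinate_correlation:
  assumes "finite I" "i \<in> I" and C: "circled_convex I C" and t0: "0 \<le> t"
  shows "measure (gprod I) {x\<in>space (gprod I). x \<in> C} * measure cgauss {z. cmod z \<le> t}
     \<le> measure (gprod I) {x\<in>space (gprod I). x \<in> C \<and> cmod (x i) \<le> t}"
proof -
  define K where "K = I - {i}"
  have I: "I = insert i K" "finite K" "i \<notin> K" using assms by (auto simp: K_def)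
  note C1 [measurable] = circled_convexD(1)[OF C]
  define base where "base a = (\<lambda>n. if n = i then a else 0)" for a :: complex
  let ?f = "\<lambda>u. indicator C u :: real"
  define g where "g a = (\<integral>y. ?f (override K (base a) y) \<partial>gprod K)" for a
  have fm: "?f \<in> borel_measurable (PiM UNIV (\<lambda>_. borel))" by measurable
  have lcf: "log_concave_fun ?f"
    unfolding log_concave_fun_def
  proof (intro allI impI)
    fix u v :: "'a \<Rightarrow> complex" and s :: real assume s: "0 < s" "s < 1"
    show "?f u powr s * ?f v powr (1 - s) \<le> ?f (\<lambda>n. s *\<^sub>R u n + (1 - s) *\<^sub>R v n)"
      using circled_convexD(2)[OF C _ _ s, of u v] by (auto simp: indicator_def)
  qed
  have "log_concave_fun (\<lambda>u. \<integral>y. ?f (override K u y) \<partial>gprod K)"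
    by (rule log_concave_fun_marginals[OF I(2) lcf _ _ fm]) auto
  then have g_lc: "g a powr s * g b powr (1 - s) \<le> g (s *\<^sub>R a + (1 - s) *\<^sub>R b)" if "0 < s" "s < 1" for a b s
  proof -
    have e: "base (s *\<^sub>R a + (1 - s) *\<^sub>R b) = (\<lambda>n. s *\<^sub>R base a n + (1 - s) *\<^sub>R base b n)"
      by (auto simp: base_def)
    show ?thesis
      using \<open>log_concave_fun (\<lambda>u. \<integral>y. ?f (override K u y) \<partial>gprod K)\<close> that
      unfolding g_def e log_concave_fun_def by blast
  qed
  have fi: "integrable (gprod K) (\<lambda>y. ?f (override K u y))" for u
    by (rule integrable_gprod_bounded) (use fm in auto)
  have g0: "0 \<le> g a" for a unfolding g_def by (intro Bochner_Integration.integral_nonneg) auto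
  have g1: "g a \<le> 1" for a
  proof -
    have "g a \<le> (\<integral>y. 1 \<partial>gprod K)" unfolding g_def
      by (intro integral_mono fi finite_measure.integrable_const[OF prob_space.finite_measure[OF prob_space_gprod]]) auto
    then show ?thesis by (simp add: prob_space.prob_space[OF prob_space_gprod])
  qed
  have g_unit: "g (w * a) = g a" if w: "cmod w = 1" for w a
  proof -
    have "g (w * a) = (\<integral>y. ?f (override K (base (w * a)) (\<lambda>n\<in>K. w * y n)) \<partial>gprod K)"
      unfolding g_def by (rule integral_gprod_unit[OF I(2) w, symmetric]) measurable
    moreover have "override K (base (w * a)) (\<lambda>n\<in>K. w * y n) = (\<lambda>n. w * override K (base a) y n)" for y
      by (auto simp: override_def base_def)
    moreover have "?f (\<lambda>n. w * u n) = ?f u" for u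
    proof -
      have "cnj w * w = 1" using w by (simp add: complex_norm_square[symmetric] mult.commute)
      then have "(\<lambda>n. cnj w * (w * u n)) = u" by (simp add: mult.assoc[symmetric])
      then have "(\<lambda>n. w * u n) \<in> C \<longleftrightarrow> u \<in> C"
        using circled_convexD(3)[OF C, of "\<lambda>n. w * u n" "cnj w"] circled_convexD(3)[OF C, of u w] w by auto
      then show ?thesis by (simp add: indicator_def)
    qed
    ultimately show ?thesis unfolding g_def by (simp only:)
  qed
  have g_mono: "g b \<le> g a" if ab: "cmod a \<le> cmod b" for a b
  proof (cases "b = 0")
    case True then show ?thesis using ab by simp
  next
    case False
    define c where "c = cmod a / cmod b"
    have c: "0 \<le> c" "c \<le> 1" using ab False by (auto simp: c_def divide_simps)
    obtain w where w: "cmod w = 1" "a = w * (c *\<^sub>R b)"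
    proof (cases "a = 0")
      case True
      then show ?thesis using that[of 1] by (simp add: c_def)
    next
      case a: False
      have n: "cmod (c *\<^sub>R b) = cmod a" using False by (simp add: c_def)
      then have "c *\<^sub>R b \<noteq> 0" using a by auto
      then have "a = a / (c *\<^sub>R b) * (c *\<^sub>R b)" by (rule nonzero_divide_eq_eq[THEN iffD1, OF _ refl])
      moreover have "cmod (a / (c *\<^sub>R b)) = 1" unfolding norm_divide n using a by simp
      ultimately show ?thesis using that by blast
    qed
    have "g b \<le> g (c *\<^sub>R b)"
    proof (cases "c = 1")
      case False
      \<comment> \<open>This weight writes \<open>c *\<^sub>R b\<close> as a convex combination of
        \<open>b\<close> and \<open>- b\<close>, at which \<open>g\<close> takes the same
        value.\<close>
      define s where "s = (1 + c) / 2"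
      have s: "0 < s" "s < 1" using c False by (auto simp: s_def)
      have "s *\<^sub>R b + (1 - s) *\<^sub>R (- b) = (s - (1 - s)) *\<^sub>R b" by (simp only: scaleR_diff_left scaleR_minus_right) simp
      also have "s - (1 - s) = c" by (simp add: s_def field_simps)
      finally have e: "s *\<^sub>R b + (1 - s) *\<^sub>R (- b) = c *\<^sub>R b" .
      have "g b = g b powr s * g (- b) powr (1 - s)"
        using g0[of b] g_unit[of "-1" b] by (simp add: powr_add[symmetric])
      also have "\<dots> \<le> g (c *\<^sub>R b)" using g_lc[OF s, of b "- b"] unfolding e .
      finally show ?thesis .
    qed simp
    then show ?thesis using g_unit[OF w(1), of "c *\<^sub>R b"] w(2) by simp
  qed
  have [measurable]: "(\<lambda>a. override K (base (fst a)) (snd a)) \<in> measurable (borel \<Otimes>\<^sub>M gprod K) (PiM UNIV (\<lambda>_. borel))"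
  proof (rule measurable_PiM_single')
    fix n show "(\<lambda>a. override K (base (fst a)) (snd a) n) \<in> borel_measurable (borel \<Otimes>\<^sub>M gprod K)"
      unfolding override_def base_def by (cases "n \<in> K"; cases "n = i") auto
  qed auto
  have "(\<lambda>a. ?f (override K (base (fst a)) (snd a))) \<in> borel_measurable (borel \<Otimes>\<^sub>M gprod K)"
    by measurable
  then have gm [measurable]: "g \<in> borel_measurable borel"
    unfolding g_def by (intro gp.borel_measurable_lebesgue_integral) (simp add: case_prod_beta)
  have gi: "integrable cgauss (\<lambda>a. indicator S a * g a)" if [measurable]: "S \<in> sets borel" for S
    by (rule cgauss.integrable_const_bound[where B = 1]) (use g0 g1 in \<open>auto split: split_indicator\<close>)
  have split: "measure (gprod I) {x\<in>space (gprod I). x \<in> C \<and> x i \<in> S} = (\<integral>a. indicator S a * g a \<partial>cgauss)"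
    if S [measurable]: "S \<in> sets borel" for S
  proof -
    have [measurable]: "(\<lambda>x. override I (\<lambda>_. 0) x) \<in> measurable (gprod I) (PiM UNIV (\<lambda>_. borel))" by measurable
    have eqC: "x \<in> C \<longleftrightarrow> override I (\<lambda>_. 0) x \<in> C" for x
      by (rule circled_convexD(4)[OF C]) (auto simp: override_def)
    have im: "i \<in> I" by fact
    have "{x\<in>space (gprod I). override I (\<lambda>_. 0) x \<in> C \<and> x i \<in> S} \<in> sets (gprod I)"
      using im by measurable
    then have set [measurable]: "{x\<in>space (gprod I). x \<in> C \<and> x i \<in> S} \<in> sets (gprod I)"
      by (subst eqC)
    have fm2: "(indicator {x\<in>space (gprod I). x \<in> C \<and> x i \<in> S} :: _ \<Rightarrow> ennreal) \<in> borel_measurable (gprod I)"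
      by measurable
    have "emeasure (gprod I) {x\<in>space (gprod I). x \<in> C \<and> x i \<in> S}
       = (\<integral>\<^sup>+x. indicator {x\<in>space (gprod I). x \<in> C \<and> x i \<in> S} x \<partial>gprod I)"
      using set by simp
    also have "\<dots> = (\<integral>\<^sup>+a. \<integral>\<^sup>+y. indicator {x\<in>space (gprod I). x \<in> C \<and> x i \<in> S} (y(i := a)) \<partial>gprod K \<partial>cgauss)"
      using gp.product_nn_integral_insert_rev[OF I(2,3), of "indicator {x\<in>space (gprod I). x \<in> C \<and> x i \<in> S}"] fm2
      unfolding I(1)[symmetric] by simp
    also have "\<dots> = (\<integral>\<^sup>+a. ennreal (indicator S a * g a) \<partial>cgauss)"
    proof (rule nn_integral_cong)
      fix a
      have "(\<integral>\<^sup>+y. indicator {x\<in>space (gprod I). x \<in> C \<and> x i \<in> S} (y(i := a)) \<partial>gprod K)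
        = (\<integral>\<^sup>+y. ennreal (indicator S a * ?f (override K (base a) y)) \<partial>gprod K)"
      proof (rule nn_integral_cong)
        fix y assume y: "y \<in> space (gprod K)"
        have "y(i := a) \<in> space (gprod I)" using y I by (auto simp: space_gprod PiE_def extensional_def)
        moreover have "y(i := a) \<in> C \<longleftrightarrow> override K (base a) y \<in> C"
          by (rule circled_convexD(4)[OF C]) (use I in \<open>auto simp: override_def base_def\<close>)
        ultimately show "indicator {x\<in>space (gprod I). x \<in> C \<and> x i \<in> S} (y(i := a)) = ennreal (indicator S a * ?f (override K (base a) y))"
          by (auto split: split_indicator)
      qed
      also have "\<dots> = ennreal (\<integral>y. indicator S a * ?f (override K (base a) y) \<partial>gprod K)"
        by (rule nn_integral_eq_integral) (use fi in auto)
      finally show "(\<integral>\<^sup>+y. indicator {x\<in>space (gprod I). x \<in> C \<and> x i \<in> S} (y(i := a)) \<partial>gprod K) = ennreal (indicator S a * g a)"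
        by (simp add: g_def)
    qed
    also have "\<dots> = ennreal (\<integral>a. indicator S a * g a \<partial>cgauss)"
      by (rule nn_integral_eq_integral) (use gi[OF S] g0 in auto)
    finally show ?thesis
      by (simp add: measure_def Bochner_Integration.integral_nonneg g0)
  qed
  define B where "B = {z::complex. cmod z \<le> t}"
  have B [measurable]: "B \<in> sets borel" unfolding B_def by measurable
  define p where "p = measure cgauss B"
  \<comment> \<open>The value of \<open>g\<close> on the boundary circle separates the two regions:
    \<open>g\<close> is at least \<open>m\<close> inside the disc and at most \<open>m\<close>
    outside. Comparing the two integrals with \<open>m * p\<close> and \<open>m * (1 - p)\<close>
    eliminates \<open>m\<close>.\<close>
  define m where "m = g (of_real \<bar>t\<bar>)"
  have p: "0 \<le> p" "p \<le> 1" by (auto simp: p_def)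
  define X where "X = (\<integral>a. indicator B a * g a \<partial>cgauss)"
  define Y where "Y = (\<integral>a. indicator (-B) a * g a \<partial>cgauss)"
  have "m * p = (\<integral>a. indicator B a * m \<partial>cgauss)" by (simp add: p_def)
  also have "\<dots> \<le> X" unfolding X_def
  proof (rule integral_mono[OF _ gi[OF B]])
    show "integrable cgauss (\<lambda>a. indicator B a * m)"
      by (rule cgauss.integrable_const_bound[where B = 1]) (auto split: split_indicator simp: m_def g0 g1)
    show "indicator B a * m \<le> indicator B a * g a" for a
      using g_mono[of a "of_real \<bar>t\<bar>"] by (auto simp: B_def m_def split: split_indicator)
  qed
  finally have 1: "m * p \<le> X" .
  have "Y \<le> (\<integral>a. indicator (-B) a * m \<partial>cgauss)" unfolding Y_def
  proof (rule integral_mono[OF gi])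
    show "integrable cgauss (\<lambda>a. indicator (-B) a * m)"
      by (rule cgauss.integrable_const_bound[where B = 1]) (auto split: split_indicator simp: m_def g0 g1)
    show "indicator (-B) a * g a \<le> indicator (-B) a * m" for a
    proof (cases "a \<in> B")
      case False
      then have "t < cmod a" by (auto simp: B_def)
      then show ?thesis using t0 g_mono[of "of_real \<bar>t\<bar>" a] by (auto simp: m_def split: split_indicator)
    qed simp
  qed measurable
  also have "\<dots> = m * (1 - p)"
    using cgauss.prob_compl[of B] by (simp add: p_def Compl_eq_Diff_UNIV)
  finally have 2: "Y \<le> m * (1 - p)" .
  have XY: "(\<integral>a. indicator UNIV a * g a \<partial>cgauss) = X + Y"
  proof -
    have "X + Y = (\<integral>a. indicator B a * g a + indicator (-B) a * g a \<partial>cgauss)"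
      unfolding X_def Y_def by (rule Bochner_Integration.integral_add[symmetric]) (intro gi, measurable)+
    also have "\<dots> = (\<integral>a. indicator UNIV a * g a \<partial>cgauss)"
      by (intro Bochner_Integration.integral_cong refl) (auto split: split_indicator)
    finally show ?thesis by simp
  qed
  have "p * Y \<le> p * (m * (1 - p))" using 2 p by (intro mult_left_mono)
  also have "\<dots> = (1 - p) * (m * p)" by (simp add: mult_ac)
  also have "\<dots> \<le> (1 - p) * X" using 1 p by (intro mult_left_mono) auto
  finally have "(X + Y) * p \<le> X" by (simp add: algebra_simps)
  then show ?thesis
    using split[of UNIV] split[of B] XY by (simp add: X_def p_def B_def)
qed

lemma emeasure_gauss_rotation:
  assumes B: "gauss_rotation I B" and S: "S \<in> sets (gprod I)"
  shows "emeasure (gprod I) S = emeasure (gprod I) {x\<in>space (gprod I). mapply I B x \<in> S}"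
proof -
  have [measurable]: "S \<in> sets (gprod I)" by fact
  have "emeasure (gprod I) S = (\<integral>\<^sup>+x. indicator S x \<partial>gprod I)" by simp
  also have "\<dots> = (\<integral>\<^sup>+x. indicator S (mapply I B x) \<partial>gprod I)"
    by (rule gauss_rotationD(2)[OF B, symmetric]) measurable
  also have "\<dots> = (\<integral>\<^sup>+x. indicator {x\<in>space (gprod I). mapply I B x \<in> S} x \<partial>gprod I)"
    by (intro nn_integral_cong) (auto split: split_indicator)
  also have "\<dots> = emeasure (gprod I) {x\<in>space (gprod I). mapply I B x \<in> S}"
    by (rule nn_integral_indicator) measurable
  finally show ?thesis .
qed

lemma measure_gprod_component:
  assumes "i \<in> I" and [measurable]: "S \<in> sets borel"
  shows "measure (gprod I) {x\<in>space (gprod I). x i \<in> S} = measure cgauss S"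
proof -
  have d: "distr (gprod I) cgauss (\<lambda>x. x i) = cgauss"
    using distr_PiM_component[of I "\<lambda>_. cgauss" i] prob_space_cgauss assms by auto
  have "measure cgauss S = measure (distr (gprod I) cgauss (\<lambda>x. x i)) S" unfolding d ..
  also have "\<dots> = measure (gprod I) ((\<lambda>x. x i) -` S \<inter> space (gprod I))"
    by (rule measure_distr) (use assms in auto)
  also have "(\<lambda>x. x i) -` S \<inter> space (gprod I) = {x\<in>space (gprod I). x i \<in> S}" by auto
  finally show ?thesis ..
qed

text \<open>A rotation carries the linear form to a multiple of one coordinate, and preimages of
  circled convex sets under linear maps are circled convex, so the coordinate case applies. When the
  form is zero the slab is the whole space.\<close>

lemma gauss_slab_correlation:
  assumes "finite I" and C: "circled_convex I C" and t0: "0 \<le> t"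
  shows "measure (gprod I) {x\<in>space (gprod I). x \<in> C} * measure cgauss {z. sqrt (\<Sum>n\<in>I. (cmod (v n))\<^sup>2) * cmod z \<le> t}
     \<le> measure (gprod I) {x\<in>space (gprod I). x \<in> C \<and> cmod (\<Sum>n\<in>I. v n * x n) \<le> t}"
proof -
  let ?r = "sqrt (\<Sum>n\<in>I. (cmod (v n))\<^sup>2)"
  have r0: "0 \<le> ?r" by (simp add: sum_nonneg)
  have Cs: "{x\<in>space (gprod I). x \<in> D \<and> P x} \<in> sets (gprod I)" if D: "circled_convex I D" and [measurable]: "Measurable.pred (gprod I) P" for D P
  proof -
    have [measurable]: "D \<in> sets (PiM UNIV (\<lambda>_. borel))" using D by (rule circled_convexD)
    have eqC: "x \<in> D \<longleftrightarrow> override I (\<lambda>_. 0) x \<in> D" for x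
      by (rule circled_convexD(4)[OF D]) (auto simp: override_def)
    have "{x\<in>space (gprod I). override I (\<lambda>_. 0) x \<in> D \<and> P x} \<in> sets (gprod I)" by measurable
    then show ?thesis by (subst eqC)
  qed
  show ?thesis
  proof (cases "?r = 0")
    case True
    then have "v n = 0" if "n \<in> I" for n using that assms(1) by (simp add: sum_nonneg_eq_0_iff)
    then have "(\<Sum>n\<in>I. v n * x n) = 0" for x by (intro sum.neutral) auto
    then show ?thesis using t0 True by (simp add: mult_left_le)
  next
    case False
    then have r: "0 < ?r" using r0 by linarith
    then obtain i where i: "i \<in> I" by (cases "I = {}") auto
    obtain B where B: "gauss_rotation I B"
      "\<And>k. k \<in> I \<Longrightarrow> (\<Sum>n\<in>I. v n * B n k) = (if k = i then of_real ?r else 0)"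
      using exists_gauss_rotation[OF assms(1) i, of v] by blast
    have v: "(\<Sum>n\<in>I. v n * mapply I B x n) = of_real ?r * x i" for x
    proof -
      have "(\<Sum>n\<in>I. v n * mapply I B x n) = (\<Sum>k\<in>I. if k = i then of_real ?r * x i else 0)"
        unfolding sum_mapply[OF assms(1)] by (intro sum.cong) (auto simp: B(2))
      then show ?thesis using i assms(1) by simp
    qed
    \<comment> \<open>\<open>Lf\<close> is \<open>mapply I B\<close> without the restriction to
      \<open>I\<close>, so that \<open>C'\<close> is a subset of the full function space as
      \<open>circled_convex\<close> requires. Membership agrees because \<open>C\<close> depends
      only on coordinates in \<open>I\<close>.\<close>
    define Lf where "Lf x = (\<lambda>n. \<Sum>k\<in>I. B n k * x k)" for x
    define C' where "C' = {x. Lf x \<in> C}"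
    have Lm [measurable]: "Lf \<in> measurable (PiM UNIV (\<lambda>_. borel)) (PiM UNIV (\<lambda>_. borel))"
      by (rule measurable_PiM_single') (auto simp: Lf_def)
    have mem: "mapply I B x \<in> C \<longleftrightarrow> x \<in> C'" for x
      unfolding C'_def mem_Collect_eq
      by (rule circled_convexD(4)[OF C]) (simp add: mapply_def Lf_def)
    have "Lf -` C \<inter> space (PiM UNIV (\<lambda>_. borel)) \<in> sets (PiM UNIV (\<lambda>_. borel))"
      by (rule measurable_sets[OF Lm circled_convexD(1)[OF C]])
    moreover have "Lf -` C \<inter> space (PiM UNIV (\<lambda>_. borel)) = C'" by (auto simp: C'_def space_PiM)
    ultimately have C'm: "C' \<in> sets (PiM UNIV (\<lambda>_. borel))" by simp
    have C': "circled_convex I C'"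
      unfolding circled_convex_def
    proof (intro conjI ballI allI impI C'm)
      fix x y and s :: real assume xy: "x \<in> C'" "y \<in> C'" and s: "0 < s" "s < 1"
      have "Lf (\<lambda>n. s *\<^sub>R x n + (1 - s) *\<^sub>R y n) = (\<lambda>n. s *\<^sub>R Lf x n + (1 - s) *\<^sub>R Lf y n)"
        by (auto simp: Lf_def scaleR_sum_right sum.distrib[symmetric] algebra_simps)
      then show "(\<lambda>n. s *\<^sub>R x n + (1 - s) *\<^sub>R y n) \<in> C'"
        using circled_convexD(2)[OF C _ _ s] xy by (simp add: C'_def)
    next
      fix x and w :: complex assume x: "x \<in> C'" and w: "cmod w = 1"
      have "Lf (\<lambda>n. w * x n) = (\<lambda>n. w * Lf x n)"
        by (auto simp: Lf_def sum_distrib_left mult_ac)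
      then show "(\<lambda>n. w * x n) \<in> C'" using circled_convexD(3)[OF C _ w] x by (simp add: C'_def)
    next
      fix x y assume "\<forall>n\<in>I. x n = y n" and x: "x \<in> C'"
      then have "Lf x = Lf y" by (simp add: Lf_def)
      then show "y \<in> C'" using x by (simp add: C'_def)
    qed
    have mm: "x \<in> space (gprod I) \<Longrightarrow> mapply I B x \<in> space (gprod I)" for x
      by (rule measurable_space[OF mapply_measurable])
    have "measure (gprod I) {x\<in>space (gprod I). x \<in> C \<and> True}
      = measure (gprod I) {x\<in>space (gprod I). mapply I B x \<in> {x\<in>space (gprod I). x \<in> C \<and> True}}"
      unfolding measure_def by (subst emeasure_gauss_rotation[OF B(1) Cs[OF C]]) auto
    also have "{x\<in>space (gprod I). mapply I B x \<in> {x\<in>space (gprod I). x \<in> C \<and> True}} = {x\<in>space (gprod I). x \<in> C'}"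
      using mm by (auto simp: mem)
    finally have e1: "measure (gprod I) {x\<in>space (gprod I). x \<in> C} = measure (gprod I) {x\<in>space (gprod I). x \<in> C'}" by simp
    have "measure (gprod I) {x\<in>space (gprod I). x \<in> C \<and> cmod (\<Sum>n\<in>I. v n * x n) \<le> t}
      = measure (gprod I) {x\<in>space (gprod I). mapply I B x \<in> {x\<in>space (gprod I). x \<in> C \<and> cmod (\<Sum>n\<in>I. v n * x n) \<le> t}}"
    proof -
      have "Measurable.pred (gprod I) (\<lambda>x. cmod (\<Sum>n\<in>I. v n * x n) \<le> t)" by measurable
      then show ?thesis unfolding measure_def by (subst emeasure_gauss_rotation[OF B(1) Cs[OF C]]) simp_all
    qed
    also have "{x\<in>space (gprod I). mapply I B x \<in> {x\<in>space (gprod I). x \<in> C \<and> cmod (\<Sum>n\<in>I. v n * x n) \<le> t}}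
      = {x\<in>space (gprod I). x \<in> C' \<and> cmod (x i) \<le> t / ?r}"
      using mm r r0 by (auto simp: mem v norm_mult field_simps)
    finally have e2: "measure (gprod I) {x\<in>space (gprod I). x \<in> C \<and> cmod (\<Sum>n\<in>I. v n * x n) \<le> t}
      = measure (gprod I) {x\<in>space (gprod I). x \<in> C' \<and> cmod (x i) \<le> t / ?r}" .
    have e3: "{z. ?r * cmod z \<le> t} = {z. cmod z \<le> t / ?r}" using r by (auto simp: field_simps)
    show ?thesis unfolding e1 e2 e3
      by (rule gauss_slab_coordinate_correlation[OF assms(1) i C']) (use t0 r in auto)
  qed
qed

lemma circled_convex_slabs:
  assumes "finite I" "finite J"
  shows "circled_convex I {u. \<forall>j\<in>J. cmod (\<Sum>n\<in>I. v j n * u n) \<le> t}"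
  unfolding circled_convex_def
proof (intro conjI ballI allI impI)
  have "{u \<in> space (PiM UNIV (\<lambda>_. borel)). \<forall>j\<in>J. cmod (\<Sum>n\<in>I. v j n * u n) \<le> t} \<in> sets (PiM UNIV (\<lambda>_. borel))"
    using assms by measurable
  then show "{u. \<forall>j\<in>J. cmod (\<Sum>n\<in>I. v j n * u n) \<le> t} \<in> sets (PiM UNIV (\<lambda>_. borel))"
    by (simp add: space_PiM)
next
  fix x y and s :: real
  assume x: "x \<in> {u. \<forall>j\<in>J. cmod (\<Sum>n\<in>I. v j n * u n) \<le> t}" and y: "y \<in> {u. \<forall>j\<in>J. cmod (\<Sum>n\<in>I. v j n * u n) \<le> t}"
    and s: "0 < s" "s < 1"
  have "cmod (\<Sum>n\<in>I. v j n * (s *\<^sub>R x n + (1 - s) *\<^sub>R y n)) \<le> t" if "j \<in> J" for j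
  proof -
    have "(\<Sum>n\<in>I. v j n * (s *\<^sub>R x n + (1 - s) *\<^sub>R y n)) = s *\<^sub>R (\<Sum>n\<in>I. v j n * x n) + (1 - s) *\<^sub>R (\<Sum>n\<in>I. v j n * y n)"
      by (simp add: scaleR_sum_right sum.distrib[symmetric] algebra_simps)
    also have "cmod \<dots> \<le> s * cmod (\<Sum>n\<in>I. v j n * x n) + (1 - s) * cmod (\<Sum>n\<in>I. v j n * y n)"
      using s by (intro norm_triangle_le) auto
    also have "\<dots> \<le> s * t + (1 - s) * t"
      using s x y that by (intro add_mono mult_left_mono) auto
    finally show ?thesis by (simp add: algebra_simps)
  qed
  then show "(\<lambda>n. s *\<^sub>R x n + (1 - s) *\<^sub>R y n) \<in> {u. \<forall>j\<in>J. cmod (\<Sum>n\<in>I. v j n * u n) \<le> t}" by auto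
next
  fix x and w :: complex
  assume x: "x \<in> {u. \<forall>j\<in>J. cmod (\<Sum>n\<in>I. v j n * u n) \<le> t}" and w: "cmod w = 1"
  have "(\<Sum>n\<in>I. v j n * (w * x n)) = w * (\<Sum>n\<in>I. v j n * x n)" for j
    by (simp add: sum_distrib_left mult_ac)
  then show "(\<lambda>n. w * x n) \<in> {u. \<forall>j\<in>J. cmod (\<Sum>n\<in>I. v j n * u n) \<le> t}" using x w by (simp add: norm_mult)
qed auto

text \<open>Slabs are split off one at a time, each against the circled convex intersection of the
  preceding ones. A single slab has probability at least \<open>1 - exp (- (t\<^sup>2 / V))\<close>,
  because the squared modulus of a standard Gaussian is exponential and the variance of the form is
  at most \<open>V\<close>.\<close>

lemma khatri_sidak:
  fixes v :: "'j \<Rightarrow> 'i \<Rightarrow> complex"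
  assumes "finite J" "finite I" "0 \<le> t" "0 < V" and V: "\<And>j. j \<in> J \<Longrightarrow> (\<Sum>n\<in>I. (cmod (v j n))\<^sup>2) \<le> V"
  shows "(1 - exp (- (t\<^sup>2 / V))) ^ card J
     \<le> measure (gprod I) {x\<in>space (gprod I). \<forall>j\<in>J. cmod (\<Sum>n\<in>I. v j n * x n) \<le> t}"
  using assms(1) V
proof (induction J rule: finite_induct)
  case empty
  then show ?case using prob_space.prob_space[OF prob_space_gprod, of I] by simp
next
  case (insert l J)
  let ?r = "sqrt (\<Sum>n\<in>I. (cmod (v l n))\<^sup>2)"
  let ?C = "{u. \<forall>j\<in>J. cmod (\<Sum>n\<in>I. v j n * u n) \<le> t}"
  have nn: "0 \<le> t\<^sup>2 / V" using assms by simp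
  have "1 - exp (- (t\<^sup>2 / V)) = measure cgauss {z. (cmod z)\<^sup>2 \<le> t\<^sup>2 / V}"
    by (rule measure_cgauss_cball[OF nn, symmetric])
  also have "\<dots> \<le> measure cgauss {z. ?r * cmod z \<le> t}"
  proof (rule cgauss.finite_measure_mono)
    show "{z. (cmod z)\<^sup>2 \<le> t\<^sup>2 / V} \<subseteq> {z. ?r * cmod z \<le> t}"
    proof safe
      fix z assume "(cmod z)\<^sup>2 \<le> t\<^sup>2 / V"
      then have "V * (cmod z)\<^sup>2 \<le> t\<^sup>2" using assms by (simp add: field_simps)
      moreover have "?r\<^sup>2 \<le> V" using insert.prems[of l] by (simp add: sum_nonneg)
      then have "?r\<^sup>2 * (cmod z)\<^sup>2 \<le> V * (cmod z)\<^sup>2" by (intro mult_right_mono) auto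
      ultimately have "(?r * cmod z)\<^sup>2 \<le> t\<^sup>2" by (simp add: power_mult_distrib)
      then show "?r * cmod z \<le> t" using assms(3) by (rule power2_le_imp_le)
    qed
  qed measurable
  finally have 1: "1 - exp (- (t\<^sup>2 / V)) \<le> measure cgauss {z. ?r * cmod z \<le> t}" .
  have "(1 - exp (- (t\<^sup>2 / V))) ^ card (insert l J)
      = (1 - exp (- (t\<^sup>2 / V))) ^ card J * (1 - exp (- (t\<^sup>2 / V)))"
    using insert.hyps by simp
  also have "\<dots> \<le> measure (gprod I) {x\<in>space (gprod I). \<forall>j\<in>J. cmod (\<Sum>n\<in>I. v j n * x n) \<le> t} * measure cgauss {z. ?r * cmod z \<le> t}"
    using insert.prems nn by (intro mult_mono 1 insert.IH) auto
  also have "\<dots> = measure (gprod I) {x\<in>space (gprod I). x \<in> ?C} * measure cgauss {z. ?r * cmod z \<le> t}" by simp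
  also have "\<dots> \<le> measure (gprod I) {x\<in>space (gprod I). x \<in> ?C \<and> cmod (\<Sum>n\<in>I. v l n * x n) \<le> t}"
    by (rule gauss_slab_correlation[OF assms(2) circled_convex_slabs[OF assms(2) insert.hyps(1)] assms(3)])
  also have "{x\<in>space (gprod I). x \<in> ?C \<and> cmod (\<Sum>n\<in>I. v l n * x n) \<le> t}
    = {x\<in>space (gprod I). \<forall>j\<in>insert l J. cmod (\<Sum>n\<in>I. v j n * x n) \<le> t}" by auto
  finally show ?case .
qed

section \<open>Circular means and polynomials on the circle\<close>

definition circ :: "real measure" where
  "circ = density lborel (\<lambda>\<theta>. ennreal (indicator {0..2*pi} \<theta> / (2*pi)))"

lemma sets_circ [simp, measurable_cong]: "sets circ = sets borel"
  by (simp add: circ_def)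

lemma space_circ [simp]: "space circ = UNIV"
  by (simp add: circ_def)

lemma prob_space_circ: "prob_space circ"
proof
  have "emeasure circ UNIV = (\<integral>\<^sup>+\<theta>. ennreal (1 / (2*pi)) * indicator {0..2*pi} \<theta> \<partial>lborel)"
    unfolding circ_def by (subst emeasure_density) (auto intro!: nn_integral_cong split: split_indicator)
  also have "\<dots> = 1"
    by (subst nn_integral_cmult_indicator) (auto simp: ennreal_mult'[symmetric])
  finally show "emeasure circ (space circ) = 1" by simp
qed

interpretation circ: prob_space circ by (rule prob_space_circ)

lemma integrable_circ_bounded:
  fixes f :: "real \<Rightarrow> real"
  assumes "f \<in> borel_measurable borel" "\<And>x. 0 \<le> x \<Longrightarrow> x \<le> 2*pi \<Longrightarrow> \<bar>f x\<bar> \<le> B"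
  shows "integrable circ f"
proof (rule circ.integrable_const_bound[where B = B])
  show "AE x in circ. norm (f x) \<le> B"
    unfolding circ_def using assms by (subst AE_density) (auto split: split_indicator)
qed (use assms in auto)

lemma integral_circ_continuous:
  fixes f :: "real \<Rightarrow> real"
  assumes "continuous_on UNIV f"
  shows "integral\<^sup>L circ f = integral {0..2*pi} f / (2*pi)"
proof -
  have [measurable]: "f \<in> borel_measurable borel" using assms by (rule borel_measurable_continuous_onI)
  have "integral\<^sup>L circ f = (\<integral>\<theta>. (1 / (2*pi)) * (indicator {0..2*pi} \<theta> *\<^sub>R f \<theta>) \<partial>lborel)"
    unfolding circ_def by (subst integral_density) auto
  also have "\<dots> = (1 / (2*pi)) * (LINT \<theta>:{0..2*pi}|lborel. f \<theta>)"
    unfolding set_lebesgue_integral_def by simp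
  also have "(LINT \<theta>:{0..2*pi}|lborel. f \<theta>) = integral {0..2*pi} f"
    by (intro set_borel_integral_eq_integral borel_integrable_atLeastAtMost' continuous_on_subset[OF assms]) auto
  finally show ?thesis by simp
qed

lemma norm_cis_diff_le: "cmod (cis a - cis b) \<le> \<bar>a - b\<bar>"
proof -
  have "cis a - cis b = cis b * (cis (a - b) - 1)" by (simp add: algebra_simps cis_mult)
  then have "cmod (cis a - cis b) = cmod (exp (\<i> * of_real (a - b)) - 1)"
    by (simp add: norm_mult cis_conv_exp)
  also have "\<dots> = 2 * \<bar>sin ((a - b) / 2)\<bar>" by (rule dist_exp_i_1)
  also have "\<dots> \<le> 2 * \<bar>(a - b) / 2\<bar>" by (intro mult_left_mono abs_sin_x_le_abs_x) auto
  finally show ?thesis by simp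
qed

lemma integral_split_periods:
  fixes h :: "real \<Rightarrow> real"
  assumes "continuous_on UNIV h" "0 \<le> a"
  shows "integral {0..of_nat m * a} h = integral {0..a} (\<lambda>\<theta>. \<Sum>j<m. h (\<theta> + of_nat j * a))"
proof (induction m)
  case 0 then show ?case by simp
next
  case (Suc m)
  have int: "h integrable_on {x..y}" for x y
    by (intro integrable_continuous_interval continuous_on_subset[OF assms(1)]) auto
  have intc: "(\<lambda>\<theta>. h (\<theta> + c)) integrable_on {x..y}" for x y c
    by (intro integrable_continuous_interval continuous_on_compose2[OF assms(1)] continuous_intros) auto
  have "integral {0..of_nat (Suc m) * a} h = integral {0..of_nat m * a} h + integral {of_nat m * a..of_nat (Suc m) * a} h"
    by (rule Henstock_Kurzweil_Integration.integral_combine[symmetric]) (use assms int in \<open>auto simp: algebra_simps\<close>)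
  also have "integral {of_nat m * a..of_nat (Suc m) * a} h = integral {0..a} (\<lambda>\<theta>. h (\<theta> + of_nat m * a))"
    using integral_shift_real_ivl[of "of_nat m * a" "of_nat m * a" "of_nat (Suc m) * a" h] by (simp add: algebra_simps)
  finally show ?case
    unfolding Suc.IH sum.lessThan_Suc
    by (subst Henstock_Kurzweil_Integration.integral_add) (auto intro!: integrable_sum intc)
qed

lemma max_modulus_circle:
  assumes "continuous_on (cball 0 r) f" "f holomorphic_on ball 0 r" "0 < r"
  obtains z where "cmod z = r" "\<And>w. cmod w \<le> r \<Longrightarrow> cmod (f w) \<le> cmod (f z)"
proof -
  have 1: "continuous_on (sphere 0 r) (\<lambda>z. cmod (f z))"
    by (intro continuous_intros continuous_on_subset[OF assms(1)]) auto
  have 2: "compact (sphere (0::complex) r)" "sphere (0::complex) r \<noteq> {}"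
    using assms(3) by auto
  obtain z where z: "z \<in> sphere 0 r" "\<And>w. w \<in> sphere 0 r \<Longrightarrow> cmod (f w) \<le> cmod (f z)"
    using continuous_attains_sup[OF 2 1] by (elim bexE) simp
  have "cmod (f w) \<le> cmod (f z)" if "cmod w \<le> r" for w
  proof (rule maximum_modulus_frontier[of f "cball 0 r"])
    show "cmod (f y) \<le> cmod (f z)" if "y \<in> frontier (cball 0 r)" for y
      by (rule z(2)) (use that in \<open>simp add: frontier_cball\<close>)
  qed (use assms(1,2) that in simp_all)
  then show ?thesis using that[of z] z(1) by simp
qed

text \<open>Jensen's inequality, without counting zeros: by the maximum principle applied to the product
  of \<open>N\<close> rotated copies of \<open>f\<close>, some \<open>N\<close>-point Riemann sum of \<open>ln \<bar>f\<bar>\<close> is at least \<open>ln \<bar>f 0\<bar>\<close>.\<close>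

lemma ln_le_circle_mean_ln_max:
  assumes cont: "continuous_on (cball 0 r) f" and hol: "f holomorphic_on ball 0 r" and r: "0 < r" and c: "0 < c"
  shows "ln (max (cmod (f 0)) c) \<le> (\<integral>\<theta>. ln (max (cmod (f (rcis r \<theta>))) c) \<partial>circ)"
proof -
  define k where "k z = ln (max (cmod (f z)) c)" for z
  define h where "h \<theta> = k (rcis r \<theta>)" for \<theta>
  have contk: "continuous_on (cball 0 r) k"
    unfolding k_def using c by (intro continuous_intros cont) (auto simp: max_def split: if_splits)
  have conth: "continuous_on UNIV h"
    unfolding h_def rcis_def
    by (intro continuous_on_compose2[OF contk] continuous_intros) (use r in \<open>auto simp: norm_mult\<close>)
  have per: "h (\<theta> + 2*pi) = h \<theta>" for \<theta>
    by (simp add: h_def rcis_def cis_mult[symmetric])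
  have lek: "ln c \<le> h \<theta>" for \<theta> unfolding h_def k_def using c by simp
  have main: "ln (cmod (f 0)) \<le> integral {0..2*pi} h / (2*pi)" if f0: "f 0 \<noteq> 0"
  proof (rule field_le_epsilon)
    fix e :: real assume e: "0 < e"
    have "uniformly_continuous_on (cball 0 r) k"
      by (rule compact_uniformly_continuous[OF contk]) auto
    then obtain d where d: "d > 0" and "\<And>z w. z \<in> cball 0 r \<Longrightarrow> w \<in> cball 0 r \<Longrightarrow> dist w z < d \<Longrightarrow> dist (k w) (k z) < e"
      using e by (rule uniformly_continuous_onE) blast
    then have d2: "\<And>z w. cmod z \<le> r \<Longrightarrow> cmod w \<le> r \<Longrightarrow> dist w z < d \<Longrightarrow> dist (k w) (k z) < e" by simp
    \<comment> \<open>With this \<open>N\<close> a rotation by \<open>a = 2 * pi / N\<close> moves a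
      point of the circle by less than \<open>d\<close>, hence changes \<open>k\<close> by less than
      \<open>e\<close>.\<close>
    obtain N :: nat where N: "2 * pi * r / d < N" using reals_Archimedean2 by blast
    have "0 < 2 * pi * r / d" using d r by simp
    then have N0: "0 < N" using N by (simp add: of_nat_0_less_iff[symmetric, where 'a = real] del: of_nat_0_less_iff)
    define a where "a = 2 * pi / N"
    have a: "0 < a" "of_nat N * a = 2 * pi" using N0 by (auto simp: a_def)
    have close: "\<bar>h x - h y\<bar> \<le> e" if "\<bar>x - y\<bar> \<le> a" for x y
    proof -
      have "dist (rcis r x) (rcis r y) = r * cmod (cis x - cis y)"
        using r by (simp add: rcis_def dist_norm right_diff_distrib[symmetric] norm_mult)
      also have "\<dots> \<le> r * a" using r that norm_cis_diff_le[of x y] by (intro mult_left_mono) auto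
      also have "\<dots> < d" using N N0 d by (simp add: a_def field_simps)
      finally show ?thesis
        using d2[of "rcis r y" "rcis r x"] r by (simp add: h_def dist_real_def)
    qed
    define S where "S \<theta> = (\<Sum>j<N. h (\<theta> + of_nat j * a))" for \<theta>
    have S1: "S (\<theta> + a) = S \<theta>" for \<theta>
    proof -
      have "S \<theta> + h (\<theta> + of_nat N * a) = (\<Sum>j<Suc N. h (\<theta> + of_nat j * a))" by (simp add: S_def)
      also have "\<dots> = h \<theta> + (\<Sum>j<N. h (\<theta> + of_nat (Suc j) * a))"
        by (subst sum.lessThan_Suc_shift) simp
      also have "(\<Sum>j<N. h (\<theta> + of_nat (Suc j) * a)) = S (\<theta> + a)"
        by (simp add: S_def algebra_simps)
      finally show ?thesis using per[of \<theta>] a by simp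
    qed
    have Sm: "S (\<theta> + of_nat m * a) = S \<theta>" for \<theta> m
    proof (induction m)
      case (Suc m)
      have "S (\<theta> + of_nat (Suc m) * a) = S ((\<theta> + of_nat m * a) + a)" by (simp add: algebra_simps)
      then show ?case using Suc S1 by simp
    qed simp
    define P where "P z = (\<Prod>j<N. f (cis (of_nat j * a) * z))" for z
    have contP: "continuous_on (cball 0 r) P" unfolding P_def
      by (intro continuous_intros continuous_on_compose2[OF cont]) (auto simp: norm_mult)
    have "(\<lambda>z. f (cis (of_nat j * a) * z)) holomorphic_on ball 0 r" for j
      by (rule holomorphic_on_compose_gen[OF _ hol, unfolded comp_def]) (auto intro!: holomorphic_intros simp: norm_mult)
    then have holP: "P holomorphic_on ball 0 r" unfolding P_def by (intro holomorphic_intros)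
    obtain z where z: "cmod z = r" "cmod (P 0) \<le> cmod (P z)"
    proof -
      obtain z where "cmod z = r" "\<And>w. cmod w \<le> r \<Longrightarrow> cmod (P w) \<le> cmod (P z)"
        using max_modulus_circle[OF contP holP r] by blast
      then show ?thesis using that[of z] r by simp
    qed
    define \<phi> where "\<phi> = Arg2pi z"
    have zr: "z = rcis r \<phi>" and \<phi>: "0 \<le> \<phi>" "\<phi> < 2 * pi"
      using Arg2pi[of z] z(1) by (auto simp: \<phi>_def is_Arg_def rcis_def cis_conv_exp)
    have "real N * ln (cmod (f 0)) = ln (cmod (P 0))"
      using f0 by (simp add: P_def norm_power ln_realpow)
    also have "\<dots> \<le> ln (cmod (P z))" using z f0 by (intro ln_mono) (auto simp: P_def)
    also have "\<dots> \<le> S \<phi>"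
    proof -
      have pos: "0 < cmod (P z)" using z f0 by (intro less_le_trans[OF _ z(2)]) (auto simp: P_def)
      have "cmod (P z) \<le> (\<Prod>j<N. max (cmod (f (cis (of_nat j * a) * z))) c)"
        unfolding P_def prod_norm[symmetric] by (intro prod_mono) auto
      then have "ln (cmod (P z)) \<le> ln (\<Prod>j<N. max (cmod (f (cis (of_nat j * a) * z))) c)"
        using pos by (intro ln_mono) auto
      also have "\<dots> = (\<Sum>j<N. ln (max (cmod (f (cis (of_nat j * a) * z))) c))"
        by (rule ln_prod) (use c in \<open>auto simp: max_def\<close>)
      also have "\<dots> = S \<phi>"
        by (simp add: S_def h_def k_def zr rcis_def cis_mult[symmetric] mult_ac)
      finally show ?thesis .
    qed
    \<comment> \<open>\<open>S\<close> has period \<open>a\<close>, so the maximizing angle may be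
      moved into \<open>[0, a]\<close>. Within that interval each summand changes by at most
      \<open>e\<close>, which bounds the integral of \<open>S\<close> from below.\<close>
    also have "S \<phi> = S (\<phi> - of_nat (nat \<lfloor>\<phi> / a\<rfloor>) * a)" using Sm[of "\<phi> - of_nat (nat \<lfloor>\<phi> / a\<rfloor>) * a" "nat \<lfloor>\<phi> / a\<rfloor>"] by simp
    finally have Sbig: "real N * ln (cmod (f 0)) \<le> S (\<phi> - of_nat (nat \<lfloor>\<phi> / a\<rfloor>) * a)" .
    define \<psi> where "\<psi> = \<phi> - of_nat (nat \<lfloor>\<phi> / a\<rfloor>) * a"
    have "real (nat \<lfloor>\<phi> / a\<rfloor>) = of_int \<lfloor>\<phi> / a\<rfloor>" using \<phi> a by simp
    moreover have "of_int \<lfloor>\<phi> / a\<rfloor> * a \<le> \<phi>" "\<phi> < (of_int \<lfloor>\<phi> / a\<rfloor> + 1) * a"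
      using a by (simp_all add: pos_le_divide_eq[symmetric] pos_divide_less_eq[symmetric])
    ultimately have \<psi>: "0 \<le> \<psi>" "\<psi> \<le> a" by (auto simp: \<psi>_def algebra_simps)
    have contS: "continuous_on UNIV S" unfolding S_def
      by (intro continuous_intros continuous_on_compose2[OF conth]) auto
    have "a * (real N * (ln (cmod (f 0)) - e)) \<le> integral {0..a} (\<lambda>\<theta>. S \<psi> - N * e)"
      using a Sbig by (simp add: \<psi>_def algebra_simps mult_left_mono)
    also have "\<dots> \<le> integral {0..a} S"
    proof (rule integral_le)
      show "S integrable_on {0..a}" by (intro integrable_continuous_interval continuous_on_subset[OF contS]) auto
      fix \<theta> assume \<theta>: "\<theta> \<in> {0..a}"
      have "S \<psi> - N * e = (\<Sum>j<N. h (\<psi> + of_nat j * a) - e)" by (simp add: S_def sum_subtractf)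
      also have "\<dots> \<le> S \<theta>" unfolding S_def
      proof (rule sum_mono)
        fix j
        show "h (\<psi> + of_nat j * a) - e \<le> h (\<theta> + of_nat j * a)"
          using close[of "\<psi> + of_nat j * a" "\<theta> + of_nat j * a"] \<theta> \<psi> by (auto simp: abs_le_iff)
      qed
      finally show "S \<psi> - N * e \<le> S \<theta>" .
    qed (auto intro!: integrable_continuous_interval continuous_intros)
    also have "\<dots> = integral {0..2*pi} h"
      using integral_split_periods[OF conth, of a N] a unfolding S_def by simp
    finally have "2 * pi * (ln (cmod (f 0)) - e) \<le> integral {0..2*pi} h"
      using a(2) by (simp add: mult.assoc[symmetric] mult.commute)
    then show "ln (cmod (f 0)) \<le> integral {0..2*pi} h / (2*pi) + e"
      by (simp add: field_simps)
  qed
  have "integral\<^sup>L circ h = integral {0..2*pi} h / (2*pi)" by (rule integral_circ_continuous[OF conth])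
  moreover have "ln c \<le> integral\<^sup>L circ h"
  proof -
    have "bounded (h ` {0..2*pi})"
      by (intro compact_imp_bounded compact_continuous_image continuous_on_subset[OF conth]) auto
    then obtain B where "\<And>x. x \<in> {0..2*pi} \<Longrightarrow> \<bar>h x\<bar> \<le> B" unfolding bounded_iff by force
    then have "integrable circ h" using conth
      by (intro integrable_circ_bounded[where B = B] borel_measurable_continuous_onI) auto
    then have "(\<integral>x. ln c \<partial>circ) \<le> integral\<^sup>L circ h" by (intro integral_mono lek) auto
    then show ?thesis using circ.prob_space by simp
  qed
  ultimately have "ln (max (cmod (f 0)) c) \<le> integral\<^sup>L circ h"
  proof (cases "cmod (f 0) \<le> c")
    case False
    then have "f 0 \<noteq> 0" using c by auto
    from main[OF this] show ?thesis using False \<open>integral\<^sup>L circ h = _\<close> by (simp add: max_def)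
  qed (simp add: max_def)
  then show ?thesis unfolding h_def k_def .
qed

text \<open>The previous inequality for \<open>1 / f\<close>, truncated at \<open>1 / B\<close> with
  \<open>B\<close> an upper bound for \<open>cmod f\<close>. Since \<open>1 / f\<close> never falls
  below this level in modulus, the truncation has no effect.\<close>

lemma circle_mean_ln_le:
  assumes cont: "continuous_on (cball 0 r) f" and hol: "f holomorphic_on ball 0 r" and r: "0 < r"
    and nz: "\<And>z. cmod z \<le> r \<Longrightarrow> f z \<noteq> 0"
  shows "(\<integral>\<theta>. ln (cmod (f (rcis r \<theta>))) \<partial>circ) \<le> ln (cmod (f 0))"
proof -
  have "bounded (f ` cball 0 r)" by (intro compact_imp_bounded compact_continuous_image cont) auto
  then obtain B where B: "\<And>z. cmod z \<le> r \<Longrightarrow> cmod (f z) \<le> B" unfolding bounded_iff by force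
  have f0: "0 < cmod (f 0)" using nz[of 0] r by auto
  moreover have "cmod (f 0) \<le> B" using B[of 0] r by simp
  ultimately have B0: "0 < B" by linarith
  define g where "g z = inverse (f z)" for z
  have mx: "max (cmod (g z)) (1 / B) = inverse (cmod (f z))" if "cmod z \<le> r" for z
  proof -
    have "1 / B \<le> inverse (cmod (f z))"
      using B[OF that] nz[OF that] by (simp add: inverse_eq_divide frac_le)
    then show ?thesis by (simp add: g_def norm_inverse)
  qed
  have "ln (max (cmod (g 0)) (1 / B)) \<le> (\<integral>\<theta>. ln (max (cmod (g (rcis r \<theta>))) (1 / B)) \<partial>circ)"
    unfolding g_def
    by (rule ln_le_circle_mean_ln_max) (use nz r B0 in \<open>auto intro!: continuous_intros holomorphic_intros cont hol\<close>)
  then have "ln (inverse (cmod (f 0))) \<le> (\<integral>\<theta>. ln (inverse (cmod (f (rcis r \<theta>)))) \<partial>circ)"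
    using r by (simp add: mx)
  then show ?thesis by (simp add: ln_inverse)
qed

text \<open>If the constant term is the larger one, truncate at the difference of the moduli, which
  the linear function never undercuts. Otherwise \<open>cmod (y + cis \<theta> * x)\<close> equals
  \<open>cmod (cnj x + cis \<theta> * cnj y)\<close>, which exchanges the roles. Equal moduli would
  give truncation level 0; they form a null set in the application.\<close>

lemma ln_max_le_circle_mean_linear:
  assumes ne: "cmod y \<noteq> cmod x"
  shows "ln (max (cmod y) (cmod x)) \<le> (\<integral>\<theta>. ln (cmod (y + cis \<theta> * x)) \<partial>circ)"
proof -
  define c where "c = \<bar>cmod y - cmod x\<bar>"
  have c: "0 < c" using ne by (simp add: c_def)
  have one: "ln (cmod a) \<le> (\<integral>\<theta>. ln (cmod (a + cis \<theta> * b)) \<partial>circ)"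
    if "\<bar>cmod a - cmod b\<bar> = c" "a \<noteq> 0" for a b
  proof -
    have "c \<le> cmod (a + cis \<theta> * b)" for \<theta>
      using norm_triangle_ineq3[of a "- (cis \<theta> * b)"] that by (simp add: norm_mult)
    then have mx: "max (cmod (a + cis \<theta> * b)) c = cmod (a + cis \<theta> * b)" for \<theta> by (rule max_absorb1)
    have "ln (cmod a) \<le> ln (max (cmod (a + 0 * b)) c)" using that by (intro ln_mono) auto
    also have "\<dots> \<le> (\<integral>\<theta>. ln (max (cmod (a + rcis 1 \<theta> * b)) c) \<partial>circ)"
      by (rule ln_le_circle_mean_ln_max[where f = "\<lambda>z. a + z * b"]) (use c in \<open>auto intro!: continuous_intros holomorphic_intros\<close>)
    finally show ?thesis by (simp add: mx rcis_def)
  qed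
  show ?thesis
  proof (cases "cmod x < cmod y")
    case True
    moreover from this have "y \<noteq> 0" by auto
    ultimately show ?thesis using one[of y x] by (simp add: c_def max_def)
  next
    case False
    then have "cmod y < cmod x" using ne by simp
    have "cmod (cnj x + cis \<theta> * cnj y) = cmod (y + cis \<theta> * x)" for \<theta>
    proof -
      have "cmod (cnj x + cis \<theta> * cnj y) = cmod (cnj (cnj x + cis \<theta> * cnj y))" by (simp only: complex_mod_cnj)
      also have "cnj (cnj x + cis \<theta> * cnj y) = cis (-\<theta>) * (y + cis \<theta> * x)"
        by (simp add: algebra_simps cis_mult cis_cnj mult.assoc[symmetric])
      finally show ?thesis by (simp add: norm_mult)
    qed
    moreover have "x \<noteq> 0" using \<open>cmod y < cmod x\<close> by auto
    ultimately show ?thesis using one[of "cnj x" "cnj y"] \<open>cmod y < cmod x\<close> by (simp add: c_def max_def)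
  qed
qed

text \<open>A weak form of Bernstein's inequality suffices here: the bound on the derivative comes from Cauchy's
  estimate on discs of radius \<open>1/K\<close>, in which a polynomial of degree \<open>K\<close> grows at most by a factor \<open>e\<close>.\<close>

lemma polynomial_bound_from_grid:
  fixes c :: "nat \<Rightarrow> complex"
  assumes K: "1 \<le> K" and N: "1 \<le> N"
    and B: "\<And>j. j < N \<Longrightarrow> cmod (\<Sum>n\<le>K. c n * cis (2 * pi * of_nat j / of_nat N) ^ n) \<le> B"
    and z: "cmod z \<le> 1"
  shows "(1 - 2 * pi * exp 1 * K / N) * cmod (\<Sum>n\<le>K. c n * z ^ n) \<le> B"
proof -
  define p where "p z = (\<Sum>n\<le>K. c n * z ^ n)" for z
  have holp: "p holomorphic_on A" for A unfolding p_def by (intro holomorphic_intros)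
  have contp: "continuous_on A p" for A unfolding p_def by (intro continuous_intros)
  obtain z0 where z0: "cmod z0 = 1" "\<And>w. cmod w \<le> 1 \<Longrightarrow> cmod (p w) \<le> cmod (p z0)"
    using max_modulus_circle[OF contp holp, of 1] by auto
  define S where "S = cmod (p z0)"
  have S0: "0 \<le> S" by (simp add: S_def)
  \<comment> \<open>The reversed polynomial: \<open>p w = w ^ K * q (1 / w)\<close>. The moduli of
    \<open>p\<close> and \<open>q\<close> have the same maximum on the unit circle, so the maximum
    principle for \<open>q\<close> bounds \<open>p\<close> outside the disc by
    \<open>S * cmod w ^ K\<close>.\<close>
  define q where "q z = (\<Sum>n\<le>K. c n * z ^ (K - n))" for z
  have holq: "q holomorphic_on A" for A unfolding q_def by (intro holomorphic_intros)
  have contq: "continuous_on A q" for A unfolding q_def by (intro continuous_intros)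
  have qp: "p w = w ^ K * q (inverse w)" if "w \<noteq> 0" for w
    unfolding p_def q_def sum_distrib_left
  proof (rule sum.cong)
    fix n assume "n \<in> {..K}"
    then have "w ^ K = w ^ n * w ^ (K - n)" by (simp add: power_add[symmetric])
    then show "c n * w ^ n = w ^ K * (c n * inverse w ^ (K - n))"
      using that by (simp add: power_inverse field_simps)
  qed simp
  obtain z1 where z1: "cmod z1 = 1" "\<And>w. cmod w \<le> 1 \<Longrightarrow> cmod (q w) \<le> cmod (q z1)"
    using max_modulus_circle[OF contq holq, of 1] by auto
  have "cmod (q z1) = cmod (p (inverse z1))"
  proof -
    have "z1 \<noteq> 0" using z1(1) by auto
    then show ?thesis using qp[of "inverse z1"] z1(1) by (simp add: norm_mult norm_power norm_inverse)
  qed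
  then have qS: "cmod (q w) \<le> S" if "cmod w \<le> 1" for w
    using z1(2)[OF that] z0(2)[of "inverse z1"] z1(1) by (simp add: S_def norm_inverse)
  have grow: "cmod (p w) \<le> S * cmod w ^ K" if "1 \<le> cmod w" for w
  proof -
    have "cmod (q (inverse w)) \<le> S" using that by (intro qS) (simp only: norm_inverse inverse_le_1_iff, simp)
    moreover have "w \<noteq> 0" using that by auto
    ultimately show ?thesis
      using qp[of w] by (simp add: norm_mult norm_power mult.commute mult_right_mono)
  qed
  have e1: "(1 + 1 / K) ^ K \<le> exp 1"
  proof -
    have "(1 + 1 / K) ^ K \<le> exp (1 / K) ^ K" by (intro power_mono) (auto intro: exp_ge_add_one_self)
    also have "\<dots> = exp 1" using K by (simp add: exp_of_nat_mult[symmetric])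
    finally show ?thesis .
  qed
  have bd: "cmod (p x) \<le> S * exp 1" if "cmod x \<le> 1 + 1 / K" for x
  proof (cases "cmod x \<le> 1")
    case True
    then have "cmod (p x) \<le> S * 1" using z0(2) by (simp add: S_def)
    also have "\<dots> \<le> S * exp 1" using S0 by (intro mult_left_mono) auto
    finally show ?thesis .
  next
    case False
    then have "cmod (p x) \<le> S * cmod x ^ K" by (intro grow) auto
    also have "\<dots> \<le> S * (1 + 1 / K) ^ K" using that S0 by (intro mult_left_mono power_mono) auto
    also have "\<dots> \<le> S * exp 1" using e1 S0 by (intro mult_left_mono) auto
    finally show ?thesis .
  qed
  have der: "cmod (deriv p w) \<le> exp 1 * K * S" if "cmod w \<le> 1" for w
  proof -
    have "cmod ((deriv ^^ 1) p w) \<le> fact 1 * (S * exp 1) / (1 / K) ^ 1"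
    proof (rule Cauchy_inequality[OF holp contp])
      fix x assume "cmod (w - x) = 1 / real K"
      then show "cmod (p x) \<le> S * exp 1"
        using norm_triangle_ineq2[of x w] that by (intro bd) (simp add: norm_minus_commute)
    qed (use K in auto)
    then show ?thesis by (simp add: mult_ac)
  qed
  define \<phi> where "\<phi> = Arg2pi z0"
  have zr: "z0 = cis \<phi>" and \<phi>: "0 \<le> \<phi>" "\<phi> < 2 * pi"
    using Arg2pi[of z0] z0(1) by (auto simp: \<phi>_def is_Arg_def cis_conv_exp)
  define a where "a = 2 * pi / N"
  have a: "0 < a" using N by (simp add: a_def)
  \<comment> \<open>The grid point just below the maximizing angle, at angular distance less than
    \<open>a\<close>.\<close>
  define j where "j = nat \<lfloor>\<phi> / a\<rfloor>"
  have rj: "real j = of_int \<lfloor>\<phi> / a\<rfloor>" using \<phi> a by (simp add: j_def)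
  have j1: "real j * a \<le> \<phi>" "\<phi> < (real j + 1) * a"
    unfolding rj using a by (simp_all add: pos_le_divide_eq[symmetric] pos_divide_less_eq[symmetric])
  have "real j * a < real N * a" using j1(1) \<phi>(2) N by (simp add: a_def)
  then have jN: "j < N" using a by simp
  have "cmod (p z0 - p (cis (real j * a))) \<le> exp 1 * K * S * cmod (z0 - cis (real j * a))"
  proof (rule field_differentiable_bound[of "cball 0 1" p "deriv p"])
    fix w :: complex
    show "(p has_field_derivative deriv p w) (at w within cball 0 1)"
      by (rule holomorphic_derivI[OF holp[of UNIV]]) auto
    assume "w \<in> cball 0 1"
    then show "cmod (deriv p w) \<le> exp 1 * K * S" by (intro der) auto
  qed (use z0 in auto)
  also have "\<dots> \<le> exp 1 * K * S * a"
    using norm_cis_diff_le[of \<phi> "real j * a"] j1 S0 by (intro mult_left_mono) (auto simp: zr algebra_simps)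
  finally have "S - cmod (p (cis (real j * a))) \<le> exp 1 * K * S * a"
    using norm_triangle_ineq2[of "p z0" "p (cis (real j * a))"] by (simp add: S_def)
  moreover have "cmod (p (cis (real j * a))) \<le> B"
    using B[OF jN] by (simp add: p_def a_def mult_ac)
  ultimately have SB: "(1 - 2 * pi * exp 1 * K / N) * S \<le> B"
    by (simp add: a_def algebra_simps)
  \<comment> \<open>If the oversampling \<open>N / K\<close> is too small, the factor on the left is
    negative and nonnegativity of \<open>B\<close> suffices.\<close>
  have B0: "0 \<le> B" using B[of 0] N by (intro order_trans[OF norm_ge_zero B[of 0]]) auto
  show ?thesis
  proof (cases "0 \<le> 1 - 2 * pi * exp 1 * K / N")
    case True
    have "(1 - 2 * pi * exp 1 * K / N) * cmod (p z) \<le> (1 - 2 * pi * exp 1 * K / N) * S"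
      using z0(2)[OF z] True by (intro mult_left_mono) (auto simp: S_def)
    then show ?thesis using SB by (simp add: p_def)
  next
    case False
    then have "(1 - 2 * pi * exp 1 * K / N) * cmod (p z) \<le> 0" by (intro mult_nonpos_nonneg) auto
    then show ?thesis using B0 by (simp add: p_def)
  qed
qed

section \<open>The logarithmic potential of the Gaussian measure\<close>

lemma integrable_if_nn_integral_le:
  assumes [measurable]: "f \<in> borel_measurable M" and "\<And>x. 0 \<le> f x" and "(\<integral>\<^sup>+x. ennreal (f x) \<partial>M) \<le> ennreal c" and "0 \<le> c"
  shows "integrable M f" "integral\<^sup>L M f \<le> c"
proof -
  have "(\<integral>\<^sup>+x. ennreal (f x) \<partial>M) < \<infinity>" using assms(3) by (rule order.strict_trans1) simp
  then show i: "integrable M f" using assms(2) by (intro integrableI_nonneg) auto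
  show "integral\<^sup>L M f \<le> c"
    using assms(3) assms(4) nn_integral_eq_integral[OF i] assms(2) by (simp add: ennreal_le_iff)
qed

lemma nn_integral_cgauss_norm_square: "(\<integral>\<^sup>+z. ennreal ((cmod z)\<^sup>2) \<partial>cgauss) = 1"
proof -
  have "(\<integral>\<^sup>+z. ennreal ((cmod z)\<^sup>2) \<partial>cgauss) = (\<integral>\<^sup>+t. emeasure cgauss {z\<in>space cgauss. t < (cmod z)\<^sup>2} * indicator {0..} t \<partial>lborel)"
    by (rule nn_integral_layer_cake) (auto intro: cgauss.sigma_finite_measure_axioms)
  also have "\<dots> = (\<integral>\<^sup>+t. ennreal (exp (- t)) * indicator {0..} t \<partial>lborel)"
    by (intro nn_integral_cong) (auto simp: emeasure_cgauss_tail split: split_indicator)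
  finally show ?thesis by (simp add: nn_integral_exp_tail)
qed

lemma cgauss_norm_square: "integrable cgauss (\<lambda>z. (cmod z)\<^sup>2)" "(\<integral>z. (cmod z)\<^sup>2 \<partial>cgauss) \<le> 1"
  using integrable_if_nn_integral_le[of "\<lambda>z. (cmod z)\<^sup>2" cgauss 1] nn_integral_cgauss_norm_square by auto

lemma cgauss_norm: "integrable cgauss cmod" "(\<integral>z. cmod z \<partial>cgauss) \<le> 2"
proof -
  have le: "cmod z \<le> 1 + (cmod z)\<^sup>2" for z
  proof -
    have "0 \<le> (cmod z - 1)\<^sup>2" by simp
    then show ?thesis by (simp add: power2_eq_square algebra_simps) (smt (verit) norm_ge_zero)
  qed
  have i: "integrable cgauss (\<lambda>z. 1 + (cmod z)\<^sup>2)" using cgauss_norm_square by simp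
  show ii: "integrable cgauss cmod"
    by (rule Bochner_Integration.integrable_bound[OF i]) (use le in auto)
  have "(\<integral>z. cmod z \<partial>cgauss) \<le> (\<integral>z. 1 + (cmod z)\<^sup>2 \<partial>cgauss)"
    by (rule integral_mono[OF ii i le])
  also have "\<dots> = 1 + (\<integral>z. (cmod z)\<^sup>2 \<partial>cgauss)"
    using cgauss_norm_square cgauss.prob_space by simp
  finally show "(\<integral>z. cmod z \<partial>cgauss) \<le> 2" using cgauss_norm_square by simp
qed

text \<open>By layer cake: for \<open>t > 1\<close> the superlevel set at height \<open>t\<close>
  lies in the disc of radius \<open>1 / t\<close>, of area \<open>pi / t\<^sup>2\<close>, and for
  smaller heights in the unit disc. Each range contributes at most \<open>pi\<close>.\<close>

lemma nn_integral_inverse_norm_disc: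
  "(\<integral>\<^sup>+z. ennreal (indicator {z. cmod z \<le> 1} z / cmod z) \<partial>lborel) \<le> ennreal (2 * pi)"
proof -
  let ?f = "\<lambda>z::complex. indicator {z. cmod z \<le> 1} z / cmod z"
  have F: "(\<integral>\<^sup>+t. ennreal (pi / (t::real)\<^sup>2) * indicator {1..} t \<partial>lborel) = ennreal (0 - (- pi / 1))"
  proof (rule nn_integral_FTC_atLeast[where F = "\<lambda>t. - pi / t"])
    show "((\<lambda>t::real. - pi / t) \<longlongrightarrow> 0) at_top" by real_asymp
  qed (auto intro!: derivative_eq_intros simp: power2_eq_square)
  have "(\<integral>\<^sup>+z. ennreal (?f z) \<partial>lborel) = (\<integral>\<^sup>+t. emeasure lborel {z\<in>space lborel. t < ?f z} * indicator {0..} t \<partial>lborel)"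
    by (rule nn_integral_layer_cake) (auto intro: lborel.sigma_finite_measure_axioms)
  also have "\<dots> \<le> (\<integral>\<^sup>+t. (ennreal pi * indicator {0..1} t + ennreal (pi / t\<^sup>2) * indicator {1..} t) \<partial>lborel)"
  proof (rule nn_integral_mono)
    fix t :: real
    consider "t < 0" | "0 \<le> t" "t \<le> 1" | "1 < t" by linarith
    then show "emeasure lborel {z\<in>space lborel. t < ?f z} * indicator {0..} t
      \<le> ennreal pi * indicator {0..1} t + ennreal (pi / t\<^sup>2) * indicator {1..} t"
    proof cases
      case 1 then show ?thesis by simp
    next
      case 2
      have "emeasure lborel {z\<in>space lborel. t < ?f z} \<le> emeasure lborel (cball (0::complex) 1)"
        using 2 by (intro emeasure_mono) (auto split: split_indicator_asm)
      also have "\<dots> = ennreal pi" by (simp add: emeasure_cball unit_ball_vol_2)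
      also have "ennreal pi \<le> ennreal pi * indicator {0..1} t + ennreal (pi / t\<^sup>2) * indicator {1..} t"
        using 2 by (simp add: add_increasing2)
      finally show ?thesis using 2 by simp
    next
      case 3
      have "{z\<in>space lborel. t < ?f z} \<subseteq> cball (0::complex) (1 / t)"
      proof
        fix z :: complex assume "z \<in> {z\<in>space lborel. t < ?f z}"
        then have "t < 1 / cmod z" "cmod z \<noteq> 0" using 3 by (auto split: split_indicator_asm)
        then show "z \<in> cball 0 (1 / t)" using 3 by (simp add: field_simps)
      qed
      then have "emeasure lborel {z\<in>space lborel. t < ?f z} \<le> emeasure lborel (cball (0::complex) (1 / t))"
        by (intro emeasure_mono) auto
      also have "\<dots> = ennreal (pi / t\<^sup>2)" using 3 by (simp add: emeasure_cball unit_ball_vol_2 power_divide)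
      finally show ?thesis using 3 by simp
    qed
  qed
  also have "\<dots> = ennreal pi + ennreal pi"
    using F by (simp add: nn_integral_add nn_integral_cmult)
  finally show ?thesis by (simp add: ennreal_plus[symmetric] del: ennreal_plus)
qed

text \<open>The decay in \<open>cmod y\<close> is the point: in the exponential moment this
  expectation is multiplied by a quantity of order \<open>1 + cmod y\<close>. The triangle
  inequality moves the factor \<open>1 + cmod y\<close> onto \<open>1 + cmod z\<close>, which the
  Gaussian density controls near the singularity. The bound is \<open>4\<close> from the unit disc
  around \<open>- y\<close>, plus \<open>2 + 2\<close> from the rest, using mean modulus at most
  \<open>2\<close>.\<close>

lemma cgauss_inverse_norm:
  "integrable cgauss (\<lambda>z. 1 / cmod (y + z))" "(1 + cmod y) * (\<integral>z. 1 / cmod (y + z) \<partial>cgauss) \<le> 8"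
proof -
  let ?f = "\<lambda>z. (1 + cmod y) * (1 / cmod (y + z))"
  let ?g = "\<lambda>z. (1 + cmod z) * (indicator {z. cmod z \<le> 1} (y + z) / cmod (y + z))"
  have le: "?f z \<le> ?g z + (2 + cmod z)" for z
  proof (cases "y + z = 0")
    case True then show ?thesis by simp
  next
    case False
    then have p: "0 < cmod (y + z)" by simp
    have "cmod y \<le> cmod (y + z) + cmod z" using norm_triangle_ineq4[of "y + z" z] by simp
    then have "?f z \<le> (1 + (cmod (y + z) + cmod z)) / cmod (y + z)"
      using p by (simp add: divide_right_mono)
    also have "\<dots> = (1 + cmod z) / cmod (y + z) + 1" using p by (simp add: field_simps)
    also have "(1 + cmod z) / cmod (y + z) \<le> ?g z + (1 + cmod z)"
    proof (cases "cmod (y + z) \<le> 1")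
      case False
      then have "(1 + cmod z) / cmod (y + z) \<le> (1 + cmod z) / 1" by (intro divide_left_mono) auto
      then show ?thesis using False by simp
    qed simp
    finally show ?thesis by simp
  qed
  have w: "1 / pi * exp (- t\<^sup>2) * (1 + t) \<le> 2 / pi" if "0 \<le> t" for t :: real
  proof -
    have "1 + t \<le> 2 * exp (t\<^sup>2)"
    proof (cases "t \<le> 1")
      case True
      have "2 * 1 \<le> 2 * exp (t\<^sup>2)" by (intro mult_left_mono) auto
      then show ?thesis using True by linarith
    next
      case False
      then have "t * 1 \<le> t * t" by (intro mult_left_mono) auto
      then have "1 + t \<le> 1 + t\<^sup>2" by (simp add: power2_eq_square)
      also have "\<dots> \<le> exp (t\<^sup>2)" by (rule exp_ge_add_one_self)
      also have "\<dots> \<le> 2 * exp (t\<^sup>2)" by simp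
      finally show ?thesis .
    qed
    then have "exp (- t\<^sup>2) * (1 + t) \<le> exp (- t\<^sup>2) * (2 * exp (t\<^sup>2))" by (intro mult_left_mono) auto
    also have "\<dots> = 2" by (simp add: exp_minus)
    finally show ?thesis by (simp add: divide_right_mono)
  qed
  have "(\<integral>\<^sup>+z. ennreal (?g z) \<partial>cgauss) = (\<integral>\<^sup>+z. ennreal ((1 / pi * exp (- (cmod z)\<^sup>2)) * ?g z) \<partial>lborel)"
    by (subst nn_integral_cgauss) (auto simp: ennreal_mult'[symmetric] simp del: times_divide_eq_left)
  also have "\<dots> \<le> (\<integral>\<^sup>+z. ennreal (2 / pi) * ennreal (indicator {z. cmod z \<le> 1} (y + z) / cmod (y + z)) \<partial>lborel)"
  proof (rule nn_integral_mono)
    fix z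
    have "(1 / pi * exp (- (cmod z)\<^sup>2)) * ?g z = (1 / pi * exp (- (cmod z)\<^sup>2) * (1 + cmod z)) * (indicator {z. cmod z \<le> 1} (y + z) / cmod (y + z))"
      by (simp only: mult.assoc)
    also have "\<dots> \<le> (2 / pi) * (indicator {z. cmod z \<le> 1} (y + z) / cmod (y + z))"
      by (intro mult_right_mono w) auto
    finally show "ennreal ((1 / pi * exp (- (cmod z)\<^sup>2)) * ?g z) \<le> ennreal (2 / pi) * ennreal (indicator {z. cmod z \<le> 1} (y + z) / cmod (y + z))"
      by (subst ennreal_mult'[symmetric]) (auto intro!: ennreal_leI)
  qed
  also have "\<dots> = ennreal (2 / pi) * (\<integral>\<^sup>+z. ennreal (indicator {z. cmod z \<le> 1} (y + 1 *\<^sub>R z) / cmod (y + 1 *\<^sub>R z)) \<partial>lborel)"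
    by (subst nn_integral_cmult) auto
  also have "\<dots> = ennreal (2 / pi) * (\<integral>\<^sup>+z. ennreal (indicator {z. cmod z \<le> 1} z / cmod z) \<partial>lborel)"
    by (subst nn_integral_lborel_affine[where f = "\<lambda>z. ennreal (indicator {z. cmod z \<le> 1} z / cmod z)"]) auto
  also have "\<dots> \<le> ennreal (2 / pi) * ennreal (2 * pi)"
    by (intro mult_left_mono nn_integral_inverse_norm_disc) auto
  also have "\<dots> = ennreal 4" by (simp add: ennreal_mult'[symmetric])
  finally have g: "(\<integral>\<^sup>+z. ennreal (?g z) \<partial>cgauss) \<le> ennreal 4" .
  have gi: "integrable cgauss ?g" "integral\<^sup>L cgauss ?g \<le> 4"
    by (rule integrable_if_nn_integral_le[OF _ _ g]; simp)+
  have i: "integrable cgauss (\<lambda>z. ?g z + (2 + cmod z))"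
    using gi cgauss_norm by (intro Bochner_Integration.integrable_add) auto
  have fi: "integrable cgauss ?f"
    by (rule Bochner_Integration.integrable_bound[OF i]) (use le in \<open>auto simp: abs_mult intro: order_trans[OF _ abs_ge_self]\<close>)
  have "integrable cgauss (\<lambda>z. 1 / (1 + cmod y) * ?f z)" by (rule integrable_mult_right[OF fi])
  moreover have "1 / (1 + cmod y) * ?f z = 1 / cmod (y + z)" for z
  proof -
    have "1 + cmod y \<noteq> 0" by (smt (verit) norm_ge_zero)
    then show ?thesis by simp
  qed
  ultimately show "integrable cgauss (\<lambda>z. 1 / cmod (y + z))" by (simp only:)
  have "(1 + cmod y) * (\<integral>z. 1 / cmod (y + z) \<partial>cgauss) = (\<integral>z. ?f z \<partial>cgauss)"
    by (rule integral_mult_right_zero[symmetric])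
  also have "\<dots> \<le> (\<integral>z. ?g z + (2 + cmod z) \<partial>cgauss)" by (rule integral_mono[OF fi i le])
  also have "\<dots> = integral\<^sup>L cgauss ?g + (2 + (\<integral>z. cmod z \<partial>cgauss))"
    using gi(1) cgauss_norm cgauss.prob_space by (subst Bochner_Integration.integral_add) auto
  finally show "(1 + cmod y) * (\<integral>z. 1 / cmod (y + z) \<partial>cgauss) \<le> 8" using gi(2) cgauss_norm by simp
qed

lemma abs_ln_le: "0 < x \<Longrightarrow> \<bar>ln x\<bar> \<le> x + 1 / x" for x :: real
proof -
  assume x: "0 < x"
  have "ln x \<le> x - 1" using x by (rule ln_le_minus_one)
  moreover have "- ln x \<le> 1 / x - 1" using ln_le_minus_one[of "1/x"] x by (simp add: ln_div)
  moreover have "0 < 1 / x" using x by simp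
  ultimately show ?thesis using x by linarith
qed

lemma ln_ge_minus_inverse: "0 < x \<Longrightarrow> - (1 / x) \<le> ln x" for x :: real
  using ln_le_minus_one[of "1/x"] by (simp add: ln_div)

lemma integrable_ln_norm: "integrable cgauss (\<lambda>z. ln (cmod (y + z)))"
proof -
  have i: "integrable cgauss (\<lambda>z. (cmod y + cmod z) + 1 / cmod (y + z))"
    using cgauss_norm cgauss_inverse_norm by simp
  show ?thesis
  proof (rule Bochner_Integration.integrable_bound[OF i])
    have "norm (ln (cmod (y + z))) \<le> norm ((cmod y + cmod z) + 1 / cmod (y + z))" if "z \<noteq> - y" for z
    proof -
      have "0 < cmod (y + z)" using that by (simp add: add_eq_0_iff)
      then have "\<bar>ln (cmod (y + z))\<bar> \<le> cmod (y + z) + 1 / cmod (y + z)" by (rule abs_ln_le)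
      also have "\<dots> \<le> cmod y + cmod z + 1 / cmod (y + z)" using norm_triangle_ineq[of y z] by simp
      finally show ?thesis by simp
    qed
    then show "AE z in cgauss. norm (ln (cmod (y + z))) \<le> norm ((cmod y + cmod z) + 1 / cmod (y + z))"
      using AE_cgauss_ne[of "-y"] by (auto elim: eventually_mono)
  qed measurable
qed

text \<open>The potential \<open>u\<close> of the overview. In the form with \<open>max\<close>, the
  excess over \<open>ln (cmod y)\<close> and the submean property under holomorphic maps hold
  pointwise in \<open>z\<close>.\<close>

definition log_potential :: "complex \<Rightarrow> real" where
  "log_potential y = (\<integral>z. ln (max (cmod y) (cmod z)) \<partial>cgauss)"

lemma log_potential_measurable [measurable]: "log_potential \<in> borel_measurable borel"
proof -
  have "(\<lambda>p. ln (max (cmod (fst p)) (cmod (snd p)))) \<in> borel_measurable (borel \<Otimes>\<^sub>M cgauss)" by measurable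
  then show ?thesis unfolding log_potential_def
    by (intro cgauss.borel_measurable_lebesgue_integral) (simp add: case_prod_beta)
qed

lemma abs_ln_max_le: "z \<noteq> 0 \<Longrightarrow> \<bar>ln (max (cmod y) (cmod z))\<bar> \<le> cmod y + cmod z + 1 / cmod z"
proof -
  assume z: "z \<noteq> 0"
  define m where "m = max (cmod y) (cmod z)"
  have m: "0 < m" "m \<le> cmod y + cmod z" "cmod z \<le> m" using z by (auto simp: m_def less_max_iff_disj)
  have "\<bar>ln m\<bar> \<le> m + 1 / m" by (rule abs_ln_le[OF m(1)])
  also have "\<dots> \<le> (cmod y + cmod z) + 1 / cmod z"
    using m z by (intro add_mono frac_le) auto
  finally show ?thesis by (simp add: m_def)
qed

lemma integrable_ln_max: "integrable cgauss (\<lambda>z. ln (max (cmod y) (cmod z)))"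
proof -
  have i: "integrable cgauss (\<lambda>z. (cmod y + cmod z) + 1 / cmod (0 + z))"
    using cgauss_norm cgauss_inverse_norm[of 0] by simp
  show ?thesis
    by (rule Bochner_Integration.integrable_bound[OF i], measurable)
      (use AE_cgauss_ne[of 0] abs_ln_max_le[of _ y] in \<open>auto elim!: eventually_mono intro: order_trans[OF _ abs_ge_self]\<close>)
qed

lemma log_potential_lower: "- 8 \<le> log_potential y" "y \<noteq> 0 \<Longrightarrow> ln (cmod y) \<le> log_potential y"
proof -
  have i: "integrable cgauss (\<lambda>z. - (1 / cmod (0 + z)))" using cgauss_inverse_norm[of 0] by simp
  have "(\<integral>z. - (1 / cmod (0 + z)) \<partial>cgauss) \<le> log_potential y"
    unfolding log_potential_def
  proof (rule integral_mono_AE[OF i integrable_ln_max])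
    have "- (1 / cmod (0 + z)) \<le> ln (max (cmod y) (cmod z))" if "z \<noteq> 0" for z
    proof -
      have "- (1 / cmod z) \<le> ln (cmod z)" using that by (intro ln_ge_minus_inverse) auto
      also have "\<dots> \<le> ln (max (cmod y) (cmod z))" using that by (intro ln_mono) auto
      finally show ?thesis by simp
    qed
    then show "AE z in cgauss. - (1 / cmod (0 + z)) \<le> ln (max (cmod y) (cmod z))"
      using AE_cgauss_ne[of 0] by (auto elim!: eventually_mono)
  qed
  moreover have "(\<integral>z. - (1 / cmod (0 + z)) \<partial>cgauss) \<ge> - 8"
    using cgauss_inverse_norm(2)[of 0] by simp
  ultimately show "- 8 \<le> log_potential y" by linarith
  assume y: "y \<noteq> 0"
  have "(\<integral>z. ln (cmod y) \<partial>cgauss) \<le> log_potential y"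
    unfolding log_potential_def
  proof (rule integral_mono[OF _ integrable_ln_max])
    show "ln (cmod y) \<le> ln (max (cmod y) (cmod z))" for z using y by (intro ln_mono) auto
  qed simp
  then show "ln (cmod y) \<le> log_potential y" using cgauss.prob_space by simp
qed

lemma log_potential_upper: "log_potential y \<le> ln (1 + cmod y) + 2"
proof -
  have i: "integrable cgauss (\<lambda>z. ln (1 + cmod y) + cmod z)" using cgauss_norm by simp
  have "log_potential y \<le> (\<integral>z. ln (1 + cmod y) + cmod z \<partial>cgauss)"
    unfolding log_potential_def
  proof (rule integral_mono_AE[OF integrable_ln_max i])
    have "ln (max (cmod y) (cmod z)) \<le> ln (1 + cmod y) + cmod z" if "z \<noteq> 0" for z
    proof -
      have "max (cmod y) (cmod z) \<le> (1 + cmod y) * (1 + cmod z)"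
        by (auto simp: algebra_simps max_def)
      then have "ln (max (cmod y) (cmod z)) \<le> ln ((1 + cmod y) * (1 + cmod z))"
        using that by (intro ln_mono) (auto simp: less_max_iff_disj)
      also have "\<dots> = ln (1 + cmod y) + ln (1 + cmod z)"
        by (rule ln_mult_pos) (auto intro: add_pos_nonneg)
      also have "ln (1 + cmod z) \<le> cmod z" by (rule ln_add_one_self_le_self) simp
      finally show ?thesis by simp
    qed
    then show "AE z in cgauss. ln (max (cmod y) (cmod z)) \<le> ln (1 + cmod y) + cmod z"
      using AE_cgauss_ne[of 0] by (auto elim!: eventually_mono)
  qed
  also have "\<dots> = ln (1 + cmod y) + (\<integral>z. cmod z \<partial>cgauss)" using cgauss_norm cgauss.prob_space by simp
  finally show ?thesis using cgauss_norm(2) by linarith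
qed

lemma AE_cgauss_norm_ne: "AE z in cgauss. cmod z \<noteq> c"
proof -
  have "AE z in lborel. z \<notin> sphere (0::complex) c"
  proof (rule AE_not_in)
    have "negligible (sphere (0::complex) c)" by (rule negligible_sphere)
    then have "sphere (0::complex) c \<in> null_sets lebesgue" by (simp add: negligible_iff_null_sets)
    then show "sphere (0::complex) c \<in> null_sets lborel" by (subst null_sets_completion_iff[symmetric]) auto
  qed
  then show ?thesis
    unfolding cgauss_def by (subst AE_density) (auto elim!: eventually_mono)
qed

text \<open>Rotating \<open>z\<close> does not change its law, so the expectation may be averaged
  over the phase of \<open>z\<close>; then the inequality for circle means of linear functions
  applies for almost every \<open>z\<close>. This direction makes
  \<open>log_potential y - ln (cmod (y + z))\<close> have nonpositive mean, as the exponential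
  moment requires.\<close>

lemma log_potential_le_expectation: "log_potential y \<le> (\<integral>z. ln (cmod (y + z)) \<partial>cgauss)"
proof -
  interpret P: pair_sigma_finite cgauss circ ..
  let ?g = "\<lambda>z \<theta>. ln (cmod (y + cis \<theta> * z))"
  have cism [measurable]: "cis \<in> borel_measurable borel"
    by (intro borel_measurable_continuous_onI continuous_intros)
  have inv: "integrable cgauss (\<lambda>z. f (cis \<theta> * z))" "(\<integral>z. f (cis \<theta> * z) \<partial>cgauss) = (\<integral>z. f z \<partial>cgauss)"
    if f: "integrable cgauss f" for f :: "complex \<Rightarrow> real" and \<theta>
  proof -
    have d: "distr cgauss cgauss ((*) (cis \<theta>)) = cgauss" by (rule distr_cgauss_unit) simp
    have "integrable (distr cgauss cgauss ((*) (cis \<theta>))) f" unfolding d by fact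
    then show "integrable cgauss (\<lambda>z. f (cis \<theta> * z))" by (subst (asm) integrable_distr_eq) (use f in auto)
    have "(\<integral>z. f z \<partial>cgauss) = (\<integral>z. f z \<partial>distr cgauss cgauss ((*) (cis \<theta>)))" unfolding d ..
    also have "\<dots> = (\<integral>z. f (cis \<theta> * z) \<partial>cgauss)" by (rule integral_distr) (use f in auto)
    finally show "(\<integral>z. f (cis \<theta> * z) \<partial>cgauss) = (\<integral>z. f z \<partial>cgauss)" ..
  qed
  have i: "integrable (cgauss \<Otimes>\<^sub>M circ) (\<lambda>(z, \<theta>). ?g z \<theta>)"
  proof (rule integrableI_bounded)
    show "(\<lambda>(z, \<theta>). ?g z \<theta>) \<in> borel_measurable (cgauss \<Otimes>\<^sub>M circ)" by measurable
    have "(\<integral>\<^sup>+p. ennreal (norm (case p of (z, \<theta>) \<Rightarrow> ?g z \<theta>)) \<partial>(cgauss \<Otimes>\<^sub>M circ))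
      = (\<integral>\<^sup>+\<theta>. \<integral>\<^sup>+z. ennreal \<bar>?g z \<theta>\<bar> \<partial>cgauss \<partial>circ)"
      by (subst P.nn_integral_snd[symmetric]) auto
    also have "\<dots> = (\<integral>\<^sup>+\<theta>. ennreal (\<integral>z. \<bar>ln (cmod (y + z))\<bar> \<partial>cgauss) \<partial>circ)"
    proof (rule nn_integral_cong)
      fix \<theta>
      have "integrable cgauss (\<lambda>z. \<bar>ln (cmod (y + z))\<bar>)" using integrable_ln_norm by simp
      from inv[OF this, of \<theta>] show "(\<integral>\<^sup>+z. ennreal \<bar>?g z \<theta>\<bar> \<partial>cgauss) = ennreal (\<integral>z. \<bar>ln (cmod (y + z))\<bar> \<partial>cgauss)"
        by (subst nn_integral_eq_integral) auto
    qed
    also have "\<dots> < \<infinity>" by (simp add: circ.emeasure_space_1[simplified])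
    finally show "(\<integral>\<^sup>+p. ennreal (norm (case p of (z, \<theta>) \<Rightarrow> ?g z \<theta>)) \<partial>(cgauss \<Otimes>\<^sub>M circ)) < \<infinity>" .
  qed
  have "log_potential y \<le> (\<integral>z. (\<integral>\<theta>. ?g z \<theta> \<partial>circ) \<partial>cgauss)"
    unfolding log_potential_def
  proof (rule integral_mono_AE[OF integrable_ln_max])
    show "integrable cgauss (\<lambda>z. \<integral>\<theta>. ?g z \<theta> \<partial>circ)" by (rule P.integrable_fst[OF i])
    show "AE z in cgauss. ln (max (cmod y) (cmod z)) \<le> (\<integral>\<theta>. ?g z \<theta> \<partial>circ)"
      using AE_cgauss_norm_ne[of "cmod y"]
    proof eventually_elim
      case (elim z)
      then show ?case by (intro ln_max_le_circle_mean_linear) auto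
    qed
  qed
  also have "\<dots> = (\<integral>\<theta>. (\<integral>z. ?g z \<theta> \<partial>cgauss) \<partial>circ)" by (rule P.Fubini_integral[OF i, symmetric])
  also have "\<dots> = (\<integral>\<theta>. (\<integral>z. ln (cmod (y + z)) \<partial>cgauss) \<partial>circ)"
    using inv(2)[OF integrable_ln_norm[of y]] by simp
  also have "\<dots> = (\<integral>z. ln (cmod (y + z)) \<partial>cgauss)" using circ.prob_space by simp
  finally show ?thesis .
qed

text \<open>On the event \<open>X + 1 < (cmod z)\<^sup>2\<close>, of probability
  \<open>exp (- (X + 1))\<close>, the maximum gains at least half of
  \<open>ln ((X + 1) / X)\<close>, which is at least \<open>1 / (2 * (X + 1))\<close>.\<close>

lemma log_potential_excess:
  assumes y: "y \<noteq> 0" and X: "(cmod y)\<^sup>2 \<le> X"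
  shows "ln (cmod y) + exp (- (X + 1)) / (2 * (X + 1)) \<le> log_potential y"
proof -
  have X0: "0 < X" using y X by (metis norm_eq_zero order_less_le_trans zero_less_power2)
  let ?e = "1 / (2 * (X + 1))"
  let ?S = "{z. X + 1 < (cmod z)\<^sup>2}"
  have [measurable]: "?S \<in> sets borel" by measurable
  have i: "integrable cgauss (\<lambda>z. ln (cmod y) + ?e * indicator ?S z)"
    by (intro Bochner_Integration.integrable_add integrable_mult_right integrable_real_indicator)
      (auto simp: cgauss.emeasure_eq_measure)
  have "(\<integral>z. ln (cmod y) + ?e * indicator ?S z \<partial>cgauss) \<le> log_potential y"
    unfolding log_potential_def
  proof (rule integral_mono[OF i integrable_ln_max])
    fix z
    show "ln (cmod y) + ?e * indicator ?S z \<le> ln (max (cmod y) (cmod z))"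
    proof (cases "z \<in> ?S")
      case False
      then show ?thesis using y by (auto intro!: ln_mono)
    next
      case True
      have "1 / (X + 1) \<le> - ln (1 - 1 / (X + 1))"
        using ln_le_minus_one[of "1 - 1 / (X + 1)"] X0 by simp
      also have "1 - 1 / (X + 1) = X / (X + 1)" using X0 by (simp add: field_simps)
      also have "- ln (X / (X + 1)) = ln (X + 1) - ln X" using X0 by (simp add: ln_div)
      finally have 1: "1 / (X + 1) \<le> ln (X + 1) - ln X" .
      have "ln ((cmod y)\<^sup>2) \<le> ln X" using y X by (intro ln_mono) auto
      moreover have "ln (X + 1) \<le> ln ((cmod z)\<^sup>2)" using True X0 by (intro ln_mono) auto
      moreover have "z \<noteq> 0" using True X0 by auto
      ultimately have "2 * ln (cmod y) + 1 / (X + 1) \<le> 2 * ln (cmod z)"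
        using 1 y by (simp add: ln_realpow)
      moreover have "ln (cmod z) \<le> ln (max (cmod y) (cmod z))" using \<open>z \<noteq> 0\<close> by (intro ln_mono) auto
      ultimately have "2 * ln (cmod y) + 1 / (X + 1) \<le> 2 * ln (max (cmod y) (cmod z))" by linarith
      then show ?thesis using True X0 by (simp add: field_simps)
    qed
  qed
  moreover have "(\<integral>z. ln (cmod y) + ?e * indicator ?S z \<partial>cgauss) = ln (cmod y) + ?e * measure cgauss ?S"
  proof -
    have i1: "integrable cgauss (\<lambda>z. ?e * indicator ?S z)"
      by (intro integrable_mult_right integrable_real_indicator) (auto simp: cgauss.emeasure_eq_measure)
    show ?thesis
      by (subst Bochner_Integration.integral_add[OF _ i1]) (use cgauss.prob_space in auto)
  qed
  ultimately show ?thesis using measure_cgauss_tail[of "X + 1"] X0 by simp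
qed

lemma exp_le_quadratic: "exp x \<le> 1 + x + x\<^sup>2 * exp \<bar>x\<bar>" for x :: real
proof (cases "0 \<le> x")
  case True
  have "(1 - x) * exp x \<le> exp (- x) * exp x" using exp_ge_add_one_self[of "-x"] by (intro mult_right_mono) auto
  then have "(1 - x) * exp x \<le> 1" by (simp add: exp_minus)
  then have "exp x - 1 \<le> x * exp x" by (simp add: algebra_simps)
  then have "x * (exp x - 1) \<le> x * (x * exp x)" using True by (rule mult_left_mono)
  moreover have "exp x - 1 - x \<le> x * (exp x - 1)" using \<open>exp x - 1 \<le> x * exp x\<close> by (simp add: algebra_simps)
  ultimately show ?thesis using True by (simp add: power2_eq_square mult.assoc)
next
  case False
  define y where "y = - x"
  have y: "0 < y" using False by (simp add: y_def)
  have "(1 + y) * exp (- y) \<le> exp y * exp (- y)" by (intro mult_right_mono) (auto intro: exp_ge_add_one_self)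
  then have "(1 + y) * exp (- y) \<le> 1" by (simp add: exp_minus)
  then have "exp (- y) - 1 + y \<le> y * (1 - exp (- y))" by (simp add: algebra_simps)
  also have "\<dots> \<le> y * y" using y exp_ge_add_one_self[of "-y"] by (intro mult_left_mono) auto
  also have "\<dots> \<le> y\<^sup>2 * exp y" using y by (simp add: power2_eq_square)
  finally show ?thesis using False by (simp add: y_def)
qed

text \<open>\<open>D\<close> will have a logarithmic singularity, so no bound on
  \<open>cmod D\<close> is available, but \<open>exp D\<close> and \<open>exp (- D)\<close> are
  integrable. Taking \<open>l\<close> at most \<open>1/2\<close> leaves a factor
  \<open>exp (\<bar>D\<bar> / 2)\<close> to absorb \<open>D\<^sup>2\<close>, which is at most
  \<open>8 * exp (\<bar>D\<bar> / 2)\<close>; hence the constant 8.\<close>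

lemma exp_scaled_le:
  fixes D l :: real
  assumes "0 \<le> l" "l \<le> 1/2"
  shows "exp (l * D) \<le> 1 + l * D + 8 * l\<^sup>2 * (exp D + exp (- D))"
proof -
  define t where "t = \<bar>D\<bar> / 2"
  have t: "0 \<le> t" by (simp add: t_def)
  have "1 + t + t\<^sup>2 / 2 \<le> exp t" using t by (rule exp_lower_Taylor_quadratic)
  then have "t\<^sup>2 \<le> 2 * exp t" using t by linarith
  then have D2: "D\<^sup>2 \<le> 8 * exp t" by (simp add: t_def power_divide)
  have "\<bar>l * D\<bar> \<le> t" using mult_right_mono[OF assms(2), of "\<bar>D\<bar>"] assms(1) by (simp add: t_def abs_mult)
  then have "(l * D)\<^sup>2 * exp \<bar>l * D\<bar> \<le> l\<^sup>2 * (8 * exp t) * exp t"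
    unfolding power_mult_distrib using D2 by (intro mult_mono mult_left_mono) auto
  also have "\<dots> = 8 * l\<^sup>2 * exp \<bar>D\<bar>" by (simp add: t_def exp_add[symmetric])
  also have "\<dots> \<le> 8 * l\<^sup>2 * (exp D + exp (- D))" by (intro mult_left_mono) (auto simp: abs_if)
  finally show ?thesis using exp_le_quadratic[of "l * D"] by linarith
qed

text \<open>The outer 8 comes from \<open>exp_scaled_le\<close>; \<open>8 * exp 2\<close> and
  \<open>1 + 2 * exp 8\<close> bound the means of \<open>exp D\<close> and \<open>exp (- D)\<close>
  for \<open>D = log_potential y - ln (cmod (y + z))\<close>.\<close>

definition log_var_const :: real where
  "log_var_const = 8 * (8 * exp 2 + (1 + 2 * exp 8))"

text \<open>Uniformity in \<open>y\<close> matters, because \<open>y\<close> will be a random and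
  unbounded value. The linear term has nonpositive mean. In the quadratic term the growth
  \<open>exp u \<le> (1 + cmod y) * exp 2\<close> is cancelled by the decay of the mean of
  \<open>1 / cmod (y + z)\<close>, and \<open>exp (- u) * cmod y \<le> 1\<close> together with
  \<open>- 8 \<le> u\<close> controls the other half.\<close>

lemma log_potential_exponential_moment:
  assumes l: "0 \<le> l" "l \<le> 1/2"
  shows "(\<integral>\<^sup>+z. ennreal (exp (l * (log_potential y - ln (cmod (y + z))))) \<partial>cgauss) \<le> ennreal (exp (log_var_const * l\<^sup>2))"
proof -
  define u where "u = log_potential y"
  let ?D = "\<lambda>z. u - ln (cmod (y + z))"
  let ?R = "\<lambda>z. 1 + l * ?D z + 8 * l\<^sup>2 * (exp u * (1 / cmod (y + z)) + exp (- u) * (cmod y + cmod z))"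
  have iR: "integrable cgauss ?R"
    using integrable_ln_norm[of y] cgauss_norm cgauss_inverse_norm[of y]
    by (intro Bochner_Integration.integrable_add Bochner_Integration.integrable_diff integrable_mult_right) auto
  have le: "exp (l * ?D z) \<le> ?R z" if "z \<noteq> - y" for z
  proof -
    have p: "0 < cmod (y + z)" using that by (simp add: add_eq_0_iff)
    have "exp (?D z) = exp u * (1 / cmod (y + z))" using p by (simp add: exp_diff)
    moreover have "exp (- ?D z) = exp (- u) * cmod (y + z)" using p by (simp add: exp_diff exp_minus field_simps)
    moreover have "exp (- u) * cmod (y + z) \<le> exp (- u) * (cmod y + cmod z)"
      by (intro mult_left_mono norm_triangle_ineq) auto
    ultimately have "exp (?D z) + exp (- ?D z) \<le> exp u * (1 / cmod (y + z)) + exp (- u) * (cmod y + cmod z)" by linarith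
    then have "8 * l\<^sup>2 * (exp (?D z) + exp (- ?D z)) \<le> 8 * l\<^sup>2 * (exp u * (1 / cmod (y + z)) + exp (- u) * (cmod y + cmod z))"
      by (intro mult_left_mono) auto
    then show ?thesis using exp_scaled_le[OF l, of "?D z"] by linarith
  qed
  have ae: "AE z in cgauss. exp (l * ?D z) \<le> ?R z"
    using AE_cgauss_ne[of "-y"] by eventually_elim (rule le)
  then have aeR: "AE z in cgauss. 0 \<le> ?R z"
    by eventually_elim (rule order_trans[OF less_imp_le[OF exp_gt_zero]])
  have "(\<integral>\<^sup>+z. ennreal (exp (l * ?D z)) \<partial>cgauss) \<le> (\<integral>\<^sup>+z. ennreal (?R z) \<partial>cgauss)"
  proof (rule nn_integral_mono_AE)
    show "AE z in cgauss. ennreal (exp (l * ?D z)) \<le> ennreal (?R z)"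
      using ae by eventually_elim (rule ennreal_leI)
  qed
  also have "\<dots> = ennreal (integral\<^sup>L cgauss ?R)" by (rule nn_integral_eq_integral[OF iR aeR])
  also have "\<dots> \<le> ennreal (exp (log_var_const * l\<^sup>2))"
  proof (rule ennreal_leI)
    have "integral\<^sup>L cgauss ?R = 1 + l * (u - (\<integral>z. ln (cmod (y + z)) \<partial>cgauss))
      + 8 * l\<^sup>2 * (exp u * (\<integral>z. 1 / cmod (y + z) \<partial>cgauss) + exp (- u) * (cmod y + (\<integral>z. cmod z \<partial>cgauss)))"
    proof (rule has_bochner_integral_integral_eq)
      have c: "has_bochner_integral cgauss (\<lambda>z. c) c" for c :: real
        using cgauss.prob_space by (simp add: has_bochner_integral_iff)
      show "has_bochner_integral cgauss ?R (1 + l * (u - (\<integral>z. ln (cmod (y + z)) \<partial>cgauss))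
        + 8 * l\<^sup>2 * (exp u * (\<integral>z. 1 / cmod (y + z) \<partial>cgauss) + exp (- u) * (cmod y + (\<integral>z. cmod z \<partial>cgauss))))"
        by (intro has_bochner_integral_add has_bochner_integral_diff has_bochner_integral_mult_right c
          has_bochner_integral_integrable integrable_ln_norm cgauss_norm cgauss_inverse_norm)
    qed
    also have "\<dots> \<le> 1 + 0 + 8 * l\<^sup>2 * (8 * exp 2 + (1 + 2 * exp 8))"
    proof (intro add_mono mult_left_mono)
      show "l * (u - (\<integral>z. ln (cmod (y + z)) \<partial>cgauss)) \<le> 0"
        using l log_potential_le_expectation[of y] by (intro mult_nonneg_nonpos) (auto simp: u_def)
      have "exp u \<le> exp (ln (1 + cmod y) + 2)" using log_potential_upper[of y] by (simp add: u_def)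
      also have "\<dots> = (1 + cmod y) * exp 2" by (simp add: exp_add add_pos_nonneg)
      finally have "exp u * (\<integral>z. 1 / cmod (y + z) \<partial>cgauss) \<le> (1 + cmod y) * exp 2 * (\<integral>z. 1 / cmod (y + z) \<partial>cgauss)"
        by (intro mult_right_mono Bochner_Integration.integral_nonneg) auto
      also have "\<dots> = exp 2 * ((1 + cmod y) * (\<integral>z. 1 / cmod (y + z) \<partial>cgauss))" by (simp only: mult_ac)
      also have "\<dots> \<le> exp 2 * 8" by (intro mult_left_mono cgauss_inverse_norm) auto
      finally show "exp u * (\<integral>z. 1 / cmod (y + z) \<partial>cgauss) \<le> 8 * exp 2" by (simp add: mult.commute)
      have 1: "exp (- u) * cmod y \<le> 1"
      proof (cases "y = 0")
        case False
        then have "exp (ln (cmod y)) \<le> exp u" using log_potential_lower(2)[of y] by (simp add: u_def del: exp_ln)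
        then show ?thesis using False by (simp add: exp_minus field_simps)
      qed simp
      have "exp (- u) * (\<integral>z. cmod z \<partial>cgauss) \<le> exp 8 * 2"
        using log_potential_lower(1)[of y] cgauss_norm by (intro mult_mono) (auto simp: u_def)
      then show "exp (- u) * (cmod y + (\<integral>z. cmod z \<partial>cgauss)) \<le> 1 + 2 * exp 8"
        using 1 by (simp add: distrib_left)
    qed auto
    also have "\<dots> \<le> exp (log_var_const * l\<^sup>2)"
    proof -
      have "8 * l\<^sup>2 * (8 * exp 2 + (1 + 2 * exp 8)) = log_var_const * l\<^sup>2"
        unfolding log_var_const_def by (simp only: mult_ac)
      then show ?thesis using exp_ge_add_one_self[of "log_var_const * l\<^sup>2"] by linarith
    qed
    finally show "integral\<^sup>L cgauss ?R \<le> exp (log_var_const * l\<^sup>2)" .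
  qed
  finally show ?thesis by (simp add: u_def)
qed

section \<open>The hole event\<close>

abbreviation (input) coord :: "nat \<Rightarrow> (nat \<Rightarrow> complex) \<Rightarrow> complex" where
  "coord n x \<equiv> x n"

abbreviation gseq :: "(nat \<Rightarrow> complex) measure" where
  "gseq \<equiv> gprod UNIV"

lemma gaf_eq_eval_fps: "gaf \<zeta> a \<omega> = eval_fps (Abs_fps (\<lambda>n. \<zeta> n \<omega> * of_real (a n)))"
  by (simp add: gaf_def eval_fps_def fun_eq_iff)

lemma gaf_summable:
  assumes "conv_radius (\<lambda>n. \<zeta> n \<omega> * of_real (a n)) \<ge> 1" "cmod z < 1"
  shows "summable (\<lambda>n. \<zeta> n \<omega> * of_real (a n) * z ^ n)"
proof (rule summable_in_conv_radius)
  have "ereal (cmod z) < 1" using assms(2) by simp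
  then show "ereal (cmod z) < conv_radius (\<lambda>n. \<zeta> n \<omega> * of_real (a n))" using assms(1) by (rule order.strict_trans2)
qed

lemma gaf_holomorphic:
  assumes "conv_radius (\<lambda>n. \<zeta> n \<omega> * of_real (a n)) \<ge> 1"
  shows "gaf \<zeta> a \<omega> holomorphic_on ball 0 1"
proof -
  have lt: "ereal (cmod z) < conv_radius (\<lambda>n. \<zeta> n \<omega> * of_real (a n))" if "cmod z < 1" for z
  proof -
    have "ereal (cmod z) < 1" using that by simp
    then show ?thesis using assms by (rule order.strict_trans2)
  qed
  show ?thesis unfolding gaf_eq_eval_fps
    by (rule holomorphic_on_eval_fps) (auto simp: fps_conv_radius_def in_eball_iff lt)
qed

lemma gaf_continuous:
  assumes "conv_radius (\<lambda>n. \<zeta> n \<omega> * of_real (a n)) \<ge> 1" "r < 1"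
  shows "continuous_on (cball 0 r) (gaf \<zeta> a \<omega>)"
  by (rule continuous_on_subset[OF holomorphic_on_imp_continuous_on[OF gaf_holomorphic[of \<zeta> \<omega> a, OF assms(1)]]])
    (use assms in auto)

lemma gaf_0: "gaf \<zeta> a \<omega> 0 = \<zeta> 0 \<omega> * of_real (a 0)"
proof -
  have "(\<lambda>n. \<zeta> n \<omega> * of_real (a n) * 0 ^ n) sums (\<Sum>n\<in>{0}. \<zeta> n \<omega> * of_real (a n) * 0 ^ n)"
    by (rule sums_finite) auto
  then show ?thesis unfolding gaf_def by (simp add: sums_iff)
qed

text \<open>Recasts the convergence condition as a bound on a limsup of measurable functions, for
  the measurability of the hole event.\<close>

lemma conv_radius_ge_1_iff:
  fixes f :: "nat \<Rightarrow> complex"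
  shows "conv_radius f \<ge> 1 \<longleftrightarrow> limsup (\<lambda>n. ereal (root n (norm (f n)))) \<le> 1"
proof -
  let ?l = "limsup (\<lambda>n. ereal (root n (norm (f n))))"
  have "0 \<le> ?l" by (rule le_Limsup) (auto intro!: always_eventually real_root_ge_zero)
  then show ?thesis unfolding conv_radius_def
    by (cases ?l) (auto simp: one_ereal_def divide_simps split: if_splits)
qed

text \<open>On the compact disc a continuous function without zeros is bounded below, so being
  zero-free is equivalent to a bound \<open>1 / Suc k\<close> on a countable dense subset for some
  \<open>k\<close>. The assumption \<open>r < 1\<close> supplies continuity up to the boundary
  circle.\<close>

lemma Hole_measurable:
  assumes r: "r < 1"
  shows "Hole gseq coord a r \<in> sets gseq"
proof -
  obtain D where D: "countable D" "D \<subseteq> cball (0::complex) r" "cball 0 r \<subseteq> closure D"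
    by (rule separable)
  have m [measurable]: "(\<lambda>x. gaf coord a x z) \<in> borel_measurable gseq" for z
    unfolding gaf_def by measurable
  have root_m [measurable]: "(\<lambda>x::real. root n x) \<in> borel_measurable borel" for n
    by (intro borel_measurable_continuous_onI continuous_intros)
  have [measurable]: "Measurable.pred gseq (\<lambda>x. \<forall>z\<in>D. 1 / real (Suc k) \<le> cmod (gaf coord a x z))" for k
  proof -
    have "(\<Union>z\<in>D. {x\<in>space gseq. \<not> 1 / real (Suc k) \<le> cmod (gaf coord a x z)}) \<in> sets gseq"
      by (rule sets.countable_UN'[OF D(1)]) (rule image_subsetI, measurable)
    then have "space gseq - (\<Union>z\<in>D. {x\<in>space gseq. \<not> 1 / real (Suc k) \<le> cmod (gaf coord a x z)}) \<in> sets gseq"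
      by auto
    also have "space gseq - (\<Union>z\<in>D. {x\<in>space gseq. \<not> 1 / real (Suc k) \<le> cmod (gaf coord a x z)})
      = {x\<in>space gseq. \<forall>z\<in>D. 1 / real (Suc k) \<le> cmod (gaf coord a x z)}" by auto
    finally show ?thesis by (simp add: pred_def)
  qed
  have "{x\<in>space gseq. limsup (\<lambda>n. ereal (root n (norm (x n * of_real (a n))))) \<le> 1 \<and>
      (\<exists>k. \<forall>z\<in>D. 1 / real (Suc k) \<le> cmod (gaf coord a x z))} \<in> sets gseq"
    by measurable
  also have "{x\<in>space gseq. limsup (\<lambda>n. ereal (root n (norm (x n * of_real (a n))))) \<le> 1 \<and>
      (\<exists>k. \<forall>z\<in>D. 1 / real (Suc k) \<le> cmod (gaf coord a x z))} = Hole gseq coord a r"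
  proof -
    have "(\<exists>k. \<forall>z\<in>D. 1 / real (Suc k) \<le> cmod (gaf coord a x z)) \<longleftrightarrow> (\<forall>z. cmod z \<le> r \<longrightarrow> gaf coord a x z \<noteq> 0)"
      if x: "conv_radius (\<lambda>n. x n * of_real (a n)) \<ge> 1" for x
    proof
      have cont: "continuous_on (cball 0 r) (\<lambda>z. cmod (gaf coord a x z))"
        using gaf_continuous[of coord x a, OF x r] by (intro continuous_intros)
      {
        assume "\<exists>k. \<forall>z\<in>D. 1 / real (Suc k) \<le> cmod (gaf coord a x z)"
        then obtain k where k: "\<And>z. z \<in> D \<Longrightarrow> 1 / real (Suc k) \<le> cmod (gaf coord a x z)" by auto
        have "closed {z\<in>cball 0 r. 1 / real (Suc k) \<le> cmod (gaf coord a x z)}"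
          using continuous_closed_preimage[OF cont closed_cball, of "{1 / real (Suc k)..}"]
          by (simp add: vimage_def Int_def)
        then have "closure D \<subseteq> {z\<in>cball 0 r. 1 / real (Suc k) \<le> cmod (gaf coord a x z)}"
          using D(2) k by (intro closure_minimal) auto
        then have ge: "1 / real (Suc k) \<le> cmod (gaf coord a x z)" if "cmod z \<le> r" for z
          using D(3) that by (auto simp: subset_iff)
        show "\<forall>z. cmod z \<le> r \<longrightarrow> gaf coord a x z \<noteq> 0"
        proof (intro allI impI notI)
          fix z assume "cmod z \<le> r" "gaf coord a x z = 0"
          then have "1 / real (Suc k) \<le> 0" using ge[of z] by simp
          then show False by (simp add: divide_le_0_iff)
        qed
      next
        assume nz: "\<forall>z. cmod z \<le> r \<longrightarrow> gaf coord a x z \<noteq> 0"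
        show "\<exists>k. \<forall>z\<in>D. 1 / real (Suc k) \<le> cmod (gaf coord a x z)"
        \<comment> \<open>For negative \<open>r\<close> the disc is empty and there is no minimum
          point to choose.\<close>
        proof (cases "cball (0::complex) r = {}")
          case True then show ?thesis using D(2) by auto
        next
          case False
          obtain w where w: "w \<in> cball 0 r" "\<And>z. z \<in> cball 0 r \<Longrightarrow> cmod (gaf coord a x w) \<le> cmod (gaf coord a x z)"
            using continuous_attains_inf[OF compact_cball False cont] by (elim bexE) simp
          have "0 < cmod (gaf coord a x w)" using nz w(1) by simp
          then obtain k where "inverse (real (Suc k)) < cmod (gaf coord a x w)"
            using reals_Archimedean by blast
          then have k: "1 / real (Suc k) \<le> cmod (gaf coord a x w)" by (simp add: inverse_eq_divide)
          have "\<forall>z\<in>D. 1 / real (Suc k) \<le> cmod (gaf coord a x z)"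
            using order_trans[OF k w(2)] D(2) by blast
          then show ?thesis ..
        qed
      }
    qed
    then show ?thesis unfolding Hole_def conv_radius_ge_1_iff[symmetric] by auto
  qed
  finally show ?thesis .
qed

lemma measure_Hole_eq_canonical:
  fixes M :: "'w measure" and \<zeta> :: "nat \<Rightarrow> 'w \<Rightarrow> complex"
  assumes "prob_space M" and ind: "prob_space.indep_vars M (\<lambda>_. borel) \<zeta> UNIV"
    and g: "\<And>n. std_complex_gaussian M (\<zeta> n)" and r: "r < 1"
  shows "measure M (Hole M \<zeta> a r) = measure gseq (Hole gseq coord a r)"
proof -
  interpret prob_space M by fact
  have rv [measurable]: "\<zeta> n \<in> borel_measurable M" for n
    using g[of n] unfolding std_complex_gaussian_def by (auto dest: distributed_measurable)
  have d: "distr M borel (\<zeta> n) = cgauss" for n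
  proof -
    have "distr M borel (\<zeta> n) = distr M lborel (\<zeta> n)" by (rule distr_cong) auto
    also have "\<dots> = cgauss"
      using g[of n] unfolding std_complex_gaussian_def cgauss_def by (rule distributed_distr_eq_density)
    finally show ?thesis .
  qed
  have "distr M (PiM UNIV (\<lambda>_. borel)) (\<lambda>\<omega>. \<lambda>n\<in>UNIV. \<zeta> n \<omega>) = PiM UNIV (\<lambda>n. distr M borel (\<zeta> n))"
    using ind by (subst (asm) indep_vars_iff_distr_eq_PiM) auto
  then have D: "gseq = distr M gseq (\<lambda>\<omega> n. \<zeta> n \<omega>)"
    unfolding d by (subst (asm) distr_cong[OF refl sets_gprod[symmetric] refl]) (simp add: restrict_def)
  have T: "(\<lambda>\<omega> n. \<zeta> n \<omega>) \<in> measurable M gseq"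
    by (rule measurable_PiM_single') auto
  have "measure gseq (Hole gseq coord a r) = measure (distr M gseq (\<lambda>\<omega> n. \<zeta> n \<omega>)) (Hole gseq coord a r)"
    using D by simp
  also have "\<dots> = measure M ((\<lambda>\<omega> n. \<zeta> n \<omega>) -` Hole gseq coord a r \<inter> space M)"
    by (rule measure_distr[OF T Hole_measurable[OF r]])
  also have "(\<lambda>\<omega> n. \<zeta> n \<omega>) -` Hole gseq coord a r \<inter> space M = Hole M \<zeta> a r"
    by (auto simp: Hole_def gaf_def space_gprod)
  finally show ?thesis ..
qed

text \<open>Replacing finitely many coordinates by sums of independent Gaussians with total variance
  1 does not change the law of the sequence. Equality is checked on finite-dimensional cylinders,
  first conditionally on the second component.\<close>

lemma distr_gaussian_splitting:
  fixes \<alpha> \<beta> :: "nat \<Rightarrow> real"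
  assumes I: "finite I" and ab: "\<And>n. n \<in> I \<Longrightarrow> (\<alpha> n)\<^sup>2 + (\<beta> n)\<^sup>2 = 1"
  defines "T \<equiv> \<lambda>p n. if n \<in> I then of_real (\<alpha> n) * fst p n + of_real (\<beta> n) * snd p n else fst p n"
  shows "distr (gseq \<Otimes>\<^sub>M gprod I) gseq T = gseq" and "T \<in> measurable (gseq \<Otimes>\<^sub>M gprod I) gseq"
proof -
  show Tm [measurable]: "T \<in> measurable (gseq \<Otimes>\<^sub>M gprod I) gseq"
  proof (rule measurable_PiM_single')
    fix n show "(\<lambda>p. T p n) \<in> measurable (gseq \<Otimes>\<^sub>M gprod I) cgauss"
      unfolding T_def by (cases "n \<in> I") auto
  qed auto
  interpret P: pair_sigma_finite gseq "gprod I" ..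
  show "distr (gseq \<Otimes>\<^sub>M gprod I) gseq T = gseq"
  proof (rule gp.PiM_eq)
    fix J :: "nat set" and F assume J: "finite J" "J \<subseteq> UNIV" and "\<And>j. j \<in> J \<Longrightarrow> F j \<in> sets cgauss"
    then have F [measurable]: "\<And>j. j \<in> J \<Longrightarrow> F j \<in> sets borel" by simp
    let ?C = "prod_emb UNIV (\<lambda>_. cgauss) J (\<Pi>\<^sub>E j\<in>J. F j)"
    have C: "?C = {x\<in>space gseq. \<forall>j\<in>J. x j \<in> F j}"
      by (auto simp: prod_emb_def space_PiM Pi_iff)
    have Cm [measurable]: "?C \<in> sets gseq" unfolding C using J by measurable
    define G where "G y j = {a. T (\<lambda>_. a, y) j \<in> F j}" for y and j :: nat
    \<comment> \<open>Coordinate \<open>j\<close> of \<open>T (x, y)\<close> depends on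
      \<open>x\<close> only through \<open>x j\<close>, so for fixed \<open>y\<close> a cylinder
      pulls back to a cylinder.\<close>
    have Tc: "T (x, y) j = T (\<lambda>_. x j, y) j" for x y j by (simp add: T_def)
    define g where "g j w = emeasure cgauss {a. of_real (\<alpha> j) * a + of_real (\<beta> j) * w \<in> F j}" for j w
    have GI: "emeasure cgauss (G y j) = (if j \<in> I then g j (y j) else emeasure cgauss (F j))" for y j
      by (simp add: G_def T_def g_def)
    have gnn: "g j w = (\<integral>\<^sup>+a. indicator (F j) (of_real (\<alpha> j) * a + of_real (\<beta> j) * w) \<partial>cgauss)" if "j \<in> J" for j w
    proof -
      have [measurable]: "F j \<in> sets borel" using F that by auto
      have "(\<integral>\<^sup>+a. indicator (F j) (of_real (\<alpha> j) * a + of_real (\<beta> j) * w) \<partial>cgauss)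
        = (\<integral>\<^sup>+a. indicator {a. of_real (\<alpha> j) * a + of_real (\<beta> j) * w \<in> F j} a \<partial>cgauss)"
        by (intro nn_integral_cong) (auto split: split_indicator)
      also have "\<dots> = g j w" unfolding g_def by (rule nn_integral_indicator) measurable
      finally show ?thesis ..
    qed
    have gm: "g j \<in> borel_measurable borel" if "j \<in> J" for j
    proof -
      have [measurable]: "F j \<in> sets borel" using F that by auto
      have "(\<lambda>w. \<integral>\<^sup>+a. indicator (F j) (of_real (\<alpha> j) * a + of_real (\<beta> j) * w) \<partial>cgauss) \<in> borel_measurable borel"
        by measurable
      then show ?thesis using gnn[OF that] by (simp add: fun_eq_iff[symmetric] cong: measurable_cong)
    qed
    have gm2: "(\<lambda>w. if j \<in> J then g j w else 1) \<in> borel_measurable cgauss" for j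
      using gm[of j] by (cases "j \<in> J") (simp_all add: measurable_cong_sets[OF sets_cgauss refl])
    have gint: "(\<integral>\<^sup>+w. g j w \<partial>cgauss) = emeasure cgauss (F j)" if "j \<in> J" "j \<in> I" for j
    proof -
      have [measurable]: "F j \<in> sets borel" using F that by auto
      have "(\<integral>\<^sup>+w. g j w \<partial>cgauss) = (\<integral>\<^sup>+w. \<integral>\<^sup>+a. indicator (F j) (of_real (\<alpha> j) * a + of_real (\<beta> j) * w) \<partial>cgauss \<partial>cgauss)"
        using gnn[OF that(1)] by simp
      also have "\<dots> = (\<integral>\<^sup>+a. indicator (F j) a \<partial>cgauss)"
        by (rule nn_integral_cgauss_sum) (use ab[OF that(2)] in auto)
      finally show ?thesis by simp
    qed
    have "emeasure (distr (gseq \<Otimes>\<^sub>M gprod I) gseq T) ?C = (\<integral>\<^sup>+z. indicator ?C z \<partial>distr (gseq \<Otimes>\<^sub>M gprod I) gseq T)"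
      by simp
    also have "\<dots> = (\<integral>\<^sup>+p. indicator ?C (T p) \<partial>(gseq \<Otimes>\<^sub>M gprod I))"
      by (rule nn_integral_distr) measurable
    also have "\<dots> = (\<integral>\<^sup>+y. \<integral>\<^sup>+x. indicator ?C (T (x, y)) \<partial>gseq \<partial>gprod I)"
      by (rule P.nn_integral_snd[symmetric, where f = "\<lambda>p. indicator ?C (T p)", simplified case_prod_beta]) measurable
    also have "\<dots> = (\<integral>\<^sup>+y. (\<Prod>j\<in>J. emeasure cgauss (G y j)) \<partial>gprod I)"
    proof (rule nn_integral_cong)
      fix y
      have Gm: "G y j \<in> sets cgauss" if "j \<in> J" for j
      proof -
        have [measurable]: "F j \<in> sets borel" using F that by auto
        have "{a \<in> space borel. T (\<lambda>_. a, y) j \<in> F j} \<in> sets borel"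
          unfolding T_def by (cases "j \<in> I") auto
        then show ?thesis by (simp add: G_def)
      qed
      have "(\<integral>\<^sup>+x. indicator ?C (T (x, y)) \<partial>gseq) = (\<integral>\<^sup>+x. indicator {x\<in>space gseq. \<forall>j\<in>J. x j \<in> G y j} x \<partial>gseq)"
      proof (rule nn_integral_cong)
        fix x
        have "T (x, y) j \<in> F j \<longleftrightarrow> x j \<in> G y j" for j unfolding G_def mem_Collect_eq by (subst Tc) simp
        then show "indicator ?C (T (x, y)) = (indicator {x\<in>space gseq. \<forall>j\<in>J. x j \<in> G y j} x :: ennreal)"
          unfolding C by (auto simp: space_gprod split: split_indicator)
      qed
      also have "\<dots> = emeasure gseq {x\<in>space gseq. \<forall>j\<in>J. x j \<in> G y j}"
        by (rule nn_integral_indicator) (use J Gm in auto)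
      also have "\<dots> = (\<Prod>j\<in>J. emeasure cgauss (G y j))"
        by (rule gp.emeasure_PiM_Collect) (use J Gm in auto)
      finally show "(\<integral>\<^sup>+x. indicator ?C (T (x, y)) \<partial>gseq) = (\<Prod>j\<in>J. emeasure cgauss (G y j))" .
    qed
    also have "\<dots> = (\<integral>\<^sup>+y. (\<Prod>j\<in>J - I. emeasure cgauss (F j)) * (\<Prod>j\<in>I. if j \<in> J then g j (y j) else 1) \<partial>gprod I)"
    proof (rule nn_integral_cong)
      fix y
      have "(\<Prod>j\<in>J. emeasure cgauss (G y j)) = (\<Prod>j\<in>J - I. emeasure cgauss (G y j)) * (\<Prod>j\<in>J \<inter> I. emeasure cgauss (G y j))"
        using J(1) by (subst prod.Int_Diff[of J _ I]) (auto simp: mult.commute)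
      also have "(\<Prod>j\<in>J \<inter> I. emeasure cgauss (G y j)) = (\<Prod>j\<in>I. if j \<in> J then g j (y j) else 1)"
        using I by (subst prod.inter_restrict[symmetric]) (auto simp: GI Int_commute intro!: prod.cong)
      finally show "(\<Prod>j\<in>J. emeasure cgauss (G y j)) = (\<Prod>j\<in>J - I. emeasure cgauss (F j)) * (\<Prod>j\<in>I. if j \<in> J then g j (y j) else 1)"
        by (simp add: GI)
    qed
    also have "\<dots> = (\<Prod>j\<in>J - I. emeasure cgauss (F j)) * (\<integral>\<^sup>+y. (\<Prod>j\<in>I. (\<lambda>j w. if j \<in> J then g j w else 1) j (y j)) \<partial>gprod I)"
      by (rule nn_integral_cmult) (use I gm2 in \<open>auto intro!: borel_measurable_prod_ennreal measurable_compose[OF measurable_component_singleton]\<close>)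
    also have "(\<integral>\<^sup>+y. (\<Prod>j\<in>I. (\<lambda>j w. if j \<in> J then g j w else 1) j (y j)) \<partial>gprod I) = (\<Prod>j\<in>I. \<integral>\<^sup>+w. (\<lambda>j w. if j \<in> J then g j w else 1) j w \<partial>cgauss)"
      by (rule gp.product_nn_integral_prod) (use I gm2 in auto)
    also have "\<dots> = (\<Prod>j\<in>I. if j \<in> J then emeasure cgauss (F j) else 1)"
      by (intro prod.cong refl) (auto simp: gint cgauss.emeasure_space_1[simplified])
    also have "\<dots> = (\<Prod>j\<in>J \<inter> I. emeasure cgauss (F j))"
      using I by (subst prod.inter_restrict[symmetric]) (auto simp: Int_commute)
    also have "(\<Prod>j\<in>J - I. emeasure cgauss (F j)) * (\<Prod>j\<in>J \<inter> I. emeasure cgauss (F j)) = (\<Prod>j\<in>J. emeasure cgauss (F j))"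
      using J(1) by (subst prod.Int_Diff[of J _ I]) (auto simp: mult.commute)
    finally show "emeasure (distr (gseq \<Otimes>\<^sub>M gprod I) gseq T) ?C = (\<Prod>j\<in>J. emeasure cgauss (F j))" .
  qed simp
qed

section \<open>Upper bound for the hole probability\<close>

lemma cis_measurable [measurable]: "cis \<in> borel_measurable borel"
  by (intro borel_measurable_continuous_onI continuous_intros)

text \<open>For each fixed \<open>z\<close> the truncated logarithm
  \<open>ln (max (cmod f) (cmod z))\<close> satisfies the mean inequality. Averaging over
  \<open>z\<close> and exchanging the integrals gives it for the potential.\<close>

lemma log_potential_circle_mean:
  assumes cont: "continuous_on (cball 0 r) f" and hol: "f holomorphic_on ball 0 r" and r: "0 < r"
  shows "log_potential (f 0) \<le> (\<integral>\<theta>. log_potential (f (rcis r \<theta>)) \<partial>circ)"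
proof -
  interpret P: pair_sigma_finite cgauss circ ..
  have "continuous_on UNIV (\<lambda>\<theta>. f (rcis r \<theta>))"
    unfolding rcis_def by (intro continuous_on_compose2[OF cont] continuous_intros) (use r in \<open>auto simp: norm_mult\<close>)
  then have m [measurable]: "(\<lambda>\<theta>. f (rcis r \<theta>)) \<in> borel_measurable borel" by (rule borel_measurable_continuous_onI)
  have "bounded (f ` cball 0 r)" by (intro compact_imp_bounded compact_continuous_image cont) auto
  then obtain B where "\<And>z. cmod z \<le> r \<Longrightarrow> cmod (f z) \<le> B" unfolding bounded_iff by force
  then have B: "cmod (f (rcis r \<theta>)) \<le> B" for \<theta> using r by simp
  let ?g = "\<lambda>z \<theta>. ln (max (cmod (f (rcis r \<theta>))) (cmod z))"
  have ib: "integrable cgauss (\<lambda>z. B + cmod z + 1 / cmod (0 + z))"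
    using cgauss_norm cgauss_inverse_norm[of 0] by simp
  have B0: "0 \<le> B" by (rule order_trans[OF norm_ge_zero B])
  have i: "integrable (cgauss \<Otimes>\<^sub>M circ) (\<lambda>(z, \<theta>). ?g z \<theta>)"
  proof (rule integrableI_bounded)
    show "(\<lambda>(z, \<theta>). ?g z \<theta>) \<in> borel_measurable (cgauss \<Otimes>\<^sub>M circ)" by measurable
    have "(\<integral>\<^sup>+p. ennreal (norm (case p of (z, \<theta>) \<Rightarrow> ?g z \<theta>)) \<partial>(cgauss \<Otimes>\<^sub>M circ))
      = (\<integral>\<^sup>+\<theta>. \<integral>\<^sup>+z. ennreal \<bar>?g z \<theta>\<bar> \<partial>cgauss \<partial>circ)"
      by (subst P.nn_integral_snd[symmetric]) auto
    also have "\<dots> \<le> (\<integral>\<^sup>+\<theta>. ennreal (\<integral>z. B + cmod z + 1 / cmod (0 + z) \<partial>cgauss) \<partial>circ)"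
    proof (rule nn_integral_mono)
      fix \<theta>
      have "(\<integral>\<^sup>+z. ennreal \<bar>?g z \<theta>\<bar> \<partial>cgauss) \<le> (\<integral>\<^sup>+z. ennreal (B + cmod z + 1 / cmod (0 + z)) \<partial>cgauss)"
      proof (rule nn_integral_mono_AE)
        show "AE z in cgauss. ennreal \<bar>?g z \<theta>\<bar> \<le> ennreal (B + cmod z + 1 / cmod (0 + z))"
          using AE_cgauss_ne[of 0]
        proof eventually_elim
          case (elim z)
          then show ?case
            using abs_ln_max_le[of z "f (rcis r \<theta>)"] B[of \<theta>] by (intro ennreal_leI) simp
        qed
      qed
      also have "\<dots> = ennreal (\<integral>z. B + cmod z + 1 / cmod (0 + z) \<partial>cgauss)"
        by (rule nn_integral_eq_integral[OF ib]) (use B0 in auto)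
      finally show "(\<integral>\<^sup>+z. ennreal \<bar>?g z \<theta>\<bar> \<partial>cgauss) \<le> \<dots>" .
    qed
    also have "\<dots> < \<infinity>" by (simp add: circ.emeasure_space_1[simplified])
    finally show "(\<integral>\<^sup>+p. ennreal (norm (case p of (z, \<theta>) \<Rightarrow> ?g z \<theta>)) \<partial>(cgauss \<Otimes>\<^sub>M circ)) < \<infinity>" .
  qed
  have "log_potential (f 0) \<le> (\<integral>z. (\<integral>\<theta>. ?g z \<theta> \<partial>circ) \<partial>cgauss)"
    unfolding log_potential_def
  proof (rule integral_mono_AE[OF integrable_ln_max P.integrable_fst[OF i]])
    show "AE z in cgauss. ln (max (cmod (f 0)) (cmod z)) \<le> (\<integral>\<theta>. ?g z \<theta> \<partial>circ)"
      using AE_cgauss_ne[of 0]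
    proof eventually_elim
      case (elim z)
      then show ?case by (intro ln_le_circle_mean_ln_max[OF cont hol r]) auto
    qed
  qed
  also have "\<dots> = (\<integral>\<theta>. (\<integral>z. ?g z \<theta> \<partial>cgauss) \<partial>circ)" by (rule P.Fubini_integral[OF i, symmetric])
  finally show ?thesis unfolding log_potential_def .
qed

lemma sum_roots_of_unity:
  assumes N: "1 \<le> N" and jl: "j < N" "l < N"
  defines "w \<equiv> \<lambda>j::nat. cis (2 * pi * of_nat j / of_nat N)"
  shows "(w j * cnj (w l)) ^ N = 1"
    and "(\<Sum>k<N. (w j * cnj (w l)) ^ k) = (if j = l then of_nat N else 0)"
proof -
  have wN: "w i ^ N = 1" for i
  proof -
    have "w i ^ N = cis (2 * pi * of_nat i)" using N unfolding w_def by (subst Complex.DeMoivre) simp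
    then show ?thesis by (metis cis_multiple_2pi Ints_of_nat)
  qed
  have wc: "w i * cnj (w i) = 1" for i by (simp add: w_def cis_cnj cis_mult)
  show 1: "(w j * cnj (w l)) ^ N = 1"
    by (simp add: power_mult_distrib wN complex_cnj_power[symmetric] del: complex_cnj_power)
  show "(\<Sum>k<N. (w j * cnj (w l)) ^ k) = (if j = l then of_nat N else 0)"
  proof (cases "j = l")
    case True then show ?thesis by (simp add: wc)
  next
    case False
    have "w j * cnj (w l) \<noteq> 1"
    proof
      assume "w j * cnj (w l) = 1"
      then have "w j * (cnj (w l) * w l) = w l" by (simp add: mult.assoc[symmetric])
      then have "w j = w l" using wc[of l] by (simp add: mult.commute)
      then have "exp (2 * of_real pi * \<i> * of_nat j / of_nat N) = exp (2 * of_real pi * \<i> * of_nat l / of_nat N)"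
        by (simp add: w_def cis_conv_exp mult_ac)
      then have "j mod N = l mod N" using complex_root_unity_eq[OF N] by blast
      then show False using jl False by simp
    qed
    then show ?thesis using 1 False by (simp add: geometric_sum)
  qed
qed

lemma sum_blocks:
  fixes f :: "nat \<Rightarrow> 'a::comm_monoid_add"
  shows "(\<Sum>n\<in>{N..<(M+1)*N}. f n) = (\<Sum>m=1..M. \<Sum>k<N. f (m * N + k))"
proof (induction M)
  case 0 then show ?case by simp
next
  case (Suc M)
  have "{N..<(Suc M + 1) * N} = {N..<(M+1)*N} \<union> {(M+1)*N..<(M+1)*N + N}" by auto
  then have "(\<Sum>n\<in>{N..<(Suc M+1)*N}. f n) = (\<Sum>n\<in>{N..<(M+1)*N}. f n) + (\<Sum>n\<in>{(M+1)*N..<(M+1)*N + N}. f n)"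
    by (simp only:) (rule sum.union_disjoint, auto)
  also have "(\<Sum>n\<in>{(M+1)*N..<(M+1)*N + N}. f n) = (\<Sum>k<N. f ((M+1)*N + k))"
    using sum.shift_bounds_nat_ivl[of f 0 "(M+1)*N" N] by (simp add: lessThan_atLeast0 add.commute)
  finally show ?case using Suc by simp
qed

lemma log_var_const_ge_1: "1 \<le> log_var_const"
proof -
  define p where "p = 64 * exp 2 + 16 * exp (8::real)"
  have "0 \<le> p" unfolding p_def by (intro add_nonneg_nonneg) auto
  moreover have "log_var_const = 8 + p" by (simp add: log_var_const_def p_def algebra_simps)
  ultimately show ?thesis by linarith
qed

text \<open>\<open>\<beta>\<close> is chosen so that the part split off has coefficients of modulus \<open>Q m\<close>, constant on the
  \<open>m\<close>-th block of length \<open>N\<close>; monotonicity of \<open>a\<close> gives \<open>\<beta> \<le> 1\<close>.\<close>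

lemma hole_probability_upper:
  fixes a :: "nat \<Rightarrow> real" and r A s2 X e :: real and N Mb :: nat
  assumes dec: "decseq a" and apos: "\<And>n. 0 < a n" and a0: "a 0 = 1"
    and r: "0 < r" "r < 1" and N: "1 \<le> N" and Mb: "1 \<le> Mb" and A: "0 \<le> A"
    and s2_def: "s2 = real N * (\<Sum>m=1..Mb. (a ((m+1)*N) * r ^ ((m+1)*N))\<^sup>2)"
    and X_def: "X = A\<^sup>2 / s2" and e_def: "e = exp (- (X + 1)) / (2 * (X + 1))"
  shows "measure gseq (Hole gseq coord a r) \<le> exp (- (A\<^sup>2)) + exp (- (N * e\<^sup>2 / (4 * log_var_const)))"
proof -
  \<comment> \<open>The index \<open>(m+1)*N\<close> is the first one after block \<open>m\<close>,
    so \<open>Q m\<close> is a lower bound for the coefficients throughout the block.\<close>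
  define Q where "Q m = a ((m+1)*N) * r ^ ((m+1)*N)" for m
  have Q: "0 < Q m" for m using apos r by (simp add: Q_def)
  define q where "q n = Q (n div N)" for n
  \<comment> \<open>Block 0 is left out, so the split part vanishes at the origin and
    \<open>F 0\<close>, \<open>F1 0\<close> and \<open>x 0\<close> coincide.\<close>
  define I where "I = {N..<(Mb+1)*N}"
  have fI: "finite I" and I0: "0 \<notin> I" using N by (auto simp: I_def)
  define \<beta> where "\<beta> n = q n / (a n * r ^ n)" for n
  define \<alpha> where "\<alpha> n = sqrt (1 - (\<beta> n)\<^sup>2)" for n
  have \<beta>: "0 \<le> \<beta> n" "\<beta> n \<le> 1" "\<beta> n * a n * r ^ n = q n" for n
  proof -
    have p: "0 < a n * r ^ n" using apos r by simp
    have "n < N + n div N * N" using N by (intro dividend_less_div_times) simp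
    then have n: "n \<le> (n div N + 1) * N" by simp
    have "a ((n div N + 1) * N) \<le> a n" by (rule decseqD[OF dec n])
    moreover have "r ^ ((n div N + 1) * N) \<le> r ^ n" by (rule power_decreasing[OF n]) (use r in auto)
    ultimately have "q n \<le> a n * r ^ n"
      unfolding q_def Q_def by (rule mult_mono) (use r less_imp_le[OF apos] in auto)
    then show "\<beta> n \<le> 1" using p by (simp add: \<beta>_def)
    show "0 \<le> \<beta> n" using p Q by (simp add: \<beta>_def q_def less_imp_le)
    have "a n * r ^ n \<noteq> 0" using p by linarith
    then have "\<beta> n * (a n * r ^ n) = q n"
      unfolding \<beta>_def by (rule nonzero_divide_eq_eq[THEN iffD1, OF _ refl, symmetric])
    then show "\<beta> n * a n * r ^ n = q n" by (simp only: mult.assoc)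
  qed
  have \<alpha>\<beta>: "(\<alpha> n)\<^sup>2 + (\<beta> n)\<^sup>2 = 1" for n
    using \<beta>(1,2)[of n] by (simp add: \<alpha>_def power_le_one)
  have s20: "0 < s2"
    unfolding s2_def Q_def[symmetric] using N Mb by (intro mult_pos_pos sum_pos zero_less_power Q) auto
  define s where "s = sqrt s2"
  have s: "0 < s" "s\<^sup>2 = s2" using s20 by (auto simp: s_def)
  have X0: "0 \<le> X" using s20 by (simp add: X_def)
  have e: "0 < e" "e \<le> 1/2"
  proof -
    show "0 < e" using X0 by (simp add: e_def)
    have "exp (- (X + 1)) / (2 * (X + 1)) \<le> 1 / (2 * 1)"
      using X0 by (intro frac_le) auto
    then show "e \<le> 1/2" by (simp add: e_def)
  qed
  define C where "C = log_var_const"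
  have C: "1 \<le> C" using log_var_const_ge_1 by (simp add: C_def)
  \<comment> \<open>The minimizer of the exponent \<open>- l * N * e + N * C * l\<^sup>2\<close>,
    with minimum \<open>- N * e\<^sup>2 / (4 * C)\<close>.\<close>
  define l where "l = e / (2 * C)"
  have l: "0 \<le> l" "l \<le> 1/2"
  proof -
    show "0 \<le> l" using e C by (simp add: l_def)
    have "e / (2 * C) \<le> (1/2) / (2 * 1)" using e C by (intro frac_le) auto
    then show "l \<le> 1/2" by (simp add: l_def)
  qed
  define w where "w j = cis (2 * pi * of_nat j / of_nat N)" for j :: nat
  have w1: "cmod (w j) = 1" for j by (simp add: w_def)
  \<comment> \<open>The coefficients in \<open>y\<close> of the split part, divided by
    \<open>s\<close>, at the \<open>j\<close>-th point of the grid rotated by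
    \<open>\<theta>\<close>. Within a block only the root of unity varies, so distinct rows are
    orthogonal; \<open>s2\<close> is the common variance.\<close>
  define U where "U \<theta> j n = of_real (q n / s) * (cis \<theta> * w j) ^ n" for \<theta> j n
  have U: "(\<Sum>n\<in>I. U \<theta> j n * cnj (U \<theta> k n)) = (if j = k then 1 else 0)" if jk: "j < N" "k < N" for \<theta> j k
  proof -
    let ?z = "w j * cnj (w k)"
    note roots = sum_roots_of_unity[OF N jk, folded w_def]
    have "U \<theta> j n * cnj (U \<theta> k n) = of_real ((q n)\<^sup>2 / s2) * ?z ^ n" for n
    proof -
      have "U \<theta> j n * cnj (U \<theta> k n) = of_real (q n / s * (q n / s)) * ((cis \<theta> * cnj (cis \<theta>)) * ?z) ^ n"
        by (simp add: U_def power_mult_distrib mult_ac)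
      also have "cis \<theta> * cnj (cis \<theta>) = 1" by (simp add: cis_cnj cis_mult)
      also have "q n / s * (q n / s) = (q n)\<^sup>2 / s2" unfolding s(2)[symmetric] by (simp add: power2_eq_square)
      finally show ?thesis by simp
    qed
    then have "(\<Sum>n\<in>I. U \<theta> j n * cnj (U \<theta> k n)) = (\<Sum>m=1..Mb. \<Sum>i<N. of_real ((q (m * N + i))\<^sup>2 / s2) * ?z ^ (m * N + i))"
      unfolding I_def sum_blocks by simp
    also have "\<dots> = (\<Sum>m=1..Mb. \<Sum>i<N. of_real ((Q m)\<^sup>2 / s2) * ?z ^ i)"
    proof (intro sum.cong refl)
      fix m i assume "i \<in> {..<N}"
      then have "q (m * N + i) = Q m" using N by (simp add: q_def)
      moreover have "?z ^ (m * N + i) = ?z ^ i"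
        using roots(1) by (simp only: power_add power_mult mult.commute[of m N] power_one mult_1)
      ultimately show "of_real ((q (m * N + i))\<^sup>2 / s2) * ?z ^ (m * N + i) = complex_of_real ((Q m)\<^sup>2 / s2) * ?z ^ i" by simp
    qed
    also have "\<dots> = (\<Sum>m=1..Mb. of_real ((Q m)\<^sup>2 / s2)) * (\<Sum>i<N. ?z ^ i)"
      by (simp only: sum_distrib_left[symmetric] sum_distrib_right[symmetric])
    also have "\<dots> = of_real ((\<Sum>m=1..Mb. (Q m)\<^sup>2) / s2) * (if j = k then of_nat N else 0)"
      unfolding roots(2) by (simp add: sum_divide_distrib)
    also have "\<dots> = of_real ((if j = k then real N * (\<Sum>m=1..Mb. (Q m)\<^sup>2) / s2 else 0))" by simp
    also have "real N * (\<Sum>m=1..Mb. (Q m)\<^sup>2) = s2" by (simp add: s2_def Q_def)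
    finally show ?thesis using s20 by simp
  qed
  define T where "T = (\<lambda>p n. if n \<in> I then complex_of_real (\<alpha> n) * fst p n + of_real (\<beta> n) * snd p n else fst p n)"
  have T: "distr (gseq \<Otimes>\<^sub>M gprod I) gseq T = gseq" and Tm [measurable]: "T \<in> measurable (gseq \<Otimes>\<^sub>M gprod I) gseq"
    unfolding T_def by (rule distr_gaussian_splitting[OF fI \<alpha>\<beta>])+
  define c1 where "c1 x n = (if n \<in> I then complex_of_real (\<alpha> n) * x n else x n)" for x n
  have c1m [measurable]: "(\<lambda>x. c1 x n) \<in> borel_measurable gseq" for n
    unfolding c1_def by (cases "n \<in> I") auto
  define f1 where "f1 x \<theta> j = gaf coord a (c1 x) (rcis r \<theta> * w j) / of_real s" for x \<theta> j
  have f1m [measurable]: "(\<lambda>p. f1 (fst p) (snd p) j) \<in> borel_measurable (gseq \<Otimes>\<^sub>M circ)" for j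
    unfolding f1_def gaf_def rcis_def by measurable
  define \<Phi> where "\<Phi> x y \<theta> = ennreal (exp (l * (\<Sum>j<N. log_potential (f1 x \<theta> j) - ln (cmod (f1 x \<theta> j + (\<Sum>n\<in>I. U \<theta> j n * y n))))))" for x y \<theta>
  have \<Phi>m [measurable]: "(\<lambda>p. \<Phi> (fst (fst p)) (snd (fst p)) (snd p)) \<in> borel_measurable ((gseq \<Otimes>\<^sub>M gprod I) \<Otimes>\<^sub>M circ)"
  proof -
    have [measurable]: "(\<lambda>p. f1 (fst (fst p)) (snd p) j) \<in> borel_measurable ((gseq \<Otimes>\<^sub>M gprod I) \<Otimes>\<^sub>M circ)" for j
      using measurable_compose[of "\<lambda>p. (fst (fst p), snd p)" "(gseq \<Otimes>\<^sub>M gprod I) \<Otimes>\<^sub>M circ" "gseq \<Otimes>\<^sub>M circ" "\<lambda>p. f1 (fst p) (snd p) j" borel] f1m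
      by simp
    show ?thesis unfolding \<Phi>_def U_def by measurable
  qed
  define H where "H = Hole gseq coord a r"
  have Hm [measurable]: "H \<in> sets gseq" unfolding H_def by (rule Hole_measurable[OF r(2)])
  define H1 where "H1 = {x\<in>space gseq. x \<in> H \<and> cmod (x 0) \<le> A}"
  have H1m [measurable]: "H1 \<in> sets gseq" unfolding H1_def by measurable
  \<comment> \<open>On the hole event with small \<open>x 0\<close>, the average of
    \<open>\<Phi>\<close> over all rotations of the grid is at least
    \<open>exp (l * (N * e))\<close>. Integrating this over the probability space is an exponential
    Markov inequality.\<close>
  have pointwise: "1 \<le> ennreal (exp (- (l * (N * e)))) * (\<integral>\<^sup>+\<theta>. \<Phi> x y \<theta> \<partial>circ)"
    if xy: "x \<in> space gseq" "y \<in> space (gprod I)" "T (x, y) \<in> H1" for x y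
  proof -
    define F where "F = gaf coord a (T (x, y))"
    define F1 where "F1 = gaf coord a (c1 x)"
    have TH: "T (x, y) \<in> Hole gseq coord a r" "cmod (T (x, y) 0) \<le> A"
      using xy(3) by (auto simp: H1_def H_def)
    have cT: "1 \<le> conv_radius (\<lambda>n. T (x, y) n * of_real (a n))"
      and nz: "\<And>z. cmod z \<le> r \<Longrightarrow> F z \<noteq> 0" using TH(1) by (auto simp: Hole_def F_def)
    \<comment> \<open>Only finitely many coefficients differ, so the radius of convergence is
      unchanged.\<close>
    have "conv_radius (\<lambda>n. c1 x n * complex_of_real (a n)) = conv_radius (\<lambda>n. T (x, y) n * of_real (a n))"
      by (rule conv_radius_cong', rule eventually_mono[OF eventually_ge_at_top[of "(Mb+1)*N"]])
        (auto simp: T_def c1_def I_def)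
    then have c1r: "1 \<le> conv_radius (\<lambda>n. c1 x n * complex_of_real (a n))" using cT by simp
    have T0: "T (x, y) 0 = x 0" "c1 x 0 = x 0" using I0 by (auto simp: T_def c1_def)
    have F0: "F 0 = x 0" "F1 0 = x 0" by (simp_all add: F_def F1_def gaf_0 T0 a0)
    have x0: "x 0 \<noteq> 0" using nz[of 0] r F0 by simp
    have Fz: "F z = F1 z + (\<Sum>n\<in>I. of_real (\<beta> n) * y n * of_real (a n) * z ^ n)" if z: "cmod z < 1" for z
    proof -
      have s1: "summable (\<lambda>n. c1 x n * of_real (a n) * z ^ n)"
        by (rule gaf_summable[of coord "c1 x" a]) (use c1r z in auto)
      have s2: "(\<lambda>n. if n \<in> I then of_real (\<beta> n) * y n * of_real (a n) * z ^ n else 0) sums (\<Sum>n\<in>I. of_real (\<beta> n) * y n * of_real (a n) * z ^ n)"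
        by (rule sums_If_finite_set[OF fI])
      have "(\<lambda>n. c1 x n * of_real (a n) * z ^ n + (if n \<in> I then of_real (\<beta> n) * y n * of_real (a n) * z ^ n else 0))
         sums (F1 z + (\<Sum>n\<in>I. of_real (\<beta> n) * y n * of_real (a n) * z ^ n))"
        unfolding F1_def gaf_def by (rule sums_add[OF summable_sums[OF s1] s2])
      moreover have "c1 x n * of_real (a n) * z ^ n + (if n \<in> I then of_real (\<beta> n) * y n * of_real (a n) * z ^ n else 0)
          = T (x, y) n * of_real (a n) * z ^ n" for n
        by (auto simp: c1_def T_def algebra_simps)
      ultimately show ?thesis unfolding F_def gaf_def by (simp add: sums_iff)
    qed
    define Fj where "Fj j z = F (z * w j) / of_real s" for j z
    define fj where "fj j z = F1 (z * w j) / of_real s" for j z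
    have rot: "continuous_on (cball 0 r) (\<lambda>z. G (z * w j) / of_real s)" "(\<lambda>z. G (z * w j) / of_real s) holomorphic_on ball 0 r"
      if G: "G holomorphic_on ball 0 1" for G j
    proof -
      have cG: "continuous_on (cball 0 r) G"
        by (rule continuous_on_subset[OF holomorphic_on_imp_continuous_on[OF G]]) (use r in auto)
      show "continuous_on (cball 0 r) (\<lambda>z. G (z * w j) / of_real s)"
        by (intro continuous_intros continuous_on_compose2[OF cG]) (use s w1 in \<open>auto simp: norm_mult\<close>)
      have "(\<lambda>z. G (z * w j)) holomorphic_on ball 0 r"
        by (rule holomorphic_on_compose_gen[OF _ G, unfolded comp_def])
          (use r w1 in \<open>auto intro!: holomorphic_intros simp: norm_mult\<close>)
      then show "(\<lambda>z. G (z * w j) / of_real s) holomorphic_on ball 0 r"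
        using s by (intro holomorphic_intros) auto
    qed
    have hF: "F holomorphic_on ball 0 1" "F1 holomorphic_on ball 0 1"
      unfolding F_def F1_def using cT c1r by (auto intro!: gaf_holomorphic)
    note Fjr = rot[OF hF(1), folded Fj_def] and fjr = rot[OF hF(2), folded fj_def]
    have f1j: "f1 x \<theta> j = fj j (rcis r \<theta>)" for \<theta> j by (simp add: f1_def fj_def F1_def)
    have Fjj: "f1 x \<theta> j + (\<Sum>n\<in>I. U \<theta> j n * y n) = Fj j (rcis r \<theta>)" for \<theta> j
    proof -
      have "cmod (rcis r \<theta> * w j) < 1" using r w1 by (simp add: norm_mult)
      from Fz[OF this] have "Fj j (rcis r \<theta>) = f1 x \<theta> j + (\<Sum>n\<in>I. of_real (\<beta> n) * y n * of_real (a n) * (rcis r \<theta> * w j) ^ n / of_real s)"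
        by (simp add: Fj_def f1_def F1_def add_divide_distrib sum_divide_distrib)
      moreover have "of_real (\<beta> n) * y n * of_real (a n) * (rcis r \<theta> * w j) ^ n / of_real s = U \<theta> j n * y n" for n
      proof -
        have "of_real (\<beta> n) * y n * of_real (a n) * (rcis r \<theta> * w j) ^ n / of_real s
          = of_real (\<beta> n * a n * r ^ n) / of_real s * (cis \<theta> * w j) ^ n * y n"
          by (simp add: rcis_def power_mult_distrib)
        also have "\<dots> = U \<theta> j n * y n" unfolding \<beta>(3) by (simp add: U_def)
        finally show ?thesis .
      qed
      ultimately show ?thesis by simp
    qed
    define L where "L j \<theta> = log_potential (fj j (rcis r \<theta>))" for j \<theta>
    define K where "K j \<theta> = ln (cmod (Fj j (rcis r \<theta>)))" for j \<theta>
    have Fjnz: "Fj j z \<noteq> 0" if "cmod z \<le> r" for j z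
      using nz[of "z * w j"] that s w1 by (simp add: Fj_def norm_mult)
    have EL: "log_potential (x 0 / of_real s) \<le> (\<integral>\<theta>. L j \<theta> \<partial>circ)" for j
      using log_potential_circle_mean[OF fjr r(1), of j] by (simp add: L_def fj_def F0)
    have EK: "(\<integral>\<theta>. K j \<theta> \<partial>circ) \<le> ln (cmod (x 0 / of_real s))" for j
      using circle_mean_ln_le[OF Fjr r(1) Fjnz, of j] by (simp add: K_def Fj_def F0)
    have contr: "continuous_on UNIV (\<lambda>\<theta>. G (rcis r \<theta>))" if "continuous_on (cball 0 r) G" for G :: "complex \<Rightarrow> complex"
      unfolding rcis_def by (intro continuous_on_compose2[OF that] continuous_intros) (use r in \<open>auto simp: norm_mult\<close>)
    \<comment> \<open>\<open>L j\<close> is bounded by the two-sided estimates on the potential, and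
      \<open>K j\<close> because it is the logarithm of a continuous function without zeros on a
      compact arc.\<close>
    have "\<exists>B. \<forall>j<N. \<forall>\<theta>\<in>{0..2*pi}. \<bar>L j \<theta> - K j \<theta>\<bar> \<le> B"
    proof -
      have "\<exists>B. \<forall>\<theta>\<in>{0..2*pi}. \<bar>L j \<theta> - K j \<theta>\<bar> \<le> B" for j
      proof -
        have "bounded ((\<lambda>\<theta>. fj j (rcis r \<theta>)) ` {0..2*pi})"
          by (intro compact_imp_bounded compact_continuous_image continuous_on_subset[OF contr[OF fjr(1)]]) auto
        then obtain B1 where B1: "\<And>\<theta>. \<theta> \<in> {0..2*pi} \<Longrightarrow> cmod (fj j (rcis r \<theta>)) \<le> B1" unfolding bounded_iff by force
        have "continuous_on UNIV (\<lambda>\<theta>. K j \<theta>)" unfolding K_def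
          by (intro continuous_intros contr[OF Fjr(1)]) (use Fjnz r in auto)
        then have "bounded (K j ` {0..2*pi})"
          by (intro compact_imp_bounded compact_continuous_image) (auto intro: continuous_on_subset)
        then obtain B2 where B2: "\<And>\<theta>. \<theta> \<in> {0..2*pi} \<Longrightarrow> \<bar>K j \<theta>\<bar> \<le> B2" unfolding bounded_iff by force
        have "\<bar>L j \<theta> - K j \<theta>\<bar> \<le> (8 + B1 + 2) + B2" if \<theta>: "\<theta> \<in> {0..2*pi}" for \<theta>
        proof -
          have "0 \<le> B1" by (rule order_trans[OF norm_ge_zero B1[OF \<theta>]])
          have "L j \<theta> \<le> ln (1 + cmod (fj j (rcis r \<theta>))) + 2" unfolding L_def by (rule log_potential_upper)
          also have "ln (1 + cmod (fj j (rcis r \<theta>))) \<le> cmod (fj j (rcis r \<theta>))" by (rule ln_add_one_self_le_self) simp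
          finally have "L j \<theta> \<le> B1 + 2" using B1[OF \<theta>] by simp
          moreover have "- 8 \<le> L j \<theta>" unfolding L_def by (rule log_potential_lower)
          ultimately have "\<bar>L j \<theta>\<bar> \<le> 8 + B1 + 2" using \<open>0 \<le> B1\<close> by linarith
          then show ?thesis using B2[OF \<theta>] by linarith
        qed
        then show ?thesis by blast
      qed
      then obtain Bf where Bf: "\<And>j \<theta>. \<theta> \<in> {0..2*pi} \<Longrightarrow> \<bar>L j \<theta> - K j \<theta>\<bar> \<le> Bf j" by metis
      have "\<bar>L j \<theta> - K j \<theta>\<bar> \<le> (\<Sum>j<N. \<bar>Bf j\<bar>)" if "j < N" "\<theta> \<in> {0..2*pi}" for j \<theta>
      proof -
        have "\<bar>L j \<theta> - K j \<theta>\<bar> \<le> \<bar>Bf j\<bar>" using Bf[OF that(2), of j] by linarith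
        also have "\<dots> \<le> (\<Sum>j<N. \<bar>Bf j\<bar>)" using that(1) by (intro member_le_sum) auto
        finally show ?thesis .
      qed
      then show ?thesis by blast
    qed
    then obtain B where B: "\<And>j \<theta>. j < N \<Longrightarrow> \<theta> \<in> {0..2*pi} \<Longrightarrow> \<bar>L j \<theta> - K j \<theta>\<bar> \<le> B" by blast
    define \<psi> where "\<psi> \<theta> = (\<Sum>j<N. L j \<theta> - K j \<theta>)" for \<theta>
    have Lm: "L j \<in> borel_measurable borel" and Km: "K j \<in> borel_measurable borel" for j
    proof -
      have [measurable]: "(\<lambda>\<theta>. fj j (rcis r \<theta>)) \<in> borel_measurable borel" "(\<lambda>\<theta>. Fj j (rcis r \<theta>)) \<in> borel_measurable borel"
        by (intro borel_measurable_continuous_onI contr fjr Fjr)+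
      show "L j \<in> borel_measurable borel" "K j \<in> borel_measurable borel" unfolding L_def K_def by measurable
    qed
    note [measurable] = Lm Km
    have \<psi>m [measurable]: "\<psi> \<in> borel_measurable borel" unfolding \<psi>_def by measurable
    have \<psi>b: "\<bar>\<psi> \<theta>\<bar> \<le> N * B" if "0 \<le> \<theta>" "\<theta> \<le> 2*pi" for \<theta>
    proof -
      have "\<bar>\<psi> \<theta>\<bar> \<le> (\<Sum>j<N. \<bar>L j \<theta> - K j \<theta>\<bar>)" unfolding \<psi>_def by (rule sum_abs)
      also have "\<dots> \<le> (\<Sum>j<N. B)" by (intro sum_mono B) (use that in auto)
      finally show ?thesis by simp
    qed
    have Ki: "integrable circ (K j)" for j
    proof -
      have "continuous_on UNIV (\<lambda>\<theta>. K j \<theta>)" unfolding K_def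
        by (intro continuous_intros contr[OF Fjr(1)]) (use Fjnz r in auto)
      then have "bounded (K j ` {0..2*pi})"
        by (intro compact_imp_bounded compact_continuous_image) (auto intro: continuous_on_subset)
      then obtain B2 where B2: "\<And>\<theta>. \<theta> \<in> {0..2*pi} \<Longrightarrow> \<bar>K j \<theta>\<bar> \<le> B2" unfolding bounded_iff by force
      show ?thesis by (rule integrable_circ_bounded[where B = B2]) (use B2 in auto)
    qed
    have LKi: "integrable circ (\<lambda>\<theta>. L j \<theta> - K j \<theta>)" if "j < N" for j
      by (rule integrable_circ_bounded[where B = B]) (use B[OF that] in auto)
    have Li: "integrable circ (L j)" if "j < N" for j
      using Bochner_Integration.integrable_add[OF LKi[OF that] Ki[of j]] by simp
    have exc: "ln (cmod (x 0 / of_real s)) + e \<le> log_potential (x 0 / of_real s)"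
    proof -
      have "(cmod (x 0 / of_real s))\<^sup>2 \<le> X"
        using TH(2) T0 A s by (simp add: X_def norm_divide power_divide) (intro divide_right_mono power_mono, use s20 in auto)
      then show ?thesis unfolding e_def using x0 s by (intro log_potential_excess) auto
    qed
    have "N * e = (\<Sum>j<N. e)" by simp
    also have "\<dots> \<le> (\<Sum>j<N. (\<integral>\<theta>. L j \<theta> - K j \<theta> \<partial>circ))"
    proof (rule sum_mono)
      fix j assume "j \<in> {..<N}"
      then have "(\<integral>\<theta>. L j \<theta> - K j \<theta> \<partial>circ) = (\<integral>\<theta>. L j \<theta> \<partial>circ) - (\<integral>\<theta>. K j \<theta> \<partial>circ)"
        by (intro Bochner_Integration.integral_diff Li Ki) auto
      then show "e \<le> (\<integral>\<theta>. L j \<theta> - K j \<theta> \<partial>circ)" using EL[of j] EK[of j] exc by linarith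
    qed
    also have "\<dots> = integral\<^sup>L circ \<psi>" unfolding \<psi>_def
      by (rule Bochner_Integration.integral_sum[symmetric]) (use LKi in auto)
    finally have E\<psi>: "N * e \<le> integral\<^sup>L circ \<psi>" .
    \<comment> \<open>The tangent line of \<open>exp\<close> at \<open>m\<close> lies below the
      function, and its mean along \<open>l * \<psi>\<close> is at least \<open>exp m\<close>,
      because the mean of \<open>\<psi>\<close> is at least \<open>N * e\<close>.\<close>
    define m where "m = l * (N * e)"
    have \<psi>i: "integrable circ \<psi>" by (rule integrable_circ_bounded[OF \<psi>m \<psi>b])
    have expi: "integrable circ (\<lambda>\<theta>. exp (l * \<psi> \<theta>))"
    proof (rule integrable_circ_bounded[where B = "exp (l * (N * B))"])
      fix \<theta> :: real assume "0 \<le> \<theta>" "\<theta> \<le> 2 * pi"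
      then have "\<psi> \<theta> \<le> N * B" using \<psi>b[of \<theta>] by simp
      then show "\<bar>exp (l * \<psi> \<theta>)\<bar> \<le> exp (l * (N * B))" using l by (simp add: mult_left_mono)
    qed measurable
    have "exp m \<le> exp m * (1 + l * integral\<^sup>L circ \<psi> - m)"
      using E\<psi> l by (simp add: m_def mult_left_mono)
    also have "\<dots> = (\<integral>\<theta>. exp m * (1 + l * \<psi> \<theta> - m) \<partial>circ)"
      using \<psi>i circ.prob_space by simp
    also have "\<dots> \<le> (\<integral>\<theta>. exp (l * \<psi> \<theta>) \<partial>circ)"
    proof (rule integral_mono[OF _ expi])
      show "integrable circ (\<lambda>\<theta>. exp m * (1 + l * \<psi> \<theta> - m))" using \<psi>i by simp
      fix \<theta>
      have "exp m * (1 + l * \<psi> \<theta> - m) \<le> exp m * exp (l * \<psi> \<theta> - m)"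
        using exp_ge_add_one_self[of "l * \<psi> \<theta> - m"] by (intro mult_left_mono) (linarith, simp)
      then show "exp m * (1 + l * \<psi> \<theta> - m) \<le> exp (l * \<psi> \<theta>)" by (simp add: exp_add[symmetric])
    qed
    finally have "ennreal (exp m) \<le> ennreal (\<integral>\<theta>. exp (l * \<psi> \<theta>) \<partial>circ)" by (rule ennreal_leI)
    also have "\<dots> = (\<integral>\<^sup>+\<theta>. ennreal (exp (l * \<psi> \<theta>)) \<partial>circ)"
      by (rule nn_integral_eq_integral[OF expi, symmetric]) auto
    also have "\<dots> = (\<integral>\<^sup>+\<theta>. \<Phi> x y \<theta> \<partial>circ)"
      unfolding \<Phi>_def Fjj \<psi>_def L_def K_def unfolding f1j ..
    finally have "ennreal (exp (- m)) * ennreal (exp m) \<le> ennreal (exp (- m)) * (\<integral>\<^sup>+\<theta>. \<Phi> x y \<theta> \<partial>circ)"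
      by (rule mult_left_mono) simp
    then show ?thesis by (simp add: m_def ennreal_mult'[symmetric] exp_add[symmetric])
  qed
  interpret P: pair_sigma_finite gseq "gprod I" ..
  interpret PP: pair_sigma_finite "gseq \<Otimes>\<^sub>M gprod I" circ ..
  \<comment> \<open>With \<open>x\<close> and \<open>\<theta>\<close> fixed, the \<open>N\<close>
    combinations of \<open>y\<close> are independent standard Gaussians, so the exponential moment
    factors, and each factor is bounded uniformly in the shift
    \<open>f1 x \<theta> j\<close>.\<close>
  have inner: "(\<integral>\<^sup>+y. \<Phi> x y \<theta> \<partial>gprod I) \<le> ennreal (exp (N * (C * l\<^sup>2)))" for x \<theta>
  proof -
    define \<phi> where "\<phi> j z = ennreal (exp (l * (log_potential (f1 x \<theta> j) - ln (cmod (f1 x \<theta> j + z)))))" for j z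
    have "\<Phi> x y \<theta> = (\<Prod>j\<in>{..<N}. \<phi> j (\<Sum>n\<in>I. U \<theta> j n * y n))" for y
      by (simp add: \<Phi>_def \<phi>_def prod_ennreal exp_sum[symmetric] sum_distrib_left)
    then have "(\<integral>\<^sup>+y. \<Phi> x y \<theta> \<partial>gprod I) = (\<integral>\<^sup>+y. (\<Prod>j\<in>{..<N}. \<phi> j (\<Sum>n\<in>I. U \<theta> j n * y n)) \<partial>gprod I)" by simp
    also have "\<dots> = (\<Prod>j\<in>{..<N}. \<integral>\<^sup>+z. \<phi> j z \<partial>cgauss)"
      by (rule nn_integral_orthonormal_combinations[OF _ fI]) (use U in \<open>auto simp: \<phi>_def\<close>)
    also have "\<dots> \<le> (\<Prod>j\<in>{..<N}. ennreal (exp (C * l\<^sup>2)))"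
      unfolding \<phi>_def C_def by (intro prod_mono_ennreal log_potential_exponential_moment l)
    also have "\<dots> = ennreal (exp (N * (C * l\<^sup>2)))"
      by (simp add: ennreal_power exp_of_nat_mult[symmetric])
    finally show ?thesis .
  qed
  have "emeasure gseq H1 = (\<integral>\<^sup>+x. indicator H1 x \<partial>distr (gseq \<Otimes>\<^sub>M gprod I) gseq T)"
    unfolding T by simp
  also have "\<dots> = (\<integral>\<^sup>+p. indicator H1 (T p) \<partial>(gseq \<Otimes>\<^sub>M gprod I))"
    by (rule nn_integral_distr) measurable
  also have "\<dots> \<le> (\<integral>\<^sup>+p. ennreal (exp (- (l * (N * e)))) * (\<integral>\<^sup>+\<theta>. \<Phi> (fst p) (snd p) \<theta> \<partial>circ) \<partial>(gseq \<Otimes>\<^sub>M gprod I))"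
  proof (rule nn_integral_mono)
    fix p assume "p \<in> space (gseq \<Otimes>\<^sub>M gprod I)"
    then show "indicator H1 (T p) \<le> ennreal (exp (- (l * (N * e)))) * (\<integral>\<^sup>+\<theta>. \<Phi> (fst p) (snd p) \<theta> \<partial>circ)"
      using pointwise[of "fst p" "snd p"] by (auto simp: space_pair_measure split: split_indicator)
  qed
  also have "\<dots> = ennreal (exp (- (l * (N * e)))) * (\<integral>\<^sup>+p. (\<integral>\<^sup>+\<theta>. \<Phi> (fst p) (snd p) \<theta> \<partial>circ) \<partial>(gseq \<Otimes>\<^sub>M gprod I))"
    by (rule nn_integral_cmult) measurable
  also have "(\<integral>\<^sup>+p. (\<integral>\<^sup>+\<theta>. \<Phi> (fst p) (snd p) \<theta> \<partial>circ) \<partial>(gseq \<Otimes>\<^sub>M gprod I))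
     = (\<integral>\<^sup>+\<theta>. (\<integral>\<^sup>+p. \<Phi> (fst p) (snd p) \<theta> \<partial>(gseq \<Otimes>\<^sub>M gprod I)) \<partial>circ)"
    by (rule PP.Fubini'[symmetric]) (use \<Phi>m in \<open>simp add: case_prod_beta\<close>)
  also have "\<dots> \<le> (\<integral>\<^sup>+\<theta>. ennreal (exp (N * (C * l\<^sup>2))) \<partial>circ)"
  proof (rule nn_integral_mono)
    fix \<theta>
    have "(\<lambda>p. \<Phi> (fst p) (snd p) \<theta>) \<in> borel_measurable (gseq \<Otimes>\<^sub>M gprod I)"
      using measurable_compose[OF _ \<Phi>m, of "\<lambda>p. (p, \<theta>)" "gseq \<Otimes>\<^sub>M gprod I"] by simp
    then have "(\<integral>\<^sup>+p. \<Phi> (fst p) (snd p) \<theta> \<partial>(gseq \<Otimes>\<^sub>M gprod I)) = (\<integral>\<^sup>+x. \<integral>\<^sup>+y. \<Phi> x y \<theta> \<partial>gprod I \<partial>gseq)"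
      using sigma_finite_measure.nn_integral_fst[OF prob_space_imp_sigma_finite[OF prob_space_gprod[of I]], of "\<lambda>p. \<Phi> (fst p) (snd p) \<theta>" gseq] by simp
    also have "\<dots> \<le> (\<integral>\<^sup>+x. ennreal (exp (N * (C * l\<^sup>2))) \<partial>gseq)" by (intro nn_integral_mono inner)
    also have "\<dots> = ennreal (exp (N * (C * l\<^sup>2)))"
      by (simp add: prob_space.emeasure_space_1[OF prob_space_gprod])
    finally show "(\<integral>\<^sup>+p. \<Phi> (fst p) (snd p) \<theta> \<partial>(gseq \<Otimes>\<^sub>M gprod I)) \<le> \<dots>" .
  qed
  also have "\<dots> = ennreal (exp (N * (C * l\<^sup>2)))" by (simp add: circ.emeasure_space_1[simplified])
  finally have "emeasure gseq H1 \<le> ennreal (exp (- (l * (N * e)))) * ennreal (exp (N * (C * l\<^sup>2)))"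
    by (simp add: mult_left_mono)
  also have "\<dots> = ennreal (exp (- (N * e\<^sup>2 / (4 * C))))"
  proof -
    have "- (l * (N * e)) + N * (C * l\<^sup>2) = - (N * e\<^sup>2 / (4 * C))"
      unfolding l_def using C by (simp add: field_simps power2_eq_square)
    then show ?thesis by (simp add: ennreal_mult'[symmetric] exp_add[symmetric])
  qed
  finally have m1: "measure gseq H1 \<le> exp (- (N * e\<^sup>2 / (4 * C)))"
    by (simp add: gp.emeasure_eq_measure)
  have m2: "measure gseq {x\<in>space gseq. x 0 \<in> {z. A\<^sup>2 < (cmod z)\<^sup>2}} = exp (- (A\<^sup>2))"
    by (subst measure_gprod_component) (auto simp: measure_cgauss_tail)
  have "measure gseq H \<le> measure gseq ({x\<in>space gseq. x 0 \<in> {z. A\<^sup>2 < (cmod z)\<^sup>2}} \<union> H1)"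
  proof (rule gp.finite_measure_mono)
    show "H \<subseteq> {x\<in>space gseq. x 0 \<in> {z. A\<^sup>2 < (cmod z)\<^sup>2}} \<union> H1"
    proof
      fix x assume x: "x \<in> H"
      then have "x \<in> space gseq" by (auto simp: H_def Hole_def)
      moreover have "A\<^sup>2 < (cmod (x 0))\<^sup>2" if "\<not> cmod (x 0) \<le> A"
        using that A by (intro power_strict_mono) auto
      ultimately show "x \<in> {x\<in>space gseq. x 0 \<in> {z. A\<^sup>2 < (cmod z)\<^sup>2}} \<union> H1" using x by (auto simp: H1_def)
    qed
  qed measurable
  also have "\<dots> \<le> measure gseq {x\<in>space gseq. x 0 \<in> {z. A\<^sup>2 < (cmod z)\<^sup>2}} + measure gseq H1"
    by (rule measure_Un_le) measurable
  finally show ?thesis using m1 m2 by (simp add: H_def C_def)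
qed

section \<open>Lower bound for the hole probability\<close>

lemma distr_gseq_component: "distr gseq borel (\<lambda>x. x n) = cgauss"
proof -
  have "distr gseq borel (\<lambda>x. x n) = distr gseq cgauss (\<lambda>x. x n)" by (rule distr_cong) auto
  also have "\<dots> = cgauss" using gp.PiM_component[of n UNIV] by simp
  finally show ?thesis .
qed

lemma indep_vars_gseq: "gp.indep_vars UNIV (\<lambda>_. borel) (\<lambda>n x. x n) (UNIV :: nat set)"
proof -
  have "distr gseq (PiM UNIV (\<lambda>_. borel)) (\<lambda>x. \<lambda>i\<in>UNIV. x i) = distr gseq (PiM UNIV (\<lambda>_. borel)) (\<lambda>x. x)"
    by (simp add: restrict_def)
  also have "\<dots> = gseq" by (rule distr_id2) (simp add: sets_gprod)
  finally show ?thesis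
    by (subst gp.indep_vars_iff_distr_eq_PiM) (auto simp: distr_gseq_component)
qed

lemma measure_gseq_block:
  assumes "finite J" "J \<noteq> {}" and S: "S \<in> sets (PiM J (\<lambda>_. borel))"
  shows "measure gseq {x\<in>space gseq. restrict x J \<in> S} = measure (gprod J) S"
proof -
  have "gp.indep_vars UNIV (\<lambda>_. borel) (\<lambda>n x. x n) J"
    by (rule gp.indep_vars_subset[OF indep_vars_gseq]) simp
  then have "distr gseq (PiM J (\<lambda>_. borel)) (\<lambda>x. \<lambda>i\<in>J. x i) = gprod J"
    using assms(2) by (subst (asm) gp.indep_vars_iff_distr_eq_PiM) (auto simp: distr_gseq_component)
  then have "measure (gprod J) S = measure (distr gseq (PiM J (\<lambda>_. borel)) (\<lambda>x. \<lambda>i\<in>J. x i)) S" by simp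
  also have "\<dots> = measure gseq ((\<lambda>x. \<lambda>i\<in>J. x i) -` S \<inter> space gseq)"
    by (rule measure_distr[OF _ S]) measurable
  also have "(\<lambda>x. \<lambda>i\<in>J. x i) -` S \<inter> space gseq = {x\<in>space gseq. restrict x J \<in> S}" by auto
  finally show ?thesis ..
qed

lemma measure_gseq_indep:
  assumes AB: "A \<inter> B = {}" and S: "S \<in> sets (PiM A (\<lambda>_. borel))" and S': "S' \<in> sets (PiM B (\<lambda>_. borel))"
  shows "measure gseq {x\<in>space gseq. restrict x A \<in> S \<and> restrict x B \<in> S'}
    = measure gseq {x\<in>space gseq. restrict x A \<in> S} * measure gseq {x\<in>space gseq. restrict x B \<in> S'}"
proof -
  have i: "gp.indep_var UNIV (PiM A (\<lambda>_. borel)) (\<lambda>x. restrict (\<lambda>i. x i) A) (PiM B (\<lambda>_. borel)) (\<lambda>x. restrict (\<lambda>i. x i) B)"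
    by (rule gp.indep_var_restrict[OF indep_vars_gseq AB]) auto
  have 1: "{x\<in>space gseq. restrict x A \<in> S \<and> restrict x B \<in> S'} = (\<lambda>x. (restrict x A, restrict x B)) -` (S \<times> S') \<inter> space gseq"
    and 2: "{x\<in>space gseq. restrict x A \<in> S} = (\<lambda>x. restrict x A) -` S \<inter> space gseq"
    and 3: "{x\<in>space gseq. restrict x B \<in> S'} = (\<lambda>x. restrict x B) -` S' \<inter> space gseq" by auto
  show ?thesis unfolding 1 2 3 using gp.indep_varD[OF i S S'] by simp
qed

lemma nn_integral_gseq_norm: "(\<integral>\<^sup>+x. ennreal (cmod (x n)) \<partial>gseq) \<le> ennreal 2"
proof -
  have "(\<integral>\<^sup>+x. ennreal (cmod (x n)) \<partial>gseq) = (\<integral>\<^sup>+z. ennreal (cmod z) \<partial>distr gseq borel (\<lambda>x. x n))"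
    by (rule nn_integral_distr[symmetric]) auto
  also have "\<dots> = ennreal (\<integral>z. cmod z \<partial>cgauss)"
    unfolding distr_gseq_component by (rule nn_integral_eq_integral[OF cgauss_norm(1)]) auto
  also have "\<dots> \<le> ennreal 2" using cgauss_norm(2) by (rule ennreal_leI)
  finally show ?thesis .
qed

text \<open>Valued in \<open>ennreal\<close>, so that its mean can be taken term by term before
  convergence is known; it equals infinity where the series diverges.\<close>

definition tail_sum :: "(nat \<Rightarrow> real) \<Rightarrow> nat set \<Rightarrow> real \<Rightarrow> (nat \<Rightarrow> complex) \<Rightarrow> ennreal" where
  "tail_sum a J r x = (\<Sum>n. ennreal (if n \<in> J then cmod (x n) * (a n * r ^ n) else 0))"

lemma nn_integral_tail_sum:
  assumes a: "\<And>n. 0 \<le> a n" "\<And>n. a n \<le> 1" and r: "0 \<le> r"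
  shows "(\<integral>\<^sup>+x. tail_sum a J r x \<partial>gseq) \<le> (\<Sum>n. ennreal (if n \<in> J then 2 * r ^ n else 0))"
proof -
  have m: "(\<lambda>x. ennreal (if n \<in> J then cmod (x n) * (a n * r ^ n) else 0)) \<in> borel_measurable gseq" for n
    by (cases "n \<in> J") auto
  have "(\<integral>\<^sup>+x. tail_sum a J r x \<partial>gseq) = (\<Sum>n. \<integral>\<^sup>+x. ennreal (if n \<in> J then cmod (x n) * (a n * r ^ n) else 0) \<partial>gseq)"
    unfolding tail_sum_def by (rule nn_integral_suminf) (rule m)
  also have "\<dots> \<le> (\<Sum>n. ennreal (if n \<in> J then 2 * r ^ n else 0))"
  proof (intro suminf_le allI)
    fix n
    show "(\<integral>\<^sup>+x. ennreal (if n \<in> J then cmod (x n) * (a n * r ^ n) else 0) \<partial>gseq) \<le> ennreal (if n \<in> J then 2 * r ^ n else 0)"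
    proof (cases "n \<in> J")
      case True
      have ar: "0 \<le> a n * r ^ n" "a n * r ^ n \<le> r ^ n" using a r by (auto intro: mult_left_le_one_le)
      have "(\<integral>\<^sup>+x. ennreal (cmod (x n) * (a n * r ^ n)) \<partial>gseq) = (\<integral>\<^sup>+x. ennreal (cmod (x n)) * ennreal (a n * r ^ n) \<partial>gseq)"
        using ar by (intro nn_integral_cong ennreal_mult) auto
      also have "\<dots> = (\<integral>\<^sup>+x. ennreal (cmod (x n)) \<partial>gseq) * ennreal (a n * r ^ n)"
        by (rule nn_integral_multc) measurable
      also have "\<dots> \<le> ennreal 2 * ennreal (r ^ n)"
        using ar by (intro mult_mono nn_integral_gseq_norm ennreal_leI) auto
      also have "\<dots> = ennreal (2 * r ^ n)" by (simp add: ennreal_mult')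
      finally show ?thesis using True by simp
    qed simp
  qed auto
  finally show ?thesis .
qed

lemma suminf_ennreal_geometric_tail:
  assumes r: "0 \<le> r" "r < 1"
  shows "(\<Sum>n. ennreal (if n \<in> {m..} then 2 * r ^ n else 0)) = ennreal (2 * r ^ m / (1 - r))"
proof -
  have "(\<lambda>n. 2 * r ^ m * r ^ n) sums (2 * r ^ m * (1 / (1 - r)))"
    using r by (intro sums_mult geometric_sums) auto
  then have "(\<lambda>n. 2 * r ^ (n + m)) sums (2 * r ^ m / (1 - r))" by (simp add: power_add mult_ac)
  then have "(\<lambda>n. if n + m \<in> {m..} then 2 * r ^ (n + m) else 0) sums (2 * r ^ m / (1 - r))" by simp
  then have "(\<lambda>n. if n \<in> {m..} then 2 * r ^ n else 0) sums (2 * r ^ m / (1 - r) + (\<Sum>n<m. if n \<in> {m..} then 2 * r ^ n else 0))"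
    by (subst (asm) sums_iff_shift) simp
  then have s: "(\<lambda>n. if n \<in> {m..} then 2 * r ^ n else 0) sums (2 * r ^ m / (1 - r))" by simp
  show ?thesis
    by (rule suminf_ennreal_eq[OF _ s]) (use r in auto)
qed

text \<open>For each radius in a sequence increasing to 1, the series of absolute values has finite
  mean, hence converges almost surely. Countably many null sets are discarded.\<close>

lemma AE_conv_radius_ge_1:
  assumes a: "\<And>n. 0 \<le> a n" "\<And>n. a n \<le> 1"
  shows "AE x in gseq. 1 \<le> conv_radius (\<lambda>n. x n * of_real (a n))"
proof -
  define \<rho> where "\<rho> k = 1 - 1 / real (k + 2)" for k :: nat
  have \<rho>: "0 \<le> \<rho> k" "\<rho> k < 1" for k by (auto simp: \<rho>_def)
  have "AE x in gseq. tail_sum a UNIV (\<rho> k) x \<noteq> \<infinity>" for k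
  proof (rule nn_integral_noteq_infinite)
    show "tail_sum a UNIV (\<rho> k) \<in> borel_measurable gseq" unfolding tail_sum_def by measurable
    have "(\<integral>\<^sup>+x. tail_sum a UNIV (\<rho> k) x \<partial>gseq) \<le> (\<Sum>n. ennreal (if n \<in> UNIV then 2 * \<rho> k ^ n else 0))"
      by (rule nn_integral_tail_sum[OF a \<rho>(1)])
    also have "\<dots> = ennreal (2 * \<rho> k ^ 0 / (1 - \<rho> k))"
    proof -
      have U: "{0..} = (UNIV :: nat set)" by auto
      show ?thesis by (rule suminf_ennreal_geometric_tail[of "\<rho> k" 0, unfolded U, OF \<rho>])
    qed
    also have "\<dots> < \<infinity>" by simp
    finally show "(\<integral>\<^sup>+x. tail_sum a UNIV (\<rho> k) x \<partial>gseq) \<noteq> \<infinity>" by simp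
  qed
  then have "AE x in gseq. \<forall>k. tail_sum a UNIV (\<rho> k) x \<noteq> \<infinity>" by (subst AE_all_countable) blast
  then show ?thesis
  proof eventually_elim
    case (elim x)
    show ?case
    proof (rule conv_radius_geI_ex')
      fix r :: real assume r: "0 < r" "ereal r < 1"
      then have "r < 1" by simp
      then obtain k where k: "inverse (real (Suc k)) < 1 - r" using reals_Archimedean[of "1 - r"] by auto
      have "1 / real (k + 2) \<le> inverse (real (Suc k))" by (simp add: inverse_eq_divide frac_le)
      then have rk: "r \<le> \<rho> k" using k by (simp add: \<rho>_def)
      have "summable (\<lambda>n. cmod (x n) * (a n * \<rho> k ^ n))"
        by (rule summable_suminf_not_top) (use elim a \<rho> in \<open>auto simp: tail_sum_def\<close>)
      then show "summable (\<lambda>n. x n * complex_of_real (a n) * of_real r ^ n)"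
      proof (rule summable_comparison_test'[where N = 0])
        fix n
        have "norm (x n * complex_of_real (a n) * of_real r ^ n) = cmod (x n) * (a n * r ^ n)"
          using a r by (simp add: norm_mult norm_power)
        also have "\<dots> \<le> cmod (x n) * (a n * \<rho> k ^ n)"
          using a r rk by (intro mult_left_mono power_mono) auto
        finally show "norm (x n * complex_of_real (a n) * of_real r ^ n) \<le> cmod (x n) * (a n * \<rho> k ^ n)" .
      qed
    qed
  qed
qed

text \<open>The deterministic half of the lower bound: the constant term exceeds \<open>A\<close>,
  while the terms up to \<open>K\<close> contribute at most \<open>t / \<kappa>\<close> by the grid
  estimate and the remaining terms at most 1.\<close>

lemma gaf_nonzero_if_dominated:
  assumes conv: "1 \<le> conv_radius (\<lambda>n. x n * complex_of_real (a n))" and a: "\<And>n. 0 \<le> a n" and a0: "a 0 = 1"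
    and r: "0 < r" "r < 1" and K: "1 \<le> K" and N: "1 \<le> N"
    and \<kappa>: "\<kappa> = 1 - 2 * pi * exp 1 * K / N" "0 < \<kappa>" and tA: "t / \<kappa> + 1 \<le> A"
    and x0: "A < cmod (x 0)"
    and grid: "\<And>j. j < N \<Longrightarrow> cmod (\<Sum>n=1..K. of_real (a n * r ^ n) * cis (2 * pi * of_nat j / of_nat N) ^ n * x n) \<le> t"
    and tail: "tail_sum a {Suc K..} r x \<le> 1" and z: "cmod z \<le> r"
  shows "gaf coord a x z \<noteq> 0"
proof
  assume F0: "gaf coord a x z = 0"
  \<comment> \<open>The powers of \<open>r\<close> are moved into the coefficients, so that the grid
    estimate on the unit disc applies at \<open>z / r\<close>.\<close>
  define c where "c n = (if n = 0 then 0 else of_real (a n * r ^ n) * x n)" for n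
  have z1: "cmod z < 1" using z r by simp
  have sumc: "(\<Sum>n\<le>K. c n * v ^ n) = (\<Sum>n=1..K. of_real (a n * r ^ n) * v ^ n * x n)" for v
  proof -
    have "{..K} = insert 0 {1..K}" by auto
    then show ?thesis by (simp add: c_def mult_ac)
  qed
  have "\<kappa> * cmod (\<Sum>n\<le>K. c n * (z / r) ^ n) \<le> t"
    unfolding \<kappa>(1)
    by (rule polynomial_bound_from_grid[OF K N]) (use grid z r in \<open>auto simp: sumc norm_divide\<close>)
  then have p: "cmod (\<Sum>n\<le>K. c n * (z / r) ^ n) \<le> t / \<kappa>" using \<kappa>(2) by (simp add: field_simps)
  have pz: "(\<Sum>n\<le>K. c n * (z / r) ^ n) = (\<Sum>n=1..K. x n * of_real (a n) * z ^ n)"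
    unfolding sumc using r by (intro sum.cong) (auto simp: power_divide)
  define f where "f n = x n * complex_of_real (a n) * z ^ n" for n
  define h where "h n = (if n \<in> {Suc K..} then f n else 0)" for n
  define g where "g n = (if n \<in> {Suc K..} then cmod (x n) * (a n * r ^ n) else 0)" for n
  have g0: "0 \<le> g n" for n using a r by (simp add: g_def)
  have tg: "(\<Sum>n. ennreal (g n)) \<le> 1" using tail by (simp add: tail_sum_def g_def)
  then have "(\<Sum>n. ennreal (g n)) \<noteq> \<top>" by (auto simp: top_unique)
  then have sg: "summable g" by (intro summable_suminf_not_top g0)
  have "ennreal (suminf g) \<le> 1" using tg suminf_ennreal2[OF g0 sg] by simp
  then have g1: "suminf g \<le> 1" by (simp add: ennreal_le_1)
  have hg: "norm (h n) \<le> g n" for n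
  proof -
    have "norm (f n) = cmod (x n) * (a n * cmod z ^ n)"
      using a by (simp add: f_def norm_mult norm_power)
    also have "\<dots> \<le> cmod (x n) * (a n * r ^ n)"
      using a z by (intro mult_left_mono power_mono) auto
    finally show ?thesis by (simp add: h_def g_def)
  qed
  have sh: "summable h" by (rule summable_comparison_test'[OF sg hg])
  have "norm (suminf h) \<le> suminf g" by (rule norm_suminf_le[OF hg sg])
  then have h1: "norm (suminf h) \<le> 1" using g1 by simp
  have "(\<lambda>n. (if n \<in> {..K} then f n else 0) + h n) sums ((\<Sum>n\<in>{..K}. f n) + suminf h)"
    by (intro sums_add sums_If_finite_set summable_sums sh) auto
  moreover have "(if n \<in> {..K} then f n else 0) + h n = f n" for n by (auto simp: h_def)
  ultimately have "suminf f = (\<Sum>n\<in>{..K}. f n) + suminf h" by (simp add: sums_iff)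
  moreover have "suminf f = gaf coord a x z" by (simp add: gaf_def f_def[abs_def])
  moreover have "(\<Sum>n\<in>{..K}. f n) = x 0 + (\<Sum>n=1..K. x n * of_real (a n) * z ^ n)"
  proof -
    have "{..K} = insert 0 {1..K}" by auto
    then show ?thesis by (simp add: f_def a0)
  qed
  ultimately have "x 0 + ((\<Sum>n=1..K. x n * of_real (a n) * z ^ n) + suminf h) = 0"
    using F0 by (simp add: add.assoc)
  then have "x 0 = - ((\<Sum>n=1..K. x n * of_real (a n) * z ^ n) + suminf h)"
    by (rule eq_neg_iff_add_eq_0[THEN iffD2])
  then have "cmod (x 0) = cmod ((\<Sum>n=1..K. x n * of_real (a n) * z ^ n) + suminf h)"
    by (simp only: norm_minus_cancel)
  also have "\<dots> \<le> cmod (\<Sum>n=1..K. x n * of_real (a n) * z ^ n) + cmod (suminf h)"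
    by (rule norm_triangle_ineq)
  also have "\<dots> \<le> t / \<kappa> + 1" using p h1 unfolding pz by linarith
  finally show False using x0 tA by linarith
qed

text \<open>Three events on disjoint sets of coordinates are intersected: a large constant term, a
  small polynomial part on the grid, and a small tail. The last has probability at least
  \<open>1/2\<close> by Markov's inequality, because the assumption on \<open>r ^ Suc K\<close>
  makes the mean of the tail at most \<open>1/2\<close>; this is the source of the factor
  \<open>1/2\<close>.\<close>

lemma hole_probability_lower:
  fixes a :: "nat \<Rightarrow> real" and r A t V \<kappa> :: real and N K :: nat
  assumes dec: "decseq a" and apos: "\<And>n. 0 < a n" and a0: "a 0 = 1"
    and r: "0 < r" "r < 1" and K: "1 \<le> K" and N: "1 \<le> N"
    and \<kappa>: "\<kappa> = 1 - 2 * pi * exp 1 * K / N" "0 < \<kappa>" and tA: "t / \<kappa> + 1 \<le> A" and t: "0 \<le> t"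
    and V: "0 < V" "(\<Sum>n=1..K. (a n)\<^sup>2 * r ^ (2 * n)) \<le> V"
    and tl: "4 * r ^ Suc K \<le> 1 - r"
  shows "exp (- (A\<^sup>2)) * (1 - exp (- (t\<^sup>2 / V))) ^ N / 2 \<le> measure gseq (Hole gseq coord a r)"
proof -
  have a: "0 \<le> a n" "a n \<le> 1" for n
    using apos[of n] decseqD[OF dec, of 0 n] a0 by auto
  have A0: "0 \<le> A" using tA t \<kappa>(2) by (smt (verit) divide_nonneg_pos)
  define v where "v j n = complex_of_real (a n * r ^ n) * cis (2 * pi * of_nat j / of_nat N) ^ n" for j n :: nat
  define S0 where "S0 = {y\<in>space (PiM {0} (\<lambda>_. borel)). A\<^sup>2 < (cmod (y (0::nat)))\<^sup>2}"
  define S1 where "S1 = {y\<in>space (PiM {1..K} (\<lambda>_. borel)). \<forall>j\<in>{..<N}. cmod (\<Sum>n\<in>{1..K}. v j n * y n) \<le> t}"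
  \<comment> \<open>The first two events written as one event on the coordinates up to
    \<open>K\<close>, so that independence from the tail again concerns two blocks.\<close>
  define S01 where "S01 = {y\<in>space (PiM {..K} (\<lambda>_. borel)). A\<^sup>2 < (cmod (y (0::nat)))\<^sup>2 \<and> (\<forall>j\<in>{..<N}. cmod (\<Sum>n\<in>{1..K}. v j n * y n) \<le> t)}"
  define S2 where "S2 = {y\<in>space (PiM {Suc K..} (\<lambda>_. borel)). tail_sum a {Suc K..} r y \<le> 1}"
  have S0 [measurable]: "S0 \<in> sets (PiM {0} (\<lambda>_. borel))" unfolding S0_def by measurable
  have S1 [measurable]: "S1 \<in> sets (PiM {1..K} (\<lambda>_. borel))" unfolding S1_def by measurable
  have S01 [measurable]: "S01 \<in> sets (PiM {..K} (\<lambda>_. borel))" unfolding S01_def by measurable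
  have "(\<lambda>y. ennreal (if n \<in> {Suc K..} then cmod (y n) * (a n * r ^ n) else 0)) \<in> borel_measurable (PiM {Suc K..} (\<lambda>_. borel))" for n
    by (cases "n \<in> {Suc K..}") auto
  then have [measurable]: "tail_sum a {Suc K..} r \<in> borel_measurable (PiM {Suc K..} (\<lambda>_. borel))"
    unfolding tail_sum_def by measurable
  have S2 [measurable]: "S2 \<in> sets (PiM {Suc K..} (\<lambda>_. borel))" unfolding S2_def by measurable
  have tsr: "tail_sum a {Suc K..} r (restrict x {Suc K..}) = tail_sum a {Suc K..} r x" for x
    unfolding tail_sum_def by (intro suminf_cong) auto
  define E0 where "E0 = {x\<in>space gseq. restrict x {0} \<in> S0}"
  define E1 where "E1 = {x\<in>space gseq. restrict x {1..K} \<in> S1}"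
  define E2 where "E2 = {x\<in>space gseq. restrict x {Suc K..} \<in> S2}"
  have e0: "measure gseq E0 = exp (- (A\<^sup>2))"
  proof -
    have "E0 = {x\<in>space gseq. x 0 \<in> {z. A\<^sup>2 < (cmod z)\<^sup>2}}" by (auto simp: E0_def S0_def space_PiM)
    then show ?thesis by (simp only:) (subst measure_gprod_component, auto simp: measure_cgauss_tail)
  qed
  have e1: "(1 - exp (- (t\<^sup>2 / V))) ^ N \<le> measure gseq E1"
  proof -
    have "(\<Sum>n\<in>{1..K}. (cmod (v j n))\<^sup>2) \<le> V" for j
    proof -
      have "(cmod (v j n))\<^sup>2 = (a n)\<^sup>2 * r ^ (2 * n)" for n
        using a r by (simp add: v_def norm_mult norm_power power_mult_distrib power_even_eq abs_mult)
      then show ?thesis using V by simp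
    qed
    then have "(1 - exp (- (t\<^sup>2 / V))) ^ card {..<N} \<le> measure (gprod {1..K}) {x\<in>space (gprod {1..K}). \<forall>j\<in>{..<N}. cmod (\<Sum>n\<in>{1..K}. v j n * x n) \<le> t}"
      using t V by (intro khatri_sidak) auto
    also have "{x\<in>space (gprod {1..K}). \<forall>j\<in>{..<N}. cmod (\<Sum>n\<in>{1..K}. v j n * x n) \<le> t} = S1"
      by (simp add: S1_def space_PiM)
    also have "measure (gprod {1..K}) S1 = measure gseq E1"
      unfolding E1_def by (rule measure_gseq_block[symmetric]) (use K S1 in auto)
    finally show ?thesis by simp
  qed
  have e2: "1/2 \<le> measure gseq E2"
  proof -
    have tm [measurable]: "tail_sum a {Suc K..} r \<in> borel_measurable gseq"
    proof -
      have "(\<lambda>x. ennreal (if n \<in> {Suc K..} then cmod (x n) * (a n * r ^ n) else 0)) \<in> borel_measurable gseq" for n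
        by (cases "n \<in> {Suc K..}") auto
      then show ?thesis unfolding tail_sum_def by measurable
    qed
    have E2: "E2 = space gseq - {x\<in>space gseq. 1 < tail_sum a {Suc K..} r x}"
      by (auto simp: E2_def S2_def space_PiM tsr not_less)
    have "emeasure gseq {x\<in>space gseq. 1 < tail_sum a {Suc K..} r x} \<le> emeasure gseq {x\<in>space gseq. 1 \<le> 1 * tail_sum a {Suc K..} r x}"
      by (intro emeasure_mono) auto
    also have "\<dots> \<le> 1 * (\<integral>\<^sup>+x. tail_sum a {Suc K..} r x * indicator (space gseq) x \<partial>gseq)"
      by (rule nn_integral_Markov_inequality) auto
    also have "\<dots> = (\<integral>\<^sup>+x. tail_sum a {Suc K..} r x \<partial>gseq)"
      by (subst mult_1, intro nn_integral_cong) simp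
    also have "\<dots> \<le> (\<Sum>n. ennreal (if n \<in> {Suc K..} then 2 * r ^ n else 0))"
      by (rule nn_integral_tail_sum[OF a less_imp_le[OF r(1)]])
    also have "\<dots> = ennreal (2 * r ^ Suc K / (1 - r))"
      by (rule suminf_ennreal_geometric_tail) (use r in auto)
    also have "\<dots> \<le> ennreal (1/2)" using tl r by (intro ennreal_leI) (simp add: field_simps)
    finally have "ennreal (measure gseq {x\<in>space gseq. 1 < tail_sum a {Suc K..} r x}) \<le> ennreal (1/2)"
      by (simp only: gp.emeasure_eq_measure)
    then have "measure gseq {x\<in>space gseq. 1 < tail_sum a {Suc K..} r x} \<le> 1/2"
      by (subst (asm) ennreal_le_iff) simp_all
    then show ?thesis unfolding E2 by (subst gp.prob_compl) auto
  qed
  have "measure gseq (E0 \<inter> E1) = measure gseq E0 * measure gseq E1"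
  proof -
    have "E0 \<inter> E1 = {x\<in>space gseq. restrict x {0} \<in> S0 \<and> restrict x {1..K} \<in> S1}" by (auto simp: E0_def E1_def)
    then show ?thesis unfolding E0_def E1_def by (simp only:) (rule measure_gseq_indep[OF _ S0 S1], auto)
  qed
  moreover have E01: "E0 \<inter> E1 = {x\<in>space gseq. restrict x {..K} \<in> S01}"
  proof -
    have "(\<Sum>n\<in>{1..K}. v j n * restrict x {..K} n) = (\<Sum>n\<in>{1..K}. v j n * x n)"
      "(\<Sum>n\<in>{1..K}. v j n * restrict x {1..K} n) = (\<Sum>n\<in>{1..K}. v j n * x n)" for x j
      by (auto intro!: sum.cong)
    then show ?thesis by (auto simp: E0_def E1_def S0_def S1_def S01_def space_PiM)
  qed
  moreover have "measure gseq ((E0 \<inter> E1) \<inter> E2) = measure gseq (E0 \<inter> E1) * measure gseq E2"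
  proof -
    have "(E0 \<inter> E1) \<inter> E2 = {x\<in>space gseq. restrict x {..K} \<in> S01 \<and> restrict x {Suc K..} \<in> S2}"
      unfolding E01 by (auto simp: E2_def)
    then show ?thesis unfolding E01 E2_def by (simp only:) (rule measure_gseq_indep[OF _ S01 S2], auto)
  qed
  ultimately have m: "measure gseq ((E0 \<inter> E1) \<inter> E2) = measure gseq E0 * measure gseq E1 * measure gseq E2" by simp
  have nn: "0 \<le> t\<^sup>2 / V" using V by simp
  have "exp (- (A\<^sup>2)) * (1 - exp (- (t\<^sup>2 / V))) ^ N / 2 = exp (- (A\<^sup>2)) * (1 - exp (- (t\<^sup>2 / V))) ^ N * (1/2)" by simp
  also have "\<dots> \<le> measure gseq E0 * measure gseq E1 * measure gseq E2"
    using e0 e1 e2 nn by (intro mult_mono) auto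
  also have "\<dots> \<le> measure gseq (Hole gseq coord a r)"
    unfolding m[symmetric]
  proof (rule gp.finite_measure_mono_AE)
    show "Hole gseq coord a r \<in> sets gseq" by (rule Hole_measurable[OF r(2)])
    show "AE x in gseq. x \<in> (E0 \<inter> E1) \<inter> E2 \<longrightarrow> x \<in> Hole gseq coord a r"
      using AE_conv_radius_ge_1[of a, OF a]
    proof eventually_elim
      case (elim x)
      show ?case
      proof
        assume x: "x \<in> (E0 \<inter> E1) \<inter> E2"
        have "A\<^sup>2 < (cmod (x 0))\<^sup>2" using x by (auto simp: E0_def S0_def)
        then have x0: "A < cmod (x 0)" by (rule power_less_imp_less_base) simp
        have grid: "cmod (\<Sum>n=1..K. of_real (a n * r ^ n) * cis (2 * pi * of_nat j / of_nat N) ^ n * x n) \<le> t" if "j < N" for j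
        proof -
          have "(\<Sum>n\<in>{1..K}. v j n * restrict x {1..K} n) = (\<Sum>n\<in>{1..K}. v j n * x n)"
            by (auto intro!: sum.cong)
          then show ?thesis using x that by (auto simp: E1_def S1_def v_def)
        qed
        have tail: "tail_sum a {Suc K..} r x \<le> 1" using x by (auto simp: E2_def S2_def tsr)
        show "x \<in> Hole gseq coord a r"
          unfolding Hole_def mem_Collect_eq
        proof (intro conjI allI impI)
          show "x \<in> space gseq" using x by (auto simp: E0_def)
          show "1 \<le> conv_radius (\<lambda>n. x n * complex_of_real (a n))" by fact
          fix z :: complex assume "cmod z \<le> r"
          show "gaf coord a x z \<noteq> 0"
          proof (rule gaf_nonzero_if_dominated[where x = x and a = a and r = r and K = K and N = N and \<kappa> = \<kappa> and t = t and A = A])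
            show "1 \<le> conv_radius (\<lambda>n. x n * complex_of_real (a n))" by fact
          qed (fact a(1) a0 r K N \<kappa> tA x0 grid tail \<open>cmod z \<le> r\<close>)+
        qed
      qed
    qed
  qed
  finally show ?thesis .
qed

section \<open>Asymptotics\<close>

text \<open>In order: the variance lost in the splitting is negligible; \<open>N * e\<^sup>2\<close>
  beats \<open>A\<^sup>2\<close>; additive constants are absorbed; the tail beyond \<open>K\<close>
  is small; the failure probability at a grid point is at most \<open>1/2\<close>; the cost of the
  grid and of the factor \<open>1/2\<close> is negligible.\<close>

lemma eventually_at_right_0_asymptotics:
  fixes L p k C :: real
  assumes "0 < L" "0 < p" "0 < k" "0 < C"
  shows "\<forall>\<^sub>F d in at_right (0::real). 2 * d powr L + C * d powr p \<le> k"
    and "\<forall>\<^sub>F d in at_right (0::real). C * (d powr p * (ln (1 / d) * (k * ln (1 / d) + 1)\<^sup>2)) \<le> 1"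
    and "\<forall>\<^sub>F d in at_right (0::real). b \<le> k * d powr (- L) * ln (1 / d)"
    and "\<forall>\<^sub>F d in at_right (0::real). 4 * exp (- (d powr (- p))) \<le> d"
    and "\<forall>\<^sub>F d in at_right (0::real). d powr p \<le> 1/2"
    and "\<forall>\<^sub>F d in at_right (0::real). C * d powr p + ln 2 * d powr L \<le> k * ln (1 / d)"
proof -
  have lim: "((\<lambda>d::real. d powr q) \<longlongrightarrow> 0) (at_right 0)" if "0 < q" for q
    using that by real_asymp
  have "((\<lambda>d::real. 2 * d powr L + C * d powr p) \<longlongrightarrow> 2 * 0 + C * 0) (at_right 0)"
    by (intro tendsto_intros lim assms)
  then have "\<forall>\<^sub>F d in at_right (0::real). 2 * d powr L + C * d powr p < k"
    using assms by (intro order_tendstoD(2)) auto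
  then show "\<forall>\<^sub>F d in at_right (0::real). 2 * d powr L + C * d powr p \<le> k"
    by (auto elim: eventually_mono)
  show "\<forall>\<^sub>F d in at_right (0::real). C * (d powr p * (ln (1 / d) * (k * ln (1 / d) + 1)\<^sup>2)) \<le> 1"
    using assms by real_asymp
  show "\<forall>\<^sub>F d in at_right (0::real). b \<le> k * d powr (- L) * ln (1 / d)"
    using assms by real_asymp
  show "\<forall>\<^sub>F d in at_right (0::real). 4 * exp (- (d powr (- p))) \<le> d"
    using assms by real_asymp
  show "\<forall>\<^sub>F d in at_right (0::real). d powr p \<le> 1/2"
    using assms by real_asymp
  have "((\<lambda>d::real. C * d powr p + ln 2 * d powr L) \<longlongrightarrow> C * 0 + ln 2 * 0) (at_right 0)"
    by (intro tendsto_intros lim assms)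
  then have "\<forall>\<^sub>F d in at_right (0::real). C * d powr p + ln 2 * d powr L < 1"
    by (intro order_tendstoD(2)) auto
  moreover have "\<forall>\<^sub>F d in at_right (0::real). 1 \<le> k * ln (1 / d)"
    using assms by real_asymp
  ultimately show "\<forall>\<^sub>F d in at_right (0::real). C * d powr p + ln 2 * d powr L \<le> k * ln (1 / d)"
    by eventually_elim linarith
qed

lemma filterlim_one_minus: "filterlim (\<lambda>r::real. 1 - r) (at_right 0) (at_left 1)"
  by real_asymp

text \<open>A discrete comparison with the integral: by the weighted arithmetic--geometric mean
  inequality, \<open>m powr L / L\<close> grows by at least \<open>m powr (L - 1)\<close> when its
  argument increases to \<open>m\<close>.\<close>

lemma sum_powr_le:
  assumes L: "0 < L" "L < 1"
  shows "(\<Sum>n=1..m. real n powr (L - 1)) \<le> real m powr L / L"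
proof (induction m)
  case 0 then show ?case by simp
next
  case (Suc m)
  define x where "x = 1 / real (Suc m)"
  have x: "0 < x" "x \<le> 1" by (auto simp: x_def)
  have "(1 - x) powr L * 1 powr (1 - L) \<le> L * (1 - x) + (1 - L) * 1"
    using L x by (intro weighted_arith_geo_mean) auto
  then have b: "(1 - x) powr L \<le> 1 - L * x" by (simp add: algebra_simps)
  have "real m = real (Suc m) * (1 - x)" by (simp add: x_def field_simps)
  then have "real m powr L = real (Suc m) powr L * (1 - x) powr L"
    using x by (simp only: powr_mult[of "real (Suc m)" "1 - x"])
  also have "\<dots> \<le> real (Suc m) powr L * (1 - L * x)" using b by (intro mult_left_mono) auto
  also have "\<dots> = real (Suc m) powr L - L * (real (Suc m) powr L * x)" by (simp add: algebra_simps)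
  also have "real (Suc m) powr L * x = real (Suc m) powr (L - 1)"
    by (simp add: x_def powr_diff)
  finally have "real m powr L + L * real (Suc m) powr (L - 1) \<le> real (Suc m) powr L" by simp
  then have "(real m powr L + L * real (Suc m) powr (L - 1)) / L \<le> real (Suc m) powr L / L"
    using L by (intro divide_right_mono) auto
  then have "real m powr L / L + real (Suc m) powr (L - 1) \<le> real (Suc m) powr L / L"
    using L by (simp add: add_divide_distrib)
  then show ?case using Suc by simp
qed

lemma ln_one_minus_ge: "- (2 * x) \<le> ln (1 - x)" if "0 \<le> x" "x \<le> 1/2" for x :: real
proof -
  have "- ln (1 - x) = ln (1 / (1 - x))" using that by (simp add: ln_div)
  also have "\<dots> \<le> 1 / (1 - x) - 1" using that by (intro ln_le_minus_one) auto
  also have "\<dots> = x / (1 - x)" using that by (simp add: field_simps)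
  also have "\<dots> \<le> x / (1/2)" using that by (intro divide_left_mono) auto
  finally show ?thesis by simp
qed

lemma power_one_minus_le: "(1 - d) ^ n \<le> exp (- (d * n))" if "d \<le> 1" for d :: real
proof -
  have "(1 - d) ^ n \<le> exp (- d) ^ n" using that exp_ge_add_one_self[of "-d"] by (intro power_mono) auto
  then show ?thesis by (simp add: exp_of_nat_mult[symmetric] mult.commute)
qed

lemma power_one_minus_ge: "exp (- (2 * d * n)) \<le> (1 - d) ^ n" if "0 \<le> d" "d \<le> 1/2" for d :: real
proof -
  have "exp (- (2 * d)) \<le> exp (ln (1 - d))" using ln_one_minus_ge[OF that] by simp
  then have "exp (- (2 * d)) \<le> 1 - d" using that by simp
  then have "exp (- (2 * d)) ^ n \<le> (1 - d) ^ n" by (intro power_mono) auto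
  then show ?thesis by (simp add: exp_of_nat_mult[symmetric] mult_ac)
qed

section \<open>Variance estimates and asymptotics for power-law coefficients\<close>

locale power_law_coefficients =
  fixes a :: "nat \<Rightarrow> real" and L c1 C1 :: real
  assumes L: "0 < L" "L < 1"
    and dec: "decseq a" and apos: "\<And>n. 0 < a n" and a0: "a 0 = 1"
    and c1: "0 < c1" "c1 \<le> C1"
    and a_ge: "\<And>n. n \<ge> 1 \<Longrightarrow> c1 * real n powr (1 / 2 * (L - 1)) \<le> a n"
    and a_le: "\<And>n. n \<ge> 1 \<Longrightarrow> a n \<le> C1 * real n powr (1 / 2 * (L - 1))"
begin

lemma a_le_1: "a n \<le> 1"
  using decseqD[OF dec, of 0 n] a0 by simp

lemma powr_half_square: "(x * real n powr (1 / 2 * (L - 1)))\<^sup>2 = x\<^sup>2 * real n powr (L - 1)"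
  by (simp add: power_mult_distrib power2_eq_square[of "real n powr _"] powr_add[symmetric])

lemma a_square_ge: "n \<ge> 1 \<Longrightarrow> c1\<^sup>2 * real n powr (L - 1) \<le> (a n)\<^sup>2"
  using power_mono[OF a_ge, of n 2, unfolded powr_half_square] c1 by simp

lemma a_square_le: "n \<ge> 1 \<Longrightarrow> (a n)\<^sup>2 \<le> C1\<^sup>2 * real n powr (L - 1)"
  using power_mono[OF a_le, of n 2, unfolded powr_half_square] apos[of n] by simp

lemma variance_term_le: "0 \<le> r \<Longrightarrow> r < 1 \<Longrightarrow> (a n)\<^sup>2 * r ^ (2 * n) \<le> r ^ n"
proof -
  assume r: "0 \<le> r" "r < 1"
  have "(a n)\<^sup>2 \<le> 1" using a_le_1[of n] apos[of n] by (intro power_le_one) auto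
  then have "(a n)\<^sup>2 * r ^ (2 * n) \<le> 1 * r ^ n"
    using r by (intro mult_mono power_decreasing) auto
  then show ?thesis by simp
qed

lemma summable_variance:
  assumes "0 \<le> r" "r < 1"
  shows "summable (\<lambda>n. (a n)\<^sup>2 * r ^ (2 * n))"
  by (rule summable_comparison_test'[OF summable_geometric[of r], where N = 0])
    (use assms variance_term_le in auto)

text \<open>Controls the variance of the initial indices, which the splitting in the upper bound
  does not capture.\<close>

lemma partial_variance_le:
  assumes "0 \<le> r" "r < 1"
  shows "(\<Sum>n<m. (a n)\<^sup>2 * r ^ (2 * n)) \<le> 1 + C1\<^sup>2 * real m powr L / L"
proof (cases m)
  case 0 then show ?thesis by simp
next
  case (Suc k)
  have s: "{..<m} = insert 0 {1..k}" using Suc by auto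
  have "(\<Sum>n<m. (a n)\<^sup>2 * r ^ (2 * n)) = 1 + (\<Sum>n=1..k. (a n)\<^sup>2 * r ^ (2 * n))"
    unfolding s by (simp add: a0)
  also have "(\<Sum>n=1..k. (a n)\<^sup>2 * r ^ (2 * n)) \<le> (\<Sum>n=1..k. C1\<^sup>2 * real n powr (L - 1))"
  proof (rule sum_mono)
    fix n assume n: "n \<in> {1..k}"
    have "(a n)\<^sup>2 * r ^ (2 * n) \<le> (a n)\<^sup>2 * 1" using assms by (intro mult_left_mono power_le_one) auto
    also have "\<dots> \<le> C1\<^sup>2 * real n powr (L - 1)" using a_square_le[of n] n by simp
    finally show "(a n)\<^sup>2 * r ^ (2 * n) \<le> C1\<^sup>2 * real n powr (L - 1)" .
  qed
  also have "\<dots> = C1\<^sup>2 * (\<Sum>n=1..k. real n powr (L - 1))" by (simp add: sum_distrib_left)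
  also have "\<dots> \<le> C1\<^sup>2 * (real k powr L / L)" using sum_powr_le[OF L] by (intro mult_left_mono) auto
  also have "\<dots> \<le> C1\<^sup>2 * (real m powr L / L)"
    using L Suc by (intro mult_left_mono divide_right_mono powr_mono2) auto
  finally show ?thesis by simp
qed

text \<open>About \<open>1 / d\<close> terms are kept, with damping \<open>r ^ (2 * n)\<close> at
  least \<open>exp (- 4)\<close>; rounding \<open>1 / d\<close> down costs at most a factor
  2.\<close>

definition sigma_lower_const :: real where "sigma_lower_const = c1\<^sup>2 * exp (- 4) / 2"
text \<open>The three summands bound the term at index 0, the indices below \<open>1 / d\<close>,
  and the geometric tail beyond.\<close>

definition sigma_upper_const :: real where "sigma_upper_const = 1 + C1\<^sup>2 / L + C1\<^sup>2"

lemma sigma_consts_pos: "0 < sigma_lower_const" "0 < sigma_upper_const"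
  using c1 L by (auto simp: sigma_lower_const_def sigma_upper_const_def intro!: add_pos_nonneg)

lemma sigma_sq_ge:
  assumes r: "1/2 \<le> r" "r < 1"
  shows "sigma_lower_const * (1 - r) powr (- L) \<le> sigma_sq a r"
proof -
  define d where "d = 1 - r"
  have d: "0 < d" "d \<le> 1/2" using r by (auto simp: d_def)
  define m where "m = nat \<lfloor>1 / d\<rfloor>"
  have d2: "2 \<le> 1 / d" using d by (simp add: field_simps)
  have rm: "real m = of_int \<lfloor>1 / d\<rfloor>" using d by (simp add: m_def)
  have m: "real m \<le> 1 / d" "1 / d < real m + 1"
    unfolding rm by linarith+
  have m1: "1 \<le> m" using m(2) d2 by (cases m) auto
  have m2: "1 / (2 * d) \<le> real m" using m(2) d2 d by (simp add: field_simps)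
  have rpow: "exp (- 4) \<le> r ^ (2 * n)" if "n \<le> m" for n
  proof -
    have "2 * d * real (2 * n) \<le> 2 * d * (2 * (1 / d))"
      using m(1) that d by (intro mult_left_mono) auto
    then have "exp (- 4) \<le> exp (- (2 * d * real (2 * n)))" using d by simp
    also have "\<dots> \<le> (1 - d) ^ (2 * n)" by (rule power_one_minus_ge) (use d in auto)
    finally show ?thesis by (simp add: d_def)
  qed
  have "sigma_lower_const * d powr (- L) = c1\<^sup>2 * exp (- 4) * (1 / 2 * (1 / d) powr L)"
  proof -
    have "(1 / d) powr L = d powr (- L)" using d by (simp add: powr_divide powr_minus_divide)
    then show ?thesis by (simp add: sigma_lower_const_def)
  qed
  also have "\<dots> \<le> c1\<^sup>2 * exp (- 4) * (real m powr L)"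
  proof (intro mult_left_mono)
    have "(1 / 2) * (1 / d) powr L \<le> (1 / 2) powr L * (1 / d) powr L"
      using L powr_mono'[of L 1 "1/2"] by (intro mult_right_mono) auto
    also have "\<dots> = (1 / (2 * d)) powr L" using d by (simp add: powr_mult[symmetric])
    also have "\<dots> \<le> real m powr L" using m2 d L by (intro powr_mono2) auto
    finally show "1 / 2 * (1 / d) powr L \<le> real m powr L" .
  qed auto
  also have "\<dots> = (\<Sum>n=1..m. c1\<^sup>2 * real m powr (L - 1) * exp (- 4))"
    using m1 by (simp add: powr_diff field_simps)
  also have "\<dots> \<le> (\<Sum>n=1..m. (a n)\<^sup>2 * r ^ (2 * n))"
  proof (intro sum_mono mult_mono)
    fix n assume n: "n \<in> {1..m}"
    have "real m powr (L - 1) \<le> real n powr (L - 1)" using n L by (intro powr_mono2') auto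
    then have "c1\<^sup>2 * real m powr (L - 1) \<le> c1\<^sup>2 * real n powr (L - 1)" by (intro mult_left_mono) auto
    also have "\<dots> \<le> (a n)\<^sup>2" using n by (intro a_square_ge) auto
    finally show "c1\<^sup>2 * real m powr (L - 1) \<le> (a n)\<^sup>2" .
    show "exp (- 4) \<le> r ^ (2 * n)" by (rule rpow) (use n in auto)
  qed auto
  also have "\<dots> \<le> sigma_sq a r"
    unfolding sigma_sq_def by (rule sum_le_suminf[OF summable_variance]) (use r in auto)
  finally show ?thesis by (simp add: d_def)
qed

lemma sigma_sq_le:
  assumes r: "1/2 \<le> r" "r < 1"
  shows "sigma_sq a r \<le> sigma_upper_const * (1 - r) powr (- L)"
proof -
  define d where "d = 1 - r"
  have d: "0 < d" "d \<le> 1/2" using r by (auto simp: d_def)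
  define m where "m = nat \<lceil>1 / d\<rceil>"
  have rm: "real m = of_int \<lceil>1 / d\<rceil>" using d by (simp add: m_def)
  have m: "1 / d \<le> real m" "real m < 1 / d + 1"
    unfolding rm by linarith+
  have m1: "1 \<le> m" using m(1) d by (cases m) auto
  define g where "g n = (a n)\<^sup>2 * r ^ (2 * n)" for n
  have sg: "summable g" unfolding g_def by (rule summable_variance) (use r in auto)
  have dL: "1 \<le> d powr (- L)" using d L powr_mono'[of "-L" 0 d] by simp
  have split: "sigma_sq a r = (\<Sum>n. g (n + m)) + (\<Sum>n<m. g n)"
    unfolding sigma_sq_def g_def[symmetric] by (rule suminf_split_initial_segment[OF sg])
  obtain k where k: "m = Suc k" using m1 by (cases m) auto
  have "real k \<le> 1 / d" using m(2) k by simp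
  have sgm: "summable (\<lambda>n. g (n + m))" using sg by (simp add: summable_iff_shift)
  have rs: "(\<lambda>n. C1\<^sup>2 * d powr (1 - L) * r ^ n) sums (C1\<^sup>2 * d powr (1 - L) * (1 / (1 - r)))"
    using r by (intro sums_mult geometric_sums) auto
  \<comment> \<open>Beyond \<open>1 / d\<close> the squared coefficients are at most of order
    \<open>d powr (1 - L)\<close>, and the geometric series contributes the remaining
    \<open>1 / d\<close>.\<close>
  have "(\<Sum>n. g (n + m)) \<le> (\<Sum>n. C1\<^sup>2 * d powr (1 - L) * r ^ n)"
  proof (intro suminf_le allI sgm)
    show "summable (\<lambda>n. C1\<^sup>2 * d powr (1 - L) * r ^ n)" using rs by (rule sums_summable)
    fix n
    have nm: "1 / d \<le> real (n + m)" "1 \<le> n + m" using m(1) m1 by auto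
    have "(a (n + m))\<^sup>2 \<le> C1\<^sup>2 * real (n + m) powr (L - 1)" using nm by (intro a_square_le) auto
    also have "\<dots> \<le> C1\<^sup>2 * (1 / d) powr (L - 1)"
      using nm d L by (intro mult_left_mono powr_mono2') auto
    also have "(1 / d) powr (L - 1) = d powr (1 - L)"
      using d by (simp add: powr_divide powr_minus_divide[symmetric])
    finally have 1: "(a (n + m))\<^sup>2 \<le> C1\<^sup>2 * d powr (1 - L)" .
    have "r ^ (2 * (n + m)) \<le> r ^ n" using r by (intro power_decreasing) auto
    then show "g (n + m) \<le> C1\<^sup>2 * d powr (1 - L) * r ^ n"
      unfolding g_def using 1 r by (intro mult_mono) auto
  qed
  also have "\<dots> = C1\<^sup>2 * d powr (1 - L) * (1 / d)" using rs by (simp add: sums_iff d_def)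
  also have "\<dots> = C1\<^sup>2 * d powr (- L)"
  proof -
    have "d powr (1 - L) = d powr 1 * d powr (- L)" by (simp only: powr_add[symmetric]) simp
    then show ?thesis using d by simp
  qed
  finally have tail: "(\<Sum>n. g (n + m)) \<le> C1\<^sup>2 * d powr (- L)" .
  have "{..<m} = insert 0 {1..k}" using k by auto
  then have "(\<Sum>n<m. g n) = 1 + (\<Sum>n=1..k. g n)" by (simp add: g_def a0)
  also have "(\<Sum>n=1..k. g n) \<le> (\<Sum>n=1..k. C1\<^sup>2 * real n powr (L - 1))"
  proof (rule sum_mono)
    fix n assume n: "n \<in> {1..k}"
    have "g n \<le> (a n)\<^sup>2 * 1" unfolding g_def using r by (intro mult_left_mono power_le_one) auto
    also have "\<dots> \<le> C1\<^sup>2 * real n powr (L - 1)" using a_square_le[of n] n by simp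
    finally show "g n \<le> C1\<^sup>2 * real n powr (L - 1)" .
  qed
  also have "\<dots> = C1\<^sup>2 * (\<Sum>n=1..k. real n powr (L - 1))" by (simp add: sum_distrib_left)
  also have "\<dots> \<le> C1\<^sup>2 * (real k powr L / L)" using sum_powr_le[OF L] by (intro mult_left_mono) auto
  also have "\<dots> \<le> C1\<^sup>2 * ((1 / d) powr L / L)"
    using L \<open>real k \<le> 1 / d\<close> by (intro mult_left_mono divide_right_mono powr_mono2) auto
  also have "(1 / d) powr L = d powr (- L)" using d by (simp add: powr_divide powr_minus_divide)
  finally have head: "(\<Sum>n<m. g n) \<le> 1 + C1\<^sup>2 * (d powr (- L) / L)" by simp
  have "sigma_sq a r \<le> C1\<^sup>2 * d powr (- L) + (1 + C1\<^sup>2 * (d powr (- L) / L))"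
    unfolding split using tail head by linarith
  also have "\<dots> \<le> C1\<^sup>2 * d powr (- L) + (d powr (- L) + C1\<^sup>2 * (d powr (- L) / L))" using dL by simp
  also have "\<dots> = sigma_upper_const * d powr (- L)" by (simp add: sigma_upper_const_def algebra_simps)
  finally show ?thesis by (simp add: d_def)
qed

lemma eventually_near_1: "\<forall>\<^sub>F r in at_left (1::real). 1/2 < r \<and> r < 1"
  using eventually_at_left_real[of "1/2" "1::real"] by (auto elim!: eventually_mono)

lemma hole_probability_upper_asymptotic:
  assumes eps: "0 < \<epsilon>" "\<epsilon> < (1 - L) / 2"
  shows "\<forall>\<^sub>F r in at_left 1. measure gseq (Hole gseq coord a r)
    \<le> exp (- (((1 - L) / 2 - 2 * \<epsilon>) * (sigma_sq a r * ln (1 / (1 - r)))))"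
proof -
  \<comment> \<open>\<open>A\<^sup>2\<close> will be \<open>\<tau> * \<sigma> * ld\<close>. The
    slightly larger \<open>s\<close> leaves room for \<open>s2 < \<sigma>\<close>, giving
    \<open>X \<le> s * ld\<close>; \<open>k\<close> below measures the loss of variance this room
    permits.\<close>
  define \<tau> where "\<tau> = (1 - L) / 2 - \<epsilon>"
  have \<tau>: "0 < \<tau>" using eps by (simp add: \<tau>_def)
  define s where "s = \<tau> + \<epsilon> / 2"
  have s: "0 < s" "\<tau> < s" using \<tau> eps by (auto simp: s_def)
  define k where "k = (1 - \<tau> / s) * sigma_lower_const"
  have k: "0 < k" using s sigma_consts_pos by (simp add: k_def)
  define \<eta> where "\<eta> = \<epsilon> / 2"
  have \<eta>: "0 < \<eta>" "\<eta> < 1" using eps L by (auto simp: \<eta>_def)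
  \<comment> \<open>\<open>C'\<close> collects the constants of the variance of the first
    \<open>2 * N\<close> terms, and \<open>C''\<close> those of the comparison of
    \<open>4 * log_var_const * A\<^sup>2\<close> with \<open>N * e\<^sup>2\<close>.\<close>
  define C' where "C' = 4 * C1\<^sup>2 / L"
  have C': "0 < C'" using c1 L by (simp add: C'_def)
  define C'' where "C'' = 16 * log_var_const * \<tau> * sigma_upper_const * exp 2"
  have C'': "0 < C''" using log_var_const_ge_1 \<tau> sigma_consts_pos by (simp add: C''_def)
  have pe: "0 < L * \<eta>" "0 < \<epsilon> / 2" "0 < \<epsilon> * sigma_lower_const" using L \<eta> eps sigma_consts_pos by auto
  note ev1 = eventually_compose_filterlim[OF eventually_at_right_0_asymptotics(1)[OF L(1) pe(1) k C'] filterlim_one_minus]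
  note ev2 = eventually_compose_filterlim[OF eventually_at_right_0_asymptotics(2)[OF L(1) pe(2) s(1) C''] filterlim_one_minus]
  note ev3 = eventually_compose_filterlim[OF eventually_at_right_0_asymptotics(3)[OF L(1) pe(2) pe(3) C'', of "ln 2"] filterlim_one_minus]
  show ?thesis
    using eventually_near_1 ev1 ev2 ev3
  proof eventually_elim
    case (elim r)
    define d where "d = 1 - r"
    define ld where "ld = ln (1 / d)"
    have r: "1/2 < r" "r < 1" and d: "0 < d" "d < 1/2" using elim(1) by (auto simp: d_def)
    have e1: "2 * d powr L + C' * d powr (L * \<eta>) \<le> k"
      and e2: "C'' * (d powr (\<epsilon> / 2) * (ld * (s * ld + 1)\<^sup>2)) \<le> 1"
      and e3: "ln 2 \<le> \<epsilon> * sigma_lower_const * d powr (- L) * ld"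
      using elim(2-4) by (simp_all add: d_def ld_def)
    have ld: "0 < ld" using d by (simp add: ld_def)
    have expl: "exp (x * ld) = d powr (- x)" for x
      using d by (simp add: ld_def powr_def ln_div)
    define \<sigma> where "\<sigma> = sigma_sq a r"
    define D where "D = d powr (- L)"
    have D: "0 < D" using d by (simp add: D_def)
    have \<sigma>: "sigma_lower_const * D \<le> \<sigma>" "\<sigma> \<le> sigma_upper_const * D"
      using sigma_sq_ge[of r] sigma_sq_le[of r] r by (auto simp: \<sigma>_def D_def d_def)
    have \<sigma>0: "0 < \<sigma>" using \<sigma>(1) sigma_consts_pos(1) D by (smt (verit) mult_pos_pos)
    \<comment> \<open>Smaller than \<open>1 / d\<close> by the factor \<open>d powr \<eta>\<close>,
      up to rounding, so that the first \<open>2 * N\<close> terms carry only a share of order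
      \<open>d powr (L * \<eta>)\<close> of the variance, apart from the term at index 0.\<close>
    define N where "N = nat \<lceil>d powr (\<eta> - 1)\<rceil>"
    have p1: "1 \<le> d powr (\<eta> - 1)" using d \<eta> powr_mono'[of "\<eta> - 1" 0 d] by simp
    then have rN: "real N = of_int \<lceil>d powr (\<eta> - 1)\<rceil>" by (simp add: N_def)
    have N: "d powr (\<eta> - 1) \<le> real N" "real N \<le> 2 * d powr (\<eta> - 1)" unfolding rN using p1 by linarith+
    have N1: "1 \<le> N" using N(1) p1 by (cases N) auto
    \<comment> \<open>Large enough that the variance beyond the last block is at most 1, because
      \<open>r ^ J \<le> exp (- (1 / d)) \<le> d\<close>.\<close>
    define Mb where "Mb = nat \<lceil>1 / d\<^sup>2\<rceil>"
    have Mb: "1 / d\<^sup>2 \<le> real Mb" by (simp add: Mb_def of_nat_ceiling)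
    have "0 < 1 / d\<^sup>2" using d by simp
    then have Mb1: "1 \<le> Mb" using Mb by (cases Mb) auto
    define A where "A = sqrt (\<tau> * \<sigma> * ld)"
    have A: "0 \<le> A" "A\<^sup>2 = \<tau> * \<sigma> * ld" using \<tau> \<sigma>0 ld by (auto simp: A_def)
    define s2 where "s2 = real N * (\<Sum>m=1..Mb. (a ((m+1)*N) * r ^ ((m+1)*N))\<^sup>2)"
    define g where "g n = (a n)\<^sup>2 * r ^ (2 * n)" for n
    have sg: "summable g" unfolding g_def by (rule summable_variance) (use r in auto)
    define J where "J = (Mb + 2) * N"
    have J: "1 / d\<^sup>2 \<le> real J"
    proof -
      have "real Mb * 1 \<le> real (Mb + 2) * real N" using N1 by (intro mult_mono) auto
      moreover have "real J = real (Mb + 2) * real N" by (simp only: J_def of_nat_mult)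
      ultimately show ?thesis using Mb by linarith
    qed
    have tail: "(\<Sum>n. g (n + J)) \<le> 1"
    proof -
      have rs: "(\<lambda>n. r ^ J * r ^ n) sums (r ^ J * (1 / (1 - r)))"
        using r by (intro sums_mult geometric_sums) auto
      have "(\<Sum>n. g (n + J)) \<le> (\<Sum>n. r ^ J * r ^ n)"
      proof (intro suminf_le allI)
        show "g (n + J) \<le> r ^ J * r ^ n" for n
          using variance_term_le[of r "n + J"] r by (simp add: g_def power_add mult.commute)
        show "summable (\<lambda>n. g (n + J))" using sg by (simp add: summable_iff_shift)
        show "summable (\<lambda>n. r ^ J * r ^ n)" using rs by (rule sums_summable)
      qed
      also have "\<dots> = r ^ J / d" using rs by (simp add: sums_iff d_def)
      also have "r ^ J \<le> exp (- (d * J))" using power_one_minus_le[of d J] d by (simp add: d_def)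
      also have "d * J \<ge> 1 / d" using mult_left_mono[OF J, of d] d by (simp add: power2_eq_square)
      then have "exp (- (d * J)) \<le> exp (- (1 / d))" by simp
      also have "\<dots> \<le> d"
      proof -
        have "1 / d \<le> exp (1 / d)" using exp_ge_add_one_self[of "1/d"] by linarith
        then show ?thesis using d by (simp add: exp_minus field_simps)
      qed
      finally show ?thesis using d by (simp add: divide_right_mono)
    qed
    have head: "(\<Sum>n<2*N. g n) \<le> 1 + C' * (D * d powr (L * \<eta>))"
    proof -
      have "(\<Sum>n<2*N. g n) \<le> 1 + C1\<^sup>2 * real (2 * N) powr L / L"
        unfolding g_def by (rule partial_variance_le) (use r in auto)
      also have "real (2 * N) powr L \<le> (4 * d powr (\<eta> - 1)) powr L"
        using N L by (intro powr_mono2) auto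
      also have "\<dots> = 4 powr L * d powr ((\<eta> - 1) * L)" by (simp add: powr_mult powr_powr)
      also have "d powr ((\<eta> - 1) * L) = D * d powr (L * \<eta>)"
        by (simp add: D_def powr_add[symmetric] algebra_simps)
      also have "4 powr L * (D * d powr (L * \<eta>)) \<le> 4 * (D * d powr (L * \<eta>))"
        using L D powr_mono[of L 1 4] by (intro mult_right_mono) auto
      finally show ?thesis using L c1 by (simp add: C'_def divide_right_mono mult_left_mono field_simps)
    qed
    \<comment> \<open>The value used for block \<open>m\<close> is taken at its right end and so
      dominates the terms of the next block. This shift by \<open>N\<close>, in addition to the
      omitted block 0, is why \<open>2 * N\<close> initial terms are lost.\<close>
    have middle: "(\<Sum>n\<in>{2*N..<J}. g n) \<le> s2"
    proof -
      have "(\<Sum>n\<in>{2*N..<J}. g n) = (\<Sum>n\<in>{N..<(Mb+1)*N}. g (n + N))"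
      proof -
        have "2 * N = N + N" "J = (Mb+1)*N + N" by (auto simp: J_def)
        then show ?thesis by (simp only: sum.shift_bounds_nat_ivl)
      qed
      also have "\<dots> = (\<Sum>m=1..Mb. \<Sum>i<N. g (m * N + i + N))" by (rule sum_blocks)
      also have "\<dots> \<le> (\<Sum>m=1..Mb. \<Sum>i<N. (a ((m+1)*N) * r ^ ((m+1)*N))\<^sup>2)"
      proof (intro sum_mono)
        fix m i
        have le: "(m+1)*N \<le> m * N + i + N" by simp
        have "a (m * N + i + N) * r ^ (m * N + i + N) \<le> a ((m+1)*N) * r ^ ((m+1)*N)"
        proof (rule mult_mono)
          show "a (m * N + i + N) \<le> a ((m+1)*N)" by (rule decseqD[OF dec le])
          show "r ^ (m * N + i + N) \<le> r ^ ((m+1)*N)" by (rule power_decreasing[OF le]) (use r in auto)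
        qed (use r less_imp_le[OF apos] in auto)
        then have "(a (m * N + i + N) * r ^ (m * N + i + N))\<^sup>2 \<le> (a ((m+1)*N) * r ^ ((m+1)*N))\<^sup>2"
          by (rule power_mono) (use r less_imp_le[OF apos] in auto)
        then show "g (m * N + i + N) \<le> (a ((m+1)*N) * r ^ ((m+1)*N))\<^sup>2"
          by (simp only: g_def power_mult_distrib power_even_eq)
      qed
      also have "\<dots> = s2" by (simp add: s2_def sum_distrib_left)
      finally show ?thesis .
    qed
    have "\<sigma> = (\<Sum>n. g (n + J)) + (\<Sum>n<J. g n)"
      unfolding \<sigma>_def sigma_sq_def g_def[symmetric] by (rule suminf_split_initial_segment[OF sg])
    also have "(\<Sum>n<J. g n) = (\<Sum>n<2*N. g n) + (\<Sum>n\<in>{2*N..<J}. g n)"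
      unfolding lessThan_atLeast0 by (rule sum.atLeastLessThan_concat[symmetric]) (auto simp: J_def)
    finally have "\<sigma> \<le> s2 + (2 + C' * (D * d powr (L * \<eta>)))" using tail head middle by linarith
    also have "2 + C' * (D * d powr (L * \<eta>)) = D * (2 * d powr L + C' * d powr (L * \<eta>))"
    proof -
      have "D * d powr L = 1" using d by (simp add: D_def powr_add[symmetric])
      then show ?thesis by (simp add: distrib_left mult.left_commute)
    qed
    also have "\<dots> \<le> D * k" using e1 D by (intro mult_left_mono) auto
    also have "\<dots> = (1 - \<tau> / s) * (sigma_lower_const * D)" by (simp add: k_def)
    also have "\<dots> \<le> (1 - \<tau> / s) * \<sigma>" using \<sigma>(1) s by (intro mult_left_mono) auto
    finally have s2: "\<tau> / s * \<sigma> \<le> s2" by (simp add: algebra_simps)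
    have s20: "0 < s2" using s2 \<tau> s \<sigma>0 by (smt (verit) divide_pos_pos mult_pos_pos)
    define X where "X = A\<^sup>2 / s2"
    define e where "e = exp (- (X + 1)) / (2 * (X + 1))"
    have X0: "0 \<le> X" using s20 by (simp add: X_def)
    have X: "X \<le> s * ld"
    proof -
      have "s * (\<tau> / s * \<sigma>) \<le> s * s2" using s2 s by (intro mult_left_mono) auto
      then have "\<tau> * \<sigma> \<le> s * s2" using s by simp
      then have "\<tau> * \<sigma> * ld \<le> s * s2 * ld" using ld by (intro mult_right_mono) auto
      then show ?thesis unfolding X_def A(2) using s20 by (simp add: field_simps)
    qed
    have "measure gseq (Hole gseq coord a r) \<le> exp (- (A\<^sup>2)) + exp (- (N * e\<^sup>2 / (4 * log_var_const)))"
      by (rule hole_probability_upper[OF dec apos a0 _ r(2) N1 Mb1 A(1) s2_def X_def e_def]) (use r in auto)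
    also have "A\<^sup>2 \<le> N * e\<^sup>2 / (4 * log_var_const)"
    proof -
      define X' where "X' = s * ld + 1"
      have X': "1 \<le> X'" using s ld by (simp add: X'_def)
      have "exp (- X') / (2 * X') \<le> e"
        unfolding e_def using X X0 by (intro frac_le) (auto simp: X'_def)
      then have "(exp (- X') / (2 * X'))\<^sup>2 \<le> e\<^sup>2" using X' by (intro power_mono) auto
      also have "(exp (- X') / (2 * X'))\<^sup>2 = exp (- 2) * exp ((- 2 * s) * ld) / (4 * X'\<^sup>2)"
      proof -
        have "(exp (- X'))\<^sup>2 = exp (- 2) * exp ((- 2 * s) * ld)"
          by (simp add: exp_double[symmetric] exp_add[symmetric] X'_def algebra_simps)
        then show ?thesis by (simp only: power_divide power_mult_distrib) simp
      qed
      also have "exp ((- 2 * s) * ld) = d powr (2 * s)" unfolding expl by simp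
      finally have e2': "exp (- 2) * d powr (2 * s) / (4 * X'\<^sup>2) \<le> e\<^sup>2" .
      have "d powr (\<eta> - 1) * (exp (- 2) * d powr (2 * s) / (4 * X'\<^sup>2)) \<le> N * e\<^sup>2"
        using N(1) e2' by (intro mult_mono) auto
      moreover have "d powr (\<eta> - 1) * (exp (- 2) * d powr (2 * s) / (4 * X'\<^sup>2)) = exp (- 2) * (D * d powr (- (\<epsilon> / 2))) / (4 * X'\<^sup>2)"
      proof -
        have "d powr (\<eta> - 1) * d powr (2 * s) = D * d powr (- (\<epsilon> / 2))"
        proof -
          \<comment> \<open>The exponent of \<open>d\<close> in \<open>N * e\<^sup>2\<close> is
            \<open>- L - \<epsilon> / 2\<close>: the margin
            \<open>d powr (- (\<epsilon> / 2))\<close> over \<open>A\<^sup>2\<close> absorbs all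
            logarithmic factors.\<close>
          have "(\<eta> - 1) + 2 * s = - L + - (\<epsilon> / 2)" by (simp add: \<eta>_def s_def \<tau>_def field_simps)
          then show ?thesis unfolding D_def by (simp only: powr_add[symmetric])
        qed
        then show ?thesis by (simp add: mult_ac)
      qed
      ultimately have Ne: "exp (- 2) * (D * d powr (- (\<epsilon> / 2))) / (4 * X'\<^sup>2) \<le> N * e\<^sup>2" by linarith
      have "C'' * (d powr (\<epsilon> / 2) * (ld * X'\<^sup>2)) \<le> 1" using e2 by (simp add: X'_def)
      then have "d powr (- (\<epsilon> / 2)) * (C'' * (d powr (\<epsilon> / 2) * (ld * X'\<^sup>2))) \<le> d powr (- (\<epsilon> / 2)) * 1"
        by (intro mult_left_mono) auto
      moreover have "d powr (- (\<epsilon> / 2)) * (C'' * (d powr (\<epsilon> / 2) * (ld * X'\<^sup>2))) = (d powr (- (\<epsilon> / 2)) * d powr (\<epsilon> / 2)) * (C'' * (ld * X'\<^sup>2))"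
        by (simp only: mult_ac)
      moreover have "d powr (- (\<epsilon> / 2)) * d powr (\<epsilon> / 2) = 1" using d by (simp add: powr_add[symmetric])
      ultimately have CX: "C'' * (ld * X'\<^sup>2) \<le> d powr (- (\<epsilon> / 2))" by simp
      have lv: "0 < log_var_const" using log_var_const_ge_1 by linarith
      have "4 * log_var_const * A\<^sup>2 \<le> 4 * log_var_const * (\<tau> * (sigma_upper_const * D) * ld)"
        unfolding A(2) using \<sigma>(2) \<tau> ld lv by (intro mult_left_mono mult_right_mono) auto
      also have "\<dots> = exp (- 2) * D / (4 * X'\<^sup>2) * (C'' * (ld * X'\<^sup>2))"
        using X' by (simp add: C''_def exp_minus field_simps)
      also have "\<dots> \<le> exp (- 2) * D / (4 * X'\<^sup>2) * d powr (- (\<epsilon> / 2))"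
        using CX D by (intro mult_left_mono) auto
      also have "\<dots> = exp (- 2) * (D * d powr (- (\<epsilon> / 2))) / (4 * X'\<^sup>2)" by simp
      also have "\<dots> \<le> N * e\<^sup>2" by (rule Ne)
      finally show ?thesis using lv by (simp add: field_simps)
    qed
    \<comment> \<open>Both terms are now at most \<open>exp (- (A\<^sup>2))\<close>. The resulting
      factor 2 is absorbed by giving up the second \<open>\<epsilon>\<close> in the
      exponent.\<close>
    then have "exp (- (A\<^sup>2)) + exp (- (N * e\<^sup>2 / (4 * log_var_const))) \<le> exp (ln 2) * exp (- (A\<^sup>2))" by simp
    also have "\<dots> = exp (ln 2 - A\<^sup>2)" by (simp add: exp_diff exp_minus divide_inverse)
    also have "\<dots> \<le> exp (- (((1 - L) / 2 - 2 * \<epsilon>) * (\<sigma> * ld)))"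
    proof -
      have "ln 2 \<le> \<epsilon> * (sigma_lower_const * D) * ld" using e3 by (simp add: D_def mult_ac)
      also have "\<dots> \<le> \<epsilon> * \<sigma> * ld" using \<sigma>(1) eps ld by (intro mult_left_mono mult_right_mono) auto
      finally have "ln 2 - A\<^sup>2 \<le> \<epsilon> * \<sigma> * ld - \<tau> * \<sigma> * ld" unfolding A(2) by linarith
      also have "\<dots> = - (((1 - L) / 2 - 2 * \<epsilon>) * (\<sigma> * ld))" by (simp add: \<tau>_def field_simps)
      finally show ?thesis by simp
    qed
    finally show ?case by (simp add: \<sigma>_def ld_def d_def)
  qed
qed

lemma hole_probability_lower_asymptotic:
  assumes eps: "0 < \<epsilon>"
  shows "\<forall>\<^sub>F r in at_left 1. exp (- ((1 - L + 2 * \<epsilon>) * (sigma_sq a r * ln (1 / (1 - r)))))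
    \<le> measure gseq (Hole gseq coord a r)"
proof -
  define \<tau> where "\<tau> = 1 - L + \<epsilon>"
  have \<tau>: "0 < \<tau>" "0 < \<tau> - \<epsilon> / 2" using eps L by (auto simp: \<tau>_def)
  \<comment> \<open>\<open>t\<close> will lose one factor \<open>q\<close> for the passage from the
    grid to the disc and one for the additive 1 in \<open>t / \<kappa> + 1 \<le> A\<close>. Squaring
    turns these into \<open>q ^ 4\<close>, so that \<open>t\<^sup>2 / \<sigma>\<close> is still at
    least \<open>(\<tau> - \<epsilon> / 2) * ld\<close>.\<close>
  define q where "q = ((\<tau> - \<epsilon> / 2) / \<tau>) powr (1/4)"
  have q4: "q ^ 4 = (\<tau> - \<epsilon> / 2) / \<tau>"
    using \<tau> unfolding q_def by (subst powr_power) auto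
  have q: "0 < q" "q < 1"
  proof -
    show "0 < q" using \<tau> by (simp add: q_def)
    show "q < 1"
    proof (rule ccontr)
      assume "\<not> q < 1"
      then have "1 \<le> q ^ 4" by (intro one_le_power) auto
      then show False unfolding q4 using \<tau> eps by simp
    qed
  qed
  \<comment> \<open>The oversampling factor: a grid of \<open>N = H * K\<close> points makes the
    loss factor \<open>\<kappa>\<close> at least \<open>q\<close>, with \<open>H\<close> independent
    of \<open>r\<close>.\<close>
  obtain H :: nat where H: "2 * pi * exp 1 / (1 - q) < real H" using reals_Archimedean2 by blast
  have "0 < 2 * pi * exp 1 / (1 - q)" using q by simp
  then have H0: "0 < real H" using H by linarith
  define \<kappa> where "\<kappa> = 1 - 2 * pi * exp 1 / H"
  have \<kappa>: "q \<le> \<kappa>"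
  proof -
    have "2 * pi * exp 1 \<le> real H * (1 - q)" using H q by (simp add: pos_divide_less_eq)
    then have "2 * pi * exp 1 / H \<le> 1 - q" using H0 by (simp add: pos_divide_le_eq mult.commute)
    then show ?thesis by (simp add: \<kappa>_def)
  qed
  \<comment> \<open>\<open>K\<close> will be about \<open>d powr (- 1 - \<eta>)\<close>, enough for
    \<open>r ^ K \<le> exp (- (d powr (- \<eta>)))\<close>. Multiplied by the failure probability
    \<open>d powr (1 - L + \<epsilon> / 2)\<close>, it gives \<open>d powr (- L + \<eta>)\<close>,
    which is negligible against \<open>A\<^sup>2\<close>.\<close>
  define \<eta> where "\<eta> = \<epsilon> / 4"
  have pe: "0 < \<eta>" "0 < 1 - L + \<epsilon> / 2" "0 < \<tau> * sigma_lower_const" "0 < \<epsilon> * sigma_lower_const" "0 < 4 * real H"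
    using L eps \<tau> sigma_consts_pos H0 by (auto simp: \<eta>_def)
  note ev3 = eventually_compose_filterlim[OF eventually_at_right_0_asymptotics(3)[OF L(1) pe(1) pe(3) pe(5), of "1 / (1 - q)\<^sup>2"] filterlim_one_minus]
  note ev4 = eventually_compose_filterlim[OF eventually_at_right_0_asymptotics(4)[OF L(1) pe(1) pe(3) pe(5)] filterlim_one_minus]
  note ev5 = eventually_compose_filterlim[OF eventually_at_right_0_asymptotics(5)[OF L(1) pe(2) pe(3) pe(5)] filterlim_one_minus]
  note ev6 = eventually_compose_filterlim[OF eventually_at_right_0_asymptotics(6)[OF L(1) pe(1) pe(4) pe(5)] filterlim_one_minus]
  show ?thesis
    using eventually_near_1 ev3 ev4 ev5 ev6
  proof eventually_elim
    case (elim r)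
    define d where "d = 1 - r"
    define ld where "ld = ln (1 / d)"
    have r: "1/2 < r" "r < 1" and d: "0 < d" "d < 1/2" using elim(1) by (auto simp: d_def)
    have e3: "1 / (1 - q)\<^sup>2 \<le> \<tau> * sigma_lower_const * d powr (- L) * ld"
      and e4: "4 * exp (- (d powr (- \<eta>))) \<le> d"
      and e5: "d powr (1 - L + \<epsilon> / 2) \<le> 1/2"
      and e6: "4 * real H * d powr \<eta> + ln 2 * d powr L \<le> \<epsilon> * sigma_lower_const * ld"
      using elim(2-5) by (simp_all add: d_def ld_def)
    have ld: "0 < ld" using d by (simp add: ld_def)
    define \<sigma> where "\<sigma> = sigma_sq a r"
    define D where "D = d powr (- L)"
    have D: "0 < D" using d by (simp add: D_def)
    have \<sigma>: "sigma_lower_const * D \<le> \<sigma>"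
      using sigma_sq_ge[of r] r by (auto simp: \<sigma>_def D_def d_def)
    have \<sigma>0: "0 < \<sigma>" using \<sigma> sigma_consts_pos(1) D by (smt (verit) mult_pos_pos)
    define A where "A = sqrt (\<tau> * \<sigma> * ld)"
    have A2: "A\<^sup>2 = \<tau> * \<sigma> * ld" and A0: "0 \<le> A" using \<tau> \<sigma>0 ld by (auto simp: A_def)
    \<comment> \<open>The additive 1 costs at most the factor \<open>q\<close> once \<open>A\<close>
      is at least \<open>1 / (1 - q)\<close>, which the growth of \<open>A\<close> ensures.\<close>
    have A: "q * A \<le> A - 1"
    proof -
      have "1 / (1 - q)\<^sup>2 \<le> \<tau> * (sigma_lower_const * D) * ld" using e3 by (simp add: D_def mult_ac)
      also have "\<dots> \<le> A\<^sup>2" unfolding A2 using \<sigma> \<tau> ld by (intro mult_right_mono mult_left_mono) auto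
      finally have "(1 / (1 - q))\<^sup>2 \<le> A\<^sup>2" by (simp add: power_divide)
      then have "1 / (1 - q) \<le> A" using A0 by (rule power2_le_imp_le)
      then show ?thesis using q by (simp add: field_simps)
    qed
    define t where "t = \<kappa> * (A - 1)"
    have t1: "q * (q * A) \<le> t" unfolding t_def using A \<kappa> q A0 by (intro mult_mono) auto
    then have t0: "0 \<le> t" using q A0 by (smt (verit) mult_nonneg_nonneg)
    define K where "K = nat \<lceil>d powr (- 1 - \<eta>)\<rceil>"
    have p1: "1 \<le> d powr (- 1 - \<eta>)" using d pe(1) powr_mono'[of "- 1 - \<eta>" 0 d] by simp
    then have rK: "real K = of_int \<lceil>d powr (- 1 - \<eta>)\<rceil>" by (simp add: K_def)
    have K: "d powr (- 1 - \<eta>) \<le> real K" "real K \<le> 2 * d powr (- 1 - \<eta>)" unfolding rK using p1 by linarith+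
    have K1: "1 \<le> K" using K(1) p1 by (cases K) auto
    define N where "N = H * K"
    have N1: "1 \<le> N" using H0 K1 by (cases H) (auto simp: N_def)
    have \<kappa>N: "\<kappa> = 1 - 2 * pi * exp 1 * K / N" using K1 H0 by (simp add: \<kappa>_def N_def)
    have tl: "4 * r ^ Suc K \<le> 1 - r"
    proof -
      have "r ^ Suc K \<le> r ^ K" using r by (intro power_decreasing) auto
      also have "\<dots> \<le> exp (- (d * K))" using power_one_minus_le[of d K] d by (simp add: d_def)
      also have "d powr (- \<eta>) \<le> d * K"
      proof -
        have "d powr (- \<eta>) = d powr 1 * d powr (- 1 - \<eta>)" by (simp only: powr_add[symmetric]) simp
        also have "\<dots> \<le> d * K" using K(1) d by simp
        finally show ?thesis .
      qed
      then have "exp (- (d * K)) \<le> exp (- (d powr (- \<eta>)))" by simp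
      finally show ?thesis using e4 by (simp add: d_def)
    qed
    have V: "(\<Sum>n=1..K. (a n)\<^sup>2 * r ^ (2 * n)) \<le> \<sigma>"
      unfolding \<sigma>_def sigma_sq_def by (rule sum_le_suminf[OF summable_variance]) (use r in auto)
    have "exp (- (A\<^sup>2)) * (1 - exp (- (t\<^sup>2 / \<sigma>))) ^ N / 2 \<le> measure gseq (Hole gseq coord a r)"
    proof (rule hole_probability_lower[OF dec apos a0 _ r(2) K1 N1 \<kappa>N _ _ t0 \<sigma>0 V tl])
      show "0 < \<kappa>" using \<kappa> q by linarith
      then show "t / \<kappa> + 1 \<le> A" by (simp add: t_def)
    qed (use r in auto)
    moreover
    define x where "x = d powr (1 - L + \<epsilon> / 2)"
    have x: "0 \<le> x" "x \<le> 1/2" using e5 by (auto simp: x_def)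
    have "exp (- (t\<^sup>2 / \<sigma>)) \<le> x"
    proof -
      have "(q * (q * A))\<^sup>2 \<le> t\<^sup>2" using t1 q A0 by (intro power_mono) auto
      moreover have "(q * (q * A))\<^sup>2 = q ^ 4 * A\<^sup>2" by (simp add: power_mult_distrib power4_eq_xxxx power2_eq_square)
      moreover have "\<dots> = (\<tau> - \<epsilon> / 2) * ld * \<sigma>" unfolding q4 A2 using \<tau> by simp
      ultimately have "(\<tau> - \<epsilon> / 2) * ld * \<sigma> \<le> t\<^sup>2" by linarith
      then have "(\<tau> - \<epsilon> / 2) * ld \<le> t\<^sup>2 / \<sigma>" using \<sigma>0 by (simp add: pos_le_divide_eq)
      then have "exp (- (t\<^sup>2 / \<sigma>)) \<le> exp (- ((\<tau> - \<epsilon> / 2) * ld))" by simp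
      also have "\<dots> = d powr (\<tau> - \<epsilon> / 2)" using d by (simp add: ld_def powr_def ln_div)
      also have "\<tau> - \<epsilon> / 2 = 1 - L + \<epsilon> / 2" by (simp add: \<tau>_def)
      finally show ?thesis by (simp add: x_def)
    qed
    then have "(1 - x) ^ N \<le> (1 - exp (- (t\<^sup>2 / \<sigma>))) ^ N" using x by (intro power_mono) auto
    moreover have "exp (- (2 * x * N)) \<le> (1 - x) ^ N" by (rule power_one_minus_ge) (use x in auto)
    ultimately have "exp (- (A\<^sup>2)) * exp (- (2 * x * N)) / 2 \<le> measure gseq (Hole gseq coord a r)"
      by (smt (verit) divide_right_mono exp_ge_zero mult_left_mono)
    moreover have "exp (- ((1 - L + 2 * \<epsilon>) * (\<sigma> * ld))) \<le> exp (- (A\<^sup>2)) * exp (- (2 * x * N)) / 2"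
    proof -
      have "2 * x * N \<le> 4 * real H * (D * d powr \<eta>)"
      proof -
        have "2 * x * N = 2 * real H * (x * real K)" by (simp add: N_def)
        also have "\<dots> \<le> 2 * real H * (x * (2 * d powr (- 1 - \<eta>)))"
          using K(2) x by (intro mult_left_mono) auto
        also have "\<dots> = 4 * real H * (x * d powr (- 1 - \<eta>))" by simp
        also have "x * d powr (- 1 - \<eta>) = D * d powr \<eta>"
        proof -
          have "(1 - L + \<epsilon> / 2) + (- 1 - \<eta>) = - L + \<eta>" by (simp add: \<eta>_def)
          then show ?thesis unfolding x_def D_def by (simp only: powr_add[symmetric])
        qed
        finally show ?thesis .
      qed
      moreover have "D * (4 * real H * d powr \<eta> + ln 2 * d powr L) \<le> D * (\<epsilon> * sigma_lower_const * ld)"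
        using e6 D by (intro mult_left_mono) auto
      moreover have "D * (4 * real H * d powr \<eta> + ln 2 * d powr L) = 4 * real H * (D * d powr \<eta>) + ln 2"
      proof -
        have "D * d powr L = 1" using d by (simp add: D_def powr_add[symmetric])
        then show ?thesis by (simp add: distrib_left mult.left_commute)
      qed
      moreover have "D * (\<epsilon> * sigma_lower_const * ld) = \<epsilon> * (sigma_lower_const * D) * ld" by (simp only: mult_ac)
      moreover have "\<epsilon> * (sigma_lower_const * D) * ld \<le> \<epsilon> * \<sigma> * ld"
        using \<sigma> eps ld by (intro mult_right_mono mult_left_mono) auto
      ultimately have "A\<^sup>2 + 2 * x * N + ln 2 \<le> \<tau> * \<sigma> * ld + \<epsilon> * \<sigma> * ld" unfolding A2 by linarith
      also have "\<dots> = (1 - L + 2 * \<epsilon>) * (\<sigma> * ld)" by (simp add: \<tau>_def algebra_simps)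
      finally have "exp (- ((1 - L + 2 * \<epsilon>) * (\<sigma> * ld))) \<le> exp (- (A\<^sup>2) + - (2 * x * N) - ln 2)" by simp
      also have "\<dots> = exp (- (A\<^sup>2)) * exp (- (2 * x * N)) / 2" by (simp only: exp_diff exp_add) simp
      finally show ?thesis .
    qed
    ultimately show ?case by (simp add: \<sigma>_def ld_def d_def)
  qed
qed

lemma eventually_sigma_sq_ln_pos: "\<forall>\<^sub>F r in at_left 1. 0 < sigma_sq a r * ln (1 / (1 - r))"
  using eventually_near_1
proof eventually_elim
  case (elim r)
  then have "0 < sigma_lower_const * (1 - r) powr (- L)" using sigma_consts_pos by simp
  then have "0 < sigma_sq a r" using sigma_sq_ge[of r] elim by linarith
  moreover have "0 < ln (1 / (1 - r))" using elim by (intro ln_gt_zero) (simp add: field_simps)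
  ultimately show ?case by simp
qed

end

text \<open>Converts bounds valid for every fixed \<open>\<epsilon>\<close> into error functions
  tending to 0. The upper bound on \<open>P\<close> is assumed only for
  \<open>\<epsilon> < \<alpha>\<close>, so the proof of the limit caps its choice of
  \<open>\<epsilon>\<close> at \<open>\<alpha> / 2\<close>.\<close>

lemma asymptotic_coefficients_from_ratio:
  fixes P S :: "real \<Rightarrow> real" and \<alpha> \<beta> :: real
  assumes \<alpha>: "0 < \<alpha>"
    and S: "\<forall>\<^sub>F r in F. 0 < S r"
    and upper: "\<And>\<epsilon>. 0 < \<epsilon> \<Longrightarrow> \<epsilon> < \<alpha> \<Longrightarrow> \<forall>\<^sub>F r in F. P r \<le> exp (- ((\<alpha> - 2 * \<epsilon>) * S r))"
    and lower: "\<And>\<epsilon>. 0 < \<epsilon> \<Longrightarrow> \<forall>\<^sub>F r in F. exp (- ((\<beta> + 2 * \<epsilon>) * S r)) \<le> P r"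
  shows "\<exists>\<delta>1 \<delta>2. (\<delta>1 \<longlongrightarrow> 0) F \<and> (\<delta>2 \<longlongrightarrow> 0) F \<and>
    (\<forall>\<^sub>F r in F. 0 < P r \<and> (\<alpha> + \<delta>1 r) * S r \<le> - ln (P r) \<and> - ln (P r) \<le> (\<beta> + \<delta>2 r) * S r)"
proof -
  define Q where "Q r = - ln (P r) / S r" for r
  have lo: "\<forall>\<^sub>F r in F. 0 < P r \<and> Q r \<le> \<beta> + 2 * e" if "0 < e" for e
    using lower[OF that] S
  proof eventually_elim
    case (elim r)
    have P: "0 < P r" using elim(1) exp_gt_zero[of "- ((\<beta> + 2 * e) * S r)"] by linarith
    have "- ((\<beta> + 2 * e) * S r) \<le> ln (P r)" using elim(1) P by (simp add: ln_ge_iff)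
    then show ?case using P elim(2) by (simp add: Q_def pos_divide_le_eq del: minus_divide_left divide_minus_left)
  qed
  have up: "\<forall>\<^sub>F r in F. \<alpha> - 2 * e \<le> Q r" if e: "0 < e" "e < \<alpha>" for e
    using upper[OF e] lo[OF e(1)] S
  proof eventually_elim
    case (elim r)
    have "ln (P r) \<le> - ((\<alpha> - 2 * e) * S r)" using elim(1,2) by (metis ln_exp ln_mono)
    then show ?case using elim(3) by (simp add: Q_def pos_le_divide_eq del: minus_divide_left divide_minus_left)
  qed
  \<comment> \<open>The ratio \<open>Q\<close> need not converge to either constant, so its
    deviation is clipped on the harmless side; the other side is controlled by \<open>up\<close> and
    \<open>lo\<close>.\<close>
  define \<delta>1 where "\<delta>1 r = min 0 (Q r - \<alpha>)" for r
  define \<delta>2 where "\<delta>2 r = max 0 (Q r - \<beta>)" for r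
  have "(\<delta>1 \<longlongrightarrow> 0) F"
  proof (rule tendstoI)
    fix e :: real assume "0 < e"
    define d where "d = min (e / 3) (\<alpha> / 2)"
    have d: "0 < d" "d < \<alpha>" "2 * d < e" using \<alpha> \<open>0 < e\<close> by (auto simp: d_def min_def)
    from up[OF d(1,2)] show "\<forall>\<^sub>F r in F. dist (\<delta>1 r) 0 < e"
      by eventually_elim (use d in \<open>auto simp: \<delta>1_def dist_real_def\<close>)
  qed
  moreover have "(\<delta>2 \<longlongrightarrow> 0) F"
  proof (rule tendstoI)
    fix e :: real assume e: "0 < e"
    from lo[of "e / 3"] e show "\<forall>\<^sub>F r in F. dist (\<delta>2 r) 0 < e"
      by (auto elim!: eventually_mono simp: \<delta>2_def dist_real_def)
  qed
  moreover have "\<forall>\<^sub>F r in F. 0 < P r \<and> (\<alpha> + \<delta>1 r) * S r \<le> - ln (P r) \<and> - ln (P r) \<le> (\<beta> + \<delta>2 r) * S r"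
    using lo[OF zero_less_one] S
  proof eventually_elim
    case (elim r)
    have QS: "Q r * S r = - ln (P r)" using elim(2) by (simp add: Q_def)
    have "(\<alpha> + \<delta>1 r) * S r \<le> Q r * S r" "Q r * S r \<le> (\<beta> + \<delta>2 r) * S r"
      using elim(2) by (auto intro!: mult_right_mono simp: \<delta>1_def \<delta>2_def)
    then show ?case using elim(1) QS by simp
  qed
  ultimately show ?thesis by blast
qed

theorem mainTheorem3:
  fixes M :: "'w measure"
    and \<zeta> :: "nat \<Rightarrow> 'w \<Rightarrow> complex"
    and a :: "nat \<Rightarrow> real"
    and L c1 C1 :: real
  assumes "prob_space M"
    and "prob_space.indep_vars M (\<lambda>_. borel) \<zeta> UNIV"
    and "\<And>n. std_complex_gaussian M (\<zeta> n)"
    and "0 < L" and "L < 1"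
    and "decseq a" and "\<And>n. 0 < a n" and "a 0 = 1"
    and "0 < c1" and "c1 \<le> C1"
    and "\<And>n. n \<ge> 1 \<Longrightarrow> c1 * real n powr (1 / 2 * (L - 1)) \<le> a n"
    and "\<And>n. n \<ge> 1 \<Longrightarrow> a n \<le> C1 * real n powr (1 / 2 * (L - 1))"
  shows "\<exists>\<epsilon>1 \<epsilon>2 :: real \<Rightarrow> real.
      (\<epsilon>1 \<longlongrightarrow> 0) (at_left 1) \<and> (\<epsilon>2 \<longlongrightarrow> 0) (at_left 1) \<and>
      (\<forall>\<^sub>F r in at_left 1.
         0 < measure M (Hole M \<zeta> a r) \<and>
         (1 - L + \<epsilon>1 r) / 2 * sigma_sq a r * ln (1 / (1 - r))
           \<le> - ln (measure M (Hole M \<zeta> a r)) \<and>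
         - ln (measure M (Hole M \<zeta> a r))
           \<le> (1 - L + \<epsilon>2 r) * sigma_sq a r * ln (1 / (1 - r)))"
proof -
  interpret power_law_coefficients a L c1 C1
    using assms(4-12) by unfold_locales
  have "\<forall>\<^sub>F r in at_left 1. measure M (Hole M \<zeta> a r) = measure gseq (Hole gseq coord a r)"
    using eventually_near_1
    by eventually_elim (use measure_Hole_eq_canonical[OF assms(1-3)] in auto)
  note eq = eventually_conj[OF this]
  have "0 < (1 - L) / 2" using \<open>L < 1\<close> by simp
  from asymptotic_coefficients_from_ratio[OF this eventually_sigma_sq_ln_pos
      hole_probability_upper_asymptotic hole_probability_lower_asymptotic]
  obtain \<delta>1 \<delta>2 where \<delta>: "(\<delta>1 \<longlongrightarrow> 0) (at_left 1)" "(\<delta>2 \<longlongrightarrow> 0) (at_left 1)"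
    and ev: "\<forall>\<^sub>F r in at_left 1. 0 < measure gseq (Hole gseq coord a r) \<and>
      ((1 - L) / 2 + \<delta>1 r) * (sigma_sq a r * ln (1 / (1 - r)))
        \<le> - ln (measure gseq (Hole gseq coord a r)) \<and>
      - ln (measure gseq (Hole gseq coord a r))
        \<le> (1 - L + \<delta>2 r) * (sigma_sq a r * ln (1 / (1 - r)))"
    by blast
  \<comment> \<open>The factor 2 appears because the error stands inside the quotient:
    \<open>(1 - L) / 2 + \<delta>1 r = (1 - L + 2 * \<delta>1 r) / 2\<close>.\<close>
  have "((\<lambda>r. 2 * \<delta>1 r) \<longlongrightarrow> 0) (at_left 1)" using tendsto_mult_left[OF \<delta>(1), of 2] by simp
  with \<delta>(2) eq[OF ev] show ?thesis
    by (intro exI[of _ "\<lambda>r. 2 * \<delta>1 r"] exI[of _ \<delta>2])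
      (auto elim!: eventually_mono simp: add_divide_distrib mult.assoc)
qed

end
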